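(* Let $\mathcal A$ be a (small) precontextual category and $\mathcal C$ a contextual category. Let $\iota_{\mathcal A}:\mathcal A\to L(\mathcal A)$ be the reflection morphism of $\mathcal A$ into contextual categories. Then the contextual functor $$\mathcal C^{\iota_{\mathcal A}}:\mathcal C^{L(\mathcal A)}\longrightarrow\mathcal C^{\mathcal A}$$ induced by $\iota_{\mathcal A}$ (precomposition with $\iota_{\mathcal A}$) is an isomorphism.
   Context: A precontextual category $\mathcal C$ consists of: a category $|\mathcal C|$ (with a set of objects); a length function $\ell$ from objects to $\mathbb N$; a function $\partial$ from objects to objects with $\ell(\partial a)=\ell(a)-1$ if $\ell(a)\ge 1$ and $\partial a=a$ if $\ell(a)=0$; for each object $a$ with $\ell(a)\ge1$ a morphism $\mathbf p_a:a\to\partial a$; and a set $\mathbf Q$ of commutative squares in $|\mathcal C|$ having left side some $\mathbf p_a$ and right side some $\mathbf p_b$. A display map (written $\twoheadrightarrow$) is a finite, possibly empty, composite of maps $\mathbf p_a$; its length is $\ell(\text{domain})-\ell(\text{codomain})$. A distinguished square is a finite vertical composite of elements of $\mathbf Q$; length-1 distinguished squares are the elements of $\mathbf Q$. $\mathcal C$ is a contextual category if moreover: there is a unique object $1_{\mathcal C}$ of length $0$, and it is terminal; every element of $\mathbf Q$ is a pullback; $\mathbf Q$ contains the identity square of every $\mathbf p_a$ and is closed under horizontal composition; for every $a$ with $\ell(a)\ge 1$ and $f:b\to\partial a$ there is a unique element of $\mathbf Q$ with right side $\mathbf p_a$ and bottom $f$ (hence any display map has a unique distinguished pullback along any map into its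 codomain). A morphism (contextual functor) is a functor strictly preserving $\ell,\partial,\mathbf p$ and sending $\mathbf Q$ into $\mathbf Q$. $\mathrm{Precont}$, $\mathrm{Cont}$ are the categories of small precontextual, resp. contextual, categories and contextual functors; $L:\mathrm{Precont}\to\mathrm{Cont}$ is a left adjoint of the inclusion $\mathrm{Cont}\hookrightarrow\mathrm{Precont}$ (it exists), with unit $\iota$. Gap maps. In a contextual category, let $S$ be a commutative square with top $f':b'\to b$, bottom $f:a'\to a$, left side $b'\twoheadrightarrow a'$ and right side $p:b\twoheadrightarrow a$ display maps. Let $c$ be the top-left corner of the distinguished square with right side $p$ and bottom $f$. The induced map $b'\to c$ is the gap map of $S$; $S$ is a relative length-1 display map if its gap map is a length-1 display map. Exponential. For $\mathcal A$ precontextual and $\mathcal C$ contextual, $D(\mathcal A,\mathcal C)$ is the full subcategory of the functor category $|\mathcal C|^{|\mathcal A|}$ on functors preserving display maps (not necessarily their lengths) and sending every length-0 object to $1_{\mathcal C}$. An indexed sort is a natural transformation $\pi:G\Rightarrow F$ in $D(\mathcal A,\mathcal C)$ such that: (i) for each $a$ with $\ell(a)\ge1$ the naturality square at $\mathbf p_a$ (top $\pi_a$, bottom $\pi_{\partial a}$, sides $G(\mathbf p_a),F(\mathbf p_a)$) is a relative length-1 display map; (ii) for each square in $\mathbf Q$ of $\mathcal A$ with top $f':a\to b$ and sides $\mathbf p_a,\mathbf p_b$, if $G(a)\twoheadrightarrow x$, $G(b)\twoheadrightarrow y$ are the gap maps of the naturality squares at $\mathbf p_a,\mathbf p_b$,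 then the square with these sides, top $G(f')$ and bottom the induced map $x\to y$ is distinguished. An indexed distinguished square is a commutative square in $D(\mathcal A,\mathcal C)$ with top $\alpha':G'\Rightarrow G$, bottom $\alpha:F'\Rightarrow F$ and sides indexed sorts $\pi':G'\Rightarrow F'$, $\pi:G\Rightarrow F$, such that for each $a$ with $\ell(a)\ge 1$, if $G'(a)\twoheadrightarrow y$ and $G(a)\twoheadrightarrow x$ are the gap maps of the naturality squares of $\pi',\pi$ at $\mathbf p_a$, the square with these sides, top $\alpha'_a$ and bottom the induced map $y\to x$ is distinguished. The exponential $\mathcal C^{\mathcal A}$ is the contextual category whose length-$n$ objects are chains $F_n\to\cdots\to F_1\to F_0$ of indexed sorts in $D(\mathcal A,\mathcal C)$ with $F_0$ constant at $1_{\mathcal C}$; morphisms $(F_i)_{i\le n}\to(G_i)_{i\le m}$ are natural transformations $F_n\Rightarrow G_m$; $\partial$ removes $F_n$, with display map $F_n\to F_{n-1}$; elements of $\mathbf Q$ are the squares whose underlying square of natural transformations is an indexed distinguished square. A morphism $U:\mathcal A\to\mathcal A'$ of precontextual categories induces a contextual functor $\mathcal C^U:\mathcal C^{\mathcal A'}\to\mathcal C^{\mathcal A}$ by precomposing functors and natural transformations with $U$. *)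

theory Defs
  imports "HOL-Library.FuncSet"
begin

text \<open>
  Categories and functors are records whose operations are only meaningful on their carriers.
  Functors, natural transformations and chains are morphisms or objects of further categories, so
  they are kept extensional (\<open>undefined\<close> off the carrier) and HOL equality is the intended equality.
\<close>

section \<open>Categories\<close>

record ('o, 'm) cat =
  Ob :: "'o set"
  Ar :: "'m set"
  Src :: "'m \<Rightarrow> 'o"
  Tgt :: "'m \<Rightarrow> 'o"
  Idn :: "'o \<Rightarrow> 'm"
  Cmp :: "'m \<Rightarrow> 'm \<Rightarrow> 'm" (infixl "\<cdot>\<index>" 70)

definition hom :: "('o, 'm, 'x) cat_scheme \<Rightarrow> 'o \<Rightarrow> 'o \<Rightarrow> 'm set" where
  "hom C a b = {f \<in> Ar C. Src C f = a \<and> Tgt C f = b}"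

locale category =
  fixes C :: "('o, 'm, 'x) cat_scheme" (structure)
  assumes src_Ob: "f \<in> Ar C \<Longrightarrow> Src C f \<in> Ob C"
    and tgt_Ob: "f \<in> Ar C \<Longrightarrow> Tgt C f \<in> Ob C"
    and idn_hom: "a \<in> Ob C \<Longrightarrow> Idn C a \<in> hom C a a"
    and cmp_hom: "f \<in> hom C a b \<Longrightarrow> g \<in> hom C b c \<Longrightarrow> g \<cdot> f \<in> hom C a c"
    and cmp_idn: "f \<in> hom C a b \<Longrightarrow> f \<cdot> Idn C a = f"
    and idn_cmp: "f \<in> hom C a b \<Longrightarrow> Idn C b \<cdot> f = f"
    and cmp_assoc: "f \<in> hom C a b \<Longrightarrow> g \<in> hom C b c \<Longrightarrow> h \<in> hom C c d \<Longrightarrow>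
                    h \<cdot> (g \<cdot> f) = (h \<cdot> g) \<cdot> f"

definition terminal :: "('o, 'm, 'x) cat_scheme \<Rightarrow> 'o \<Rightarrow> bool" where
  "terminal C t \<longleftrightarrow> t \<in> Ob C \<and> (\<forall>a \<in> Ob C. \<exists>!f. f \<in> hom C a t)"

record 'm square =
  sTop :: 'm
  sBot :: 'm
  sLft :: 'm
  sRgt :: 'm

definition map_square :: "('m \<Rightarrow> 'n) \<Rightarrow> 'm square \<Rightarrow> 'n square" where
  "map_square h S = \<lparr>sTop = h (sTop S), sBot = h (sBot S), sLft = h (sLft S), sRgt = h (sRgt S)\<rparr>"

definition comm_square :: "('o, 'm, 'x) cat_scheme \<Rightarrow> 'm square \<Rightarrow> bool" where
  "comm_square C S \<longleftrightarrow>
     sTop S \<in> Ar C \<and> sBot S \<in> Ar C \<and> sLft S \<in> Ar C \<and> sRgt S \<in> Ar C \<and>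
     Src C (sLft S) = Src C (sTop S) \<and> Src C (sRgt S) = Tgt C (sTop S) \<and>
     Tgt C (sLft S) = Src C (sBot S) \<and> Tgt C (sRgt S) = Tgt C (sBot S) \<and>
     sRgt S \<cdot>\<^bsub>C\<^esub> sTop S = sBot S \<cdot>\<^bsub>C\<^esub> sLft S"

definition pullback :: "('o, 'm, 'x) cat_scheme \<Rightarrow> 'm square \<Rightarrow> bool" where
  "pullback C S \<longleftrightarrow> comm_square C S \<and>
     (\<forall>z u v. u \<in> hom C z (Src C (sBot S)) \<longrightarrow> v \<in> hom C z (Src C (sRgt S)) \<longrightarrow>
        sBot S \<cdot>\<^bsub>C\<^esub> u = sRgt S \<cdot>\<^bsub>C\<^esub> v \<longrightarrow>
        (\<exists>!h. h \<in> hom C z (Src C (sTop S)) \<and> sLft S \<cdot>\<^bsub>C\<^esub> h = u \<and> sTop S \<cdot>\<^bsub>C\<^esub> h = v))"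

record ('o, 'm, 'p, 'n) fctr =
  Fo :: "'o \<Rightarrow> 'p"
  Fa :: "'m \<Rightarrow> 'n"

definition functors ::
  "('o, 'm, 'x) cat_scheme \<Rightarrow> ('p, 'n, 'y) cat_scheme \<Rightarrow> ('o, 'm, 'p, 'n) fctr set" where
  "functors A B = {F. Fo F \<in> Ob A \<rightarrow>\<^sub>E Ob B \<and> Fa F \<in> Ar A \<rightarrow>\<^sub>E Ar B \<and>
     (\<forall>f \<in> Ar A. Fa F f \<in> hom B (Fo F (Src A f)) (Fo F (Tgt A f))) \<and>
     (\<forall>a \<in> Ob A. Fa F (Idn A a) = Idn B (Fo F a)) \<and>
     (\<forall>f \<in> Ar A. \<forall>g \<in> Ar A. Src A g = Tgt A f \<longrightarrow>
        Fa F (g \<cdot>\<^bsub>A\<^esub> f) = Fa F g \<cdot>\<^bsub>B\<^esub> Fa F f)}"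

definition id_fctr :: "('o, 'm, 'x) cat_scheme \<Rightarrow> ('o, 'm, 'o, 'm) fctr" where
  "id_fctr A = \<lparr>Fo = (\<lambda>a \<in> Ob A. a), Fa = (\<lambda>f \<in> Ar A. f)\<rparr>"

definition comp_fctr ::
  "('o, 'm, 'x) cat_scheme \<Rightarrow> ('p, 'n, 'q, 'k) fctr \<Rightarrow> ('o, 'm, 'p, 'n) fctr \<Rightarrow> ('o, 'm, 'q, 'k) fctr"
  where
  "comp_fctr A G F = \<lparr>Fo = compose (Ob A) (Fo G) (Fo F), Fa = compose (Ar A) (Fa G) (Fa F)\<rparr>"

record ('o, 'm, 'p, 'n) ntrans =
  NDom :: "('o, 'm, 'p, 'n) fctr"
  NCod :: "('o, 'm, 'p, 'n) fctr"
  NCmp :: "'o \<Rightarrow> 'n"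

definition natsq ::
  "('o, 'm, 'x) cat_scheme \<Rightarrow> ('o, 'm, 'p, 'n) ntrans \<Rightarrow> 'm \<Rightarrow> 'n square" where
  "natsq A \<pi> f = \<lparr>sTop = NCmp \<pi> (Src A f), sBot = NCmp \<pi> (Tgt A f),
                  sLft = Fa (NDom \<pi>) f, sRgt = Fa (NCod \<pi>) f\<rparr>"

definition fun_cat ::
  "('o, 'm, 'x) cat_scheme \<Rightarrow> ('p, 'n, 'y) cat_scheme \<Rightarrow>
   (('o, 'm, 'p, 'n) fctr, ('o, 'm, 'p, 'n) ntrans) cat" where
  "fun_cat A B =
     \<lparr>Ob = functors A B,
      Ar = {\<tau>. NDom \<tau> \<in> functors A B \<and> NCod \<tau> \<in> functors A B \<and>
               NCmp \<tau> \<in> extensional (Ob A) \<and>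
               (\<forall>a \<in> Ob A. NCmp \<tau> a \<in> hom B (Fo (NDom \<tau>) a) (Fo (NCod \<tau>) a)) \<and>
               (\<forall>f \<in> Ar A. comm_square B (natsq A \<tau> f))},
      Src = NDom,
      Tgt = NCod,
      Idn = (\<lambda>F. \<lparr>NDom = F, NCod = F, NCmp = (\<lambda>a \<in> Ob A. Idn B (Fo F a))\<rparr>),
      Cmp = (\<lambda>\<tau> \<sigma>. \<lparr>NDom = NDom \<sigma>, NCod = NCod \<tau>,
                    NCmp = (\<lambda>a \<in> Ob A. NCmp \<tau> a \<cdot>\<^bsub>B\<^esub> NCmp \<sigma> a)\<rparr>)\<rparr>"

definition full_subcat :: "('o, 'm) cat \<Rightarrow> 'o set \<Rightarrow> ('o, 'm) cat" where
  "full_subcat C X = C\<lparr>Ob := Ob C \<inter> X, Ar := {f \<in> Ar C. Src C f \<in> X \<and> Tgt C f \<in> X}\<rparr>"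

section \<open>Precontextual and contextual categories\<close>

record ('o, 'm) ctx = "('o, 'm) cat" +
  Len :: "'o \<Rightarrow> nat"
  Ft :: "'o \<Rightarrow> 'o"
  Pr :: "'o \<Rightarrow> 'm"
  QQ :: "'m square set"

locale precontextual = category C for C :: "('o, 'm, 'x) ctx_scheme" (structure) +
  assumes ft_Ob: "a \<in> Ob C \<Longrightarrow> Ft C a \<in> Ob C"
    and len_ft: "a \<in> Ob C \<Longrightarrow> 1 \<le> Len C a \<Longrightarrow> Len C (Ft C a) = Len C a - 1"
    and ft_len0: "a \<in> Ob C \<Longrightarrow> Len C a = 0 \<Longrightarrow> Ft C a = a"
    and pr_hom: "a \<in> Ob C \<Longrightarrow> 1 \<le> Len C a \<Longrightarrow> Pr C a \<in> hom C a (Ft C a)"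
    and Q_comm: "S \<in> QQ C \<Longrightarrow> comm_square C S"
    and Q_lft: "S \<in> QQ C \<Longrightarrow> \<exists>a \<in> Ob C. 1 \<le> Len C a \<and> sLft S = Pr C a"
    and Q_rgt: "S \<in> QQ C \<Longrightarrow> \<exists>b \<in> Ob C. 1 \<le> Len C b \<and> sRgt S = Pr C b"

locale contextual = precontextual C for C :: "('o, 'm, 'x) ctx_scheme" (structure) +
  assumes len0_unique: "\<exists>!a. a \<in> Ob C \<and> Len C a = 0"
    and len0_terminal: "a \<in> Ob C \<Longrightarrow> Len C a = 0 \<Longrightarrow> terminal C a"
    and Q_pullback: "S \<in> QQ C \<Longrightarrow> pullback C S"
    and Q_id: "a \<in> Ob C \<Longrightarrow> 1 \<le> Len C a \<Longrightarrow>
        \<lparr>sTop = Idn C a, sBot = Idn C (Ft C a), sLft = Pr C a, sRgt = Pr C a\<rparr> \<in> QQ C"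
    and Q_horizontal: "S \<in> QQ C \<Longrightarrow> T \<in> QQ C \<Longrightarrow> sRgt S = sLft T \<Longrightarrow>
        \<lparr>sTop = sTop T \<cdot> sTop S, sBot = sBot T \<cdot> sBot S, sLft = sLft S, sRgt = sRgt T\<rparr> \<in> QQ C"
    and Q_lift: "a \<in> Ob C \<Longrightarrow> 1 \<le> Len C a \<Longrightarrow> f \<in> Ar C \<Longrightarrow> Tgt C f = Ft C a \<Longrightarrow>
        \<exists>!S. S \<in> QQ C \<and> sRgt S = Pr C a \<and> sBot S = f"

definition one :: "('o, 'm, 'x) ctx_scheme \<Rightarrow> 'o" where
  "one C = (THE a. a \<in> Ob C \<and> Len C a = 0)"

inductive_set displays :: "('o, 'm, 'x) ctx_scheme \<Rightarrow> 'm set" for C :: "('o, 'm, 'x) ctx_scheme"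
  where
  displays_id: "a \<in> Ob C \<Longrightarrow> Idn C a \<in> displays C"
| displays_step: "a \<in> Ob C \<Longrightarrow> 1 \<le> Len C a \<Longrightarrow> f \<in> displays C \<Longrightarrow> Src C f = Ft C a \<Longrightarrow>
    f \<cdot>\<^bsub>C\<^esub> Pr C a \<in> displays C"

definition display_length :: "('o, 'm, 'x) ctx_scheme \<Rightarrow> 'm \<Rightarrow> nat" where
  "display_length C f = Len C (Src C f) - Len C (Tgt C f)"

text \<open>
  The empty vertical composite (identity sides) counts as distinguished: display maps may be
  empty composites, and these must have distinguished pullbacks too.
\<close>

inductive_set distinguished :: "('o, 'm, 'x) ctx_scheme \<Rightarrow> 'm square set"
  for C :: "('o, 'm, 'x) ctx_scheme"
  where
  distinguished_id: "f \<in> Ar C \<Longrightarrow>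
    \<lparr>sTop = f, sBot = f, sLft = Idn C (Src C f), sRgt = Idn C (Tgt C f)\<rparr> \<in> distinguished C"
| distinguished_step: "S \<in> QQ C \<Longrightarrow> T \<in> distinguished C \<Longrightarrow> sBot S = sTop T \<Longrightarrow>
    \<lparr>sTop = sTop S, sBot = sBot T,
     sLft = sLft T \<cdot>\<^bsub>C\<^esub> sLft S, sRgt = sRgt T \<cdot>\<^bsub>C\<^esub> sRgt S\<rparr> \<in> distinguished C"

definition ctx_functors ::
  "('o, 'm, 'x) ctx_scheme \<Rightarrow> ('p, 'n, 'y) ctx_scheme \<Rightarrow> ('o, 'm, 'p, 'n) fctr set" where
  "ctx_functors A B = {F \<in> functors A B.
     (\<forall>a \<in> Ob A. Len B (Fo F a) = Len A a) \<and>
     (\<forall>a \<in> Ob A. Fo F (Ft A a) = Ft B (Fo F a)) \<and>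
     (\<forall>a \<in> Ob A. 1 \<le> Len A a \<longrightarrow> Fa F (Pr A a) = Pr B (Fo F a)) \<and>
     (\<forall>S \<in> QQ A. map_square (Fa F) S \<in> QQ B)}"

definition ctx_iso ::
  "('o, 'm, 'x) ctx_scheme \<Rightarrow> ('p, 'n, 'y) ctx_scheme \<Rightarrow> ('o, 'm, 'p, 'n) fctr \<Rightarrow> bool" where
  "ctx_iso A B F \<longleftrightarrow> F \<in> ctx_functors A B \<and>
     (\<exists>G \<in> ctx_functors B A. comp_fctr A G F = id_fctr A \<and> comp_fctr B F G = id_fctr B)"

text \<open>
  The pair \<open>(L, \<iota>)\<close> is a reflection of \<open>A\<close>: the component at \<open>A\<close> of the unit of a left adjoint to
  the inclusion of contextual into precontextual categories.  HOL cannot quantify over types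
  inside a formula, so small means: objects and morphisms are drawn from the type \<open>'u\<close>.  For
  infinite \<open>'u\<close> this means cardinality at most that of \<open>'u\<close>; as \<open>A\<close> generates \<open>L\<close>, and also the part
  of any \<open>D\<close> that a functor out of \<open>L\<close> reaches, the choice of such a \<open>'u\<close> is immaterial.
\<close>

definition reflection :: "('u, 'u) ctx \<Rightarrow> ('u, 'u) ctx \<Rightarrow> ('u, 'u, 'u, 'u) fctr \<Rightarrow> bool" where
  "reflection A L \<iota> \<longleftrightarrow> contextual L \<and> \<iota> \<in> ctx_functors A L \<and>
     (\<forall>D :: ('u, 'u) ctx. contextual D \<longrightarrow>
        (\<forall>F \<in> ctx_functors A D. \<exists>!G. G \<in> ctx_functors L D \<and> comp_fctr A G \<iota> = F))"

section \<open>Gap maps\<close>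

text \<open>The definite descriptions are well defined in contextual categories.\<close>

definition dpull :: "('o, 'm, 'x) ctx_scheme \<Rightarrow> 'm \<Rightarrow> 'm \<Rightarrow> 'm square" where
  "dpull C p f = (THE T. T \<in> distinguished C \<and> sRgt T = p \<and> sBot T = f)"

text \<open>The distinguished square with the same right side and bottom as \<open>S\<close>.\<close>

definition dsq :: "('o, 'm, 'x) ctx_scheme \<Rightarrow> 'm square \<Rightarrow> 'm square" where
  "dsq C S = dpull C (sRgt S) (sBot S)"

definition corner :: "('o, 'm, 'x) ctx_scheme \<Rightarrow> 'm square \<Rightarrow> 'o" where
  "corner C S = Src C (sTop (dsq C S))"

definition gap :: "('o, 'm, 'x) ctx_scheme \<Rightarrow> 'm square \<Rightarrow> 'm" where
  "gap C S = (THE g. g \<in> hom C (Src C (sTop S)) (corner C S) \<and>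
     sLft (dsq C S) \<cdot>\<^bsub>C\<^esub> g = sLft S \<and> sTop (dsq C S) \<cdot>\<^bsub>C\<^esub> g = sTop S)"

definition rel_display1 :: "('o, 'm, 'x) ctx_scheme \<Rightarrow> 'm square \<Rightarrow> bool" where
  "rel_display1 C S \<longleftrightarrow> comm_square C S \<and> sLft S \<in> displays C \<and> sRgt S \<in> displays C \<and>
     gap C S \<in> displays C \<and> display_length C (gap C S) = 1"

text \<open>
  The map between the corners of \<open>S\<close> and \<open>T\<close> induced by \<open>u\<close> on bottom-left and \<open>v\<close> on top-right
  vertices.
\<close>

definition corner_map ::
  "('o, 'm, 'x) ctx_scheme \<Rightarrow> 'm square \<Rightarrow> 'm square \<Rightarrow> 'm \<Rightarrow> 'm \<Rightarrow> 'm" where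
  "corner_map C S T u v = (THE h. h \<in> hom C (corner C S) (corner C T) \<and>
     sLft (dsq C T) \<cdot>\<^bsub>C\<^esub> h = u \<cdot>\<^bsub>C\<^esub> sLft (dsq C S) \<and>
     sTop (dsq C T) \<cdot>\<^bsub>C\<^esub> h = v \<cdot>\<^bsub>C\<^esub> sTop (dsq C S))"

section \<open>The exponential\<close>

definition disp_fun_cat ::
  "('o, 'm, 'x) ctx_scheme \<Rightarrow> ('p, 'n, 'y) ctx_scheme \<Rightarrow>
   (('o, 'm, 'p, 'n) fctr, ('o, 'm, 'p, 'n) ntrans) cat" where
  "disp_fun_cat A C = full_subcat (fun_cat A C)
     {F. (\<forall>f \<in> displays A. Fa F f \<in> displays C) \<and>
         (\<forall>a \<in> Ob A. Len A a = 0 \<longrightarrow> Fo F a = one C)}"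

definition indexed_sort ::
  "('o, 'm, 'x) ctx_scheme \<Rightarrow> ('p, 'n, 'y) ctx_scheme \<Rightarrow> ('o, 'm, 'p, 'n) ntrans \<Rightarrow> bool" where
  "indexed_sort A C \<pi> \<longleftrightarrow> \<pi> \<in> Ar (disp_fun_cat A C) \<and>
     (\<forall>a \<in> Ob A. 1 \<le> Len A a \<longrightarrow> rel_display1 C (natsq A \<pi> (Pr A a))) \<and>
     (\<forall>S \<in> QQ A.
        let N = natsq A \<pi> (sLft S); M = natsq A \<pi> (sRgt S) in
        \<lparr>sTop = Fa (NDom \<pi>) (sTop S),
         sBot = corner_map C N M (Fa (NDom \<pi>) (sBot S)) (Fa (NCod \<pi>) (sTop S)),
         sLft = gap C N,
         sRgt = gap C M\<rparr> \<in> distinguished C)"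

definition indexed_distinguished ::
  "('o, 'm, 'x) ctx_scheme \<Rightarrow> ('p, 'n, 'y) ctx_scheme \<Rightarrow> ('o, 'm, 'p, 'n) ntrans square \<Rightarrow> bool" where
  "indexed_distinguished A C S \<longleftrightarrow> comm_square (disp_fun_cat A C) S \<and>
     indexed_sort A C (sLft S) \<and> indexed_sort A C (sRgt S) \<and>
     (\<forall>a \<in> Ob A. 1 \<le> Len A a \<longrightarrow>
        (let N = natsq A (sLft S) (Pr A a); M = natsq A (sRgt S) (Pr A a) in
         \<lparr>sTop = NCmp (sTop S) a,
          sBot = corner_map C N M (NCmp (sTop S) (Ft A a)) (NCmp (sBot S) a),
          sLft = gap C N,
          sRgt = gap C M\<rparr> \<in> distinguished C))"

definition const_one ::
  "('o, 'm, 'x) ctx_scheme \<Rightarrow> ('p, 'n, 'y) ctx_scheme \<Rightarrow> ('o, 'm, 'p, 'n) fctr" where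
  "const_one A C = \<lparr>Fo = (\<lambda>a \<in> Ob A. one C), Fa = (\<lambda>f \<in> Ar A. Idn C (one C))\<rparr>"

text \<open>
  A chain \<open>F\<^sub>n \<rightarrow> \<dots> \<rightarrow> F\<^sub>1 \<rightarrow> F\<^sub>0\<close> is the list of its \<open>n\<close> indexed sorts, the one with domain \<open>F\<^sub>n\<close>
  first; the empty list is the chain consisting of \<open>F\<^sub>0\<close> only.
\<close>

fun chain_top ::
  "('o, 'm, 'x) ctx_scheme \<Rightarrow> ('p, 'n, 'y) ctx_scheme \<Rightarrow> ('o, 'm, 'p, 'n) ntrans list \<Rightarrow>
   ('o, 'm, 'p, 'n) fctr" where
  "chain_top A C [] = const_one A C"
| "chain_top A C (\<pi> # xs) = NDom \<pi>"

fun is_chain ::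
  "('o, 'm, 'x) ctx_scheme \<Rightarrow> ('p, 'n, 'y) ctx_scheme \<Rightarrow> ('o, 'm, 'p, 'n) ntrans list \<Rightarrow> bool" where
  "is_chain A C [] \<longleftrightarrow> True"
| "is_chain A C (\<pi> # xs) \<longleftrightarrow> is_chain A C xs \<and> indexed_sort A C \<pi> \<and> NCod \<pi> = chain_top A C xs"

record ('o, 'm, 'p, 'n) chain_map =
  XSrc :: "('o, 'm, 'p, 'n) ntrans list"
  XTgt :: "('o, 'm, 'p, 'n) ntrans list"
  XNt :: "('o, 'm, 'p, 'n) ntrans"

definition chain_cat ::
  "('o, 'm, 'x) ctx_scheme \<Rightarrow> ('p, 'n, 'y) ctx_scheme \<Rightarrow>
   (('o, 'm, 'p, 'n) ntrans list, ('o, 'm, 'p, 'n) chain_map) cat" where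
  "chain_cat A C =
     \<lparr>Ob = {xs. is_chain A C xs},
      Ar = {f. is_chain A C (XSrc f) \<and> is_chain A C (XTgt f) \<and>
               XNt f \<in> hom (disp_fun_cat A C) (chain_top A C (XSrc f)) (chain_top A C (XTgt f))},
      Src = XSrc,
      Tgt = XTgt,
      Idn = (\<lambda>xs. \<lparr>XSrc = xs, XTgt = xs, XNt = Idn (disp_fun_cat A C) (chain_top A C xs)\<rparr>),
      Cmp = (\<lambda>g f. \<lparr>XSrc = XSrc f, XTgt = XTgt g,
                    XNt = XNt g \<cdot>\<^bsub>disp_fun_cat A C\<^esub> XNt f\<rparr>)\<rparr>"

definition chain_proj :: "('o, 'm, 'p, 'n) ntrans list \<Rightarrow> ('o, 'm, 'p, 'n) chain_map" where
  "chain_proj xs = \<lparr>XSrc = xs, XTgt = tl xs, XNt = hd xs\<rparr>"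

definition exponential ::
  "('o, 'm, 'x) ctx_scheme \<Rightarrow> ('p, 'n, 'y) ctx_scheme \<Rightarrow>
   (('o, 'm, 'p, 'n) ntrans list, ('o, 'm, 'p, 'n) chain_map) ctx" where
  "exponential A C =
     \<lparr>Ob = Ob (chain_cat A C),
      Ar = Ar (chain_cat A C),
      Src = Src (chain_cat A C),
      Tgt = Tgt (chain_cat A C),
      Idn = Idn (chain_cat A C),
      Cmp = Cmp (chain_cat A C),
      Len = length,
      Ft = tl,
      Pr = chain_proj,
      QQ = {S. comm_square (chain_cat A C) S \<and>
               (\<exists>xs. is_chain A C xs \<and> 1 \<le> length xs \<and> sLft S = chain_proj xs) \<and>
               (\<exists>ys. is_chain A C ys \<and> 1 \<le> length ys \<and> sRgt S = chain_proj ys) \<and>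
               indexed_distinguished A C (map_square XNt S)}\<rparr>"

definition whisker ::
  "('o, 'm, 'x) cat_scheme \<Rightarrow> ('q, 'k, 'p, 'n) ntrans \<Rightarrow> ('o, 'm, 'q, 'k) fctr \<Rightarrow>
   ('o, 'm, 'p, 'n) ntrans" where
  "whisker A \<tau> U = \<lparr>NDom = comp_fctr A (NDom \<tau>) U, NCod = comp_fctr A (NCod \<tau>) U,
                    NCmp = compose (Ob A) (NCmp \<tau>) (Fo U)\<rparr>"

text \<open>For \<open>U : A \<rightarrow> B\<close>, the functor \<open>C\<^sup>U : C\<^sup>B \<rightarrow> C\<^sup>A\<close>.\<close>

definition exponential_map ::
  "('o, 'm, 'x) ctx_scheme \<Rightarrow> ('q, 'k, 'y) ctx_scheme \<Rightarrow> ('p, 'n, 'z) ctx_scheme \<Rightarrow>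
   ('o, 'm, 'q, 'k) fctr \<Rightarrow>
   (('q, 'k, 'p, 'n) ntrans list, ('q, 'k, 'p, 'n) chain_map,
    ('o, 'm, 'p, 'n) ntrans list, ('o, 'm, 'p, 'n) chain_map) fctr" where
  "exponential_map A B C U =
     (let pre = map (\<lambda>\<pi>. whisker A \<pi> U) in
      \<lparr>Fo = (\<lambda>xs \<in> Ob (exponential B C). pre xs),
       Fa = (\<lambda>f \<in> Ar (exponential B C).
               \<lparr>XSrc = pre (XSrc f), XTgt = pre (XTgt f), XNt = whisker A (XNt f) U\<rparr>)\<rparr>)"

end

(*
  A functor from a contextual category L that is free on A can be built by a universal property
  whenever the data to be extended can be packaged as a contextual category.  Given a category K with
  a terminal object, a class of arrows (sorts) and a class of pullback squares that is closed
  under horizontal composition and has unique lifts, the finite chains of sorts form a contextual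
  category, and contextual functors into it are the functors T into K (models) that send projections
  to sorts and squares in Q to squares.  Hence models on A extend uniquely to L.

  This applies three times, for F, G : L -> C.
  (1) K = comma category of C over F: models over iota are the indexed sorts over F o iota.
  (2) K = objects a of L with a map F a -> G a: models are natural transformations.  Unique lifts
      hold as soon as G sends Q to pullbacks, which is true for the functor on top of a chain.
  (3) K = L with only those projections that satisfy a predicate: this is induction over L, and it
      shows that being an indexed distinguished square can be tested on A, by cancellation.
  So precomposition with iota is bijective on objects by (1), on morphisms by (2), and reflects Q by (3).
*)
theory Submission
  imports Defs
begin

section \<open>Categories and pullbacks\<close>

text \<open>\<open>L\<close> is known only through the contextual axioms and its universal property,
  and the latter produces contextual functors and nothing else. An object of \<open>K\<close> has no
  length and no father; a chain of sorts supplies both, so contextual functors into chains amount to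
  models. An extended model lies over \<open>L\<close> for a reason that its construction does not
  show: projecting it back gives a contextual endofunctor of \<open>L\<close> under
  \<open>\<iota>\<close>, and there is only one. In (1) the difficulty is that comma squares must be
  pullbacks although only their squares of gap maps are distinguished; the pullback in
  \<open>L\<close> and the one in \<open>C\<close> have to be used in turn. In (2) a lift needs a
  component at a new vertex, and an arbitrary \<open>G\<close> gives no means to produce it; along a
  chain the required property passes from the codomain of an indexed sort to its domain. In (3) the
  induction step is a cube whose faces lie in \<open>QQ\<close> except one. The universal property
  speaks of categories on the type \<open>'u\<close> alone, so pairs and lists over
  \<open>'u\<close> must embed in \<open>'u\<close>, which is why \<open>'u\<close> is
  infinite.\<close>

lemma hom_iff: "f \<in> hom C a b \<longleftrightarrow> f \<in> Ar C \<and> Src C f = a \<and> Tgt C f = b"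
  by (simp add: hom_def)

lemma in_hom: "f \<in> Ar C \<Longrightarrow> f \<in> hom C (Src C f) (Tgt C f)"
  by (simp add: hom_def)

context category
begin

lemma Ob_Src [simp]: "f \<in> Ar C \<Longrightarrow> Src C f \<in> Ob C"
  by (rule src_Ob)

lemma Ob_Tgt [simp]: "f \<in> Ar C \<Longrightarrow> Tgt C f \<in> Ob C"
  by (rule tgt_Ob)

lemma Ar_Idn [simp]: "a \<in> Ob C \<Longrightarrow> Idn C a \<in> Ar C"
  and Src_Idn [simp]: "a \<in> Ob C \<Longrightarrow> Src C (Idn C a) = a"
  and Tgt_Idn [simp]: "a \<in> Ob C \<Longrightarrow> Tgt C (Idn C a) = a"
  using idn_hom[of a] by (simp_all add: hom_def)

lemma Ar_Cmp [simp]: "f \<in> Ar C \<Longrightarrow> g \<in> Ar C \<Longrightarrow> Src C g = Tgt C f \<Longrightarrow> g \<cdot> f \<in> Ar C"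
  and Src_Cmp [simp]: "f \<in> Ar C \<Longrightarrow> g \<in> Ar C \<Longrightarrow> Src C g = Tgt C f \<Longrightarrow> Src C (g \<cdot> f) = Src C f"
  and Tgt_Cmp [simp]: "f \<in> Ar C \<Longrightarrow> g \<in> Ar C \<Longrightarrow> Src C g = Tgt C f \<Longrightarrow> Tgt C (g \<cdot> f) = Tgt C g"
  using cmp_hom[of f "Src C f" "Tgt C f" g "Tgt C g"] by (simp_all add: hom_def)

lemma Cmp_Idn [simp]: "f \<in> Ar C \<Longrightarrow> Src C f = a \<Longrightarrow> f \<cdot> Idn C a = f"
  using cmp_idn[OF in_hom, of f] by simp

lemma Idn_Cmp [simp]: "f \<in> Ar C \<Longrightarrow> Tgt C f = a \<Longrightarrow> Idn C a \<cdot> f = f"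
  using idn_cmp[OF in_hom, of f] by simp

lemma Cmp_assoc: "f \<in> Ar C \<Longrightarrow> g \<in> Ar C \<Longrightarrow> h \<in> Ar C \<Longrightarrow> Src C g = Tgt C f \<Longrightarrow>
    Src C h = Tgt C g \<Longrightarrow> (h \<cdot> g) \<cdot> f = h \<cdot> (g \<cdot> f)"
  using cmp_assoc[of f "Src C f" "Tgt C f" g "Tgt C g" h "Tgt C h"] by (simp add: hom_def)

text \<open>Replaces a known composite inside a product bracketed to the right. The diagram chases
  below alternate this rule with \<open>Cmp_assoc\<close>.\<close>

lemma Cmp_reassoc: "h \<cdot> g = k \<Longrightarrow> f \<in> Ar C \<Longrightarrow> g \<in> Ar C \<Longrightarrow> h \<in> Ar C \<Longrightarrow> Src C g = Tgt C f \<Longrightarrow>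
    Src C h = Tgt C g \<Longrightarrow> h \<cdot> (g \<cdot> f) = k \<cdot> f"
  using Cmp_assoc[of f g h] by simp

end

section \<open>Commutative squares and pullbacks: lifting, uniqueness, pasting\<close>

lemma comm_squareD:
  assumes "comm_square C S"
  shows "sTop S \<in> Ar C" "sBot S \<in> Ar C" "sLft S \<in> Ar C" "sRgt S \<in> Ar C"
    "Src C (sLft S) = Src C (sTop S)" "Src C (sRgt S) = Tgt C (sTop S)"
    "Tgt C (sLft S) = Src C (sBot S)" "Tgt C (sRgt S) = Tgt C (sBot S)"
    "sRgt S \<cdot>\<^bsub>C\<^esub> sTop S = sBot S \<cdot>\<^bsub>C\<^esub> sLft S"
  using assms by (simp_all add: comm_square_def)

lemma pullback_comm: "pullback C S \<Longrightarrow> comm_square C S"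
  by (simp add: pullback_def)

lemma pullback_lift:
  assumes "pullback C S" "u \<in> hom C z (Src C (sBot S))" "v \<in> hom C z (Src C (sRgt S))"
    "sBot S \<cdot>\<^bsub>C\<^esub> u = sRgt S \<cdot>\<^bsub>C\<^esub> v"
  obtains h where "h \<in> hom C z (Src C (sTop S))" "sLft S \<cdot>\<^bsub>C\<^esub> h = u" "sTop S \<cdot>\<^bsub>C\<^esub> h = v"
  using assms unfolding pullback_def by blast

context category
begin

lemma pullback_unique:
  assumes "pullback C S" and h: "h \<in> hom C z (Src C (sTop S))" and k: "k \<in> hom C z (Src C (sTop S))"
    and eq: "sLft S \<cdot> h = sLft S \<cdot> k" "sTop S \<cdot> h = sTop S \<cdot> k"
  shows "h = k"
proof -
  note S = comm_squareD[OF pullback_comm[OF assms(1)]]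
  have u: "sLft S \<cdot> h \<in> hom C z (Src C (sBot S))" and v: "sTop S \<cdot> h \<in> hom C z (Src C (sRgt S))"
    using S h by (auto simp: hom_iff)
  have "sBot S \<cdot> (sLft S \<cdot> h) = sRgt S \<cdot> (sTop S \<cdot> h)"
    using S h Cmp_assoc[of h "sLft S" "sBot S"] Cmp_assoc[of h "sTop S" "sRgt S"] by (simp add: hom_iff)
  then have "\<exists>!h'. h' \<in> hom C z (Src C (sTop S)) \<and> sLft S \<cdot> h' = sLft S \<cdot> h \<and> sTop S \<cdot> h' = sTop S \<cdot> h"
    using assms(1) u v unfolding pullback_def by blast
  then show ?thesis using h k eq by metis
qed

text \<open>Splits the unique existence into a lift and the joint monicity of the two projections,
  because the two come from different arguments in the categories built later.\<close>

lemma pullbackI: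
  assumes S: "comm_square C S"
    and ex: "\<And>z u v. u \<in> hom C z (Src C (sBot S)) \<Longrightarrow> v \<in> hom C z (Src C (sRgt S)) \<Longrightarrow>
        sBot S \<cdot> u = sRgt S \<cdot> v \<Longrightarrow>
        \<exists>h. h \<in> hom C z (Src C (sTop S)) \<and> sLft S \<cdot> h = u \<and> sTop S \<cdot> h = v"
    and un: "\<And>z h k. h \<in> hom C z (Src C (sTop S)) \<Longrightarrow> k \<in> hom C z (Src C (sTop S)) \<Longrightarrow>
        sLft S \<cdot> h = sLft S \<cdot> k \<Longrightarrow> sTop S \<cdot> h = sTop S \<cdot> k \<Longrightarrow> h = k"
  shows "pullback C S"
  unfolding pullback_def
proof (intro conjI allI impI S)
  fix z u v
  assume "u \<in> hom C z (Src C (sBot S))" "v \<in> hom C z (Src C (sRgt S))" "sBot S \<cdot> u = sRgt S \<cdot> v"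
  from ex[OF this] obtain h where "h \<in> hom C z (Src C (sTop S)) \<and> sLft S \<cdot> h = u \<and> sTop S \<cdot> h = v" ..
  then show "\<exists>!h. h \<in> hom C z (Src C (sTop S)) \<and> sLft S \<cdot> h = u \<and> sTop S \<cdot> h = v"
    using un by (intro ex1I[of _ h]) auto
qed

lemma comm_square_vertical:
  assumes "comm_square C S" "comm_square C T" "sBot S = sTop T"
  shows "comm_square C \<lparr>sTop = sTop S, sBot = sBot T, sLft = sLft T \<cdot> sLft S, sRgt = sRgt T \<cdot> sRgt S\<rparr>"
proof -
  note S = comm_squareD[OF assms(1)] and T = comm_squareD[OF assms(2)]
  have "sRgt T \<cdot> (sRgt S \<cdot> sTop S) = sRgt T \<cdot> (sTop T \<cdot> sLft S)" by (simp add: S(9) assms(3))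
  also have "\<dots> = (sRgt T \<cdot> sTop T) \<cdot> sLft S"
    using S(1-8) T(1-8) assms(3) by (simp add: Cmp_assoc)
  also have "\<dots> = (sBot T \<cdot> sLft T) \<cdot> sLft S" by (simp add: T(9))
  also have "\<dots> = sBot T \<cdot> (sLft T \<cdot> sLft S)"
    using S T(1-8) assms(3) by (simp add: Cmp_assoc)
  finally show ?thesis
    using S(1-8) T(1-8) assms(3) by (simp add: comm_square_def Cmp_assoc)
qed

lemma comm_square_horizontal:
  assumes "comm_square C S" "comm_square C T" "sRgt S = sLft T"
  shows "comm_square C \<lparr>sTop = sTop T \<cdot> sTop S, sBot = sBot T \<cdot> sBot S, sLft = sLft S, sRgt = sRgt T\<rparr>"
proof -
  note S = comm_squareD[OF assms(1)] and T = comm_squareD[OF assms(2)]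
  have "sRgt T \<cdot> (sTop T \<cdot> sTop S) = (sRgt T \<cdot> sTop T) \<cdot> sTop S"
    using S(1-8) T(1-8) assms(3) by (simp add: Cmp_assoc)
  also have "\<dots> = (sBot T \<cdot> sRgt S) \<cdot> sTop S" by (simp add: T(9) assms(3))
  also have "\<dots> = sBot T \<cdot> (sRgt S \<cdot> sTop S)"
    using S(1-8) T(1-8) assms(3) by (simp add: Cmp_assoc)
  also have "\<dots> = sBot T \<cdot> (sBot S \<cdot> sLft S)" by (simp add: S(9))
  also have "\<dots> = (sBot T \<cdot> sBot S) \<cdot> sLft S"
    using S(1-8) T(1-8) assms(3) by (simp add: Cmp_assoc)
  finally show ?thesis
    using S(1-8) T(1-8) assms(3) by (simp add: comm_square_def Cmp_assoc)
qed

text \<open>A cone is lifted through the lower square \<open>T\<close> first; the result, paired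
  with \<open>v\<close>, is a cone over \<open>S\<close>. Uniqueness peels off the squares in the
  same order.\<close>

lemma pullback_vertical:
  assumes PS: "pullback C S" and PT: "pullback C T" and ST: "sBot S = sTop T"
  shows "pullback C \<lparr>sTop = sTop S, sBot = sBot T, sLft = sLft T \<cdot> sLft S, sRgt = sRgt T \<cdot> sRgt S\<rparr>"
    (is "pullback C ?V")
proof (rule pullbackI)
  note cS = pullback_comm[OF PS] and cT = pullback_comm[OF PT]
  show "comm_square C ?V"
    by (rule comm_square_vertical[OF cS cT ST])
  note S = comm_squareD[OF cS] and T = comm_squareD[OF cT]
  { fix z u v
    assume u: "u \<in> hom C z (Src C (sBot T))" and v: "v \<in> hom C z (Src C (sRgt T \<cdot> sRgt S))"
      and uv: "sBot T \<cdot> u = (sRgt T \<cdot> sRgt S) \<cdot> v"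
    have v': "sRgt S \<cdot> v \<in> hom C z (Src C (sRgt T))" and e: "sBot T \<cdot> u = sRgt T \<cdot> (sRgt S \<cdot> v)"
      using u v uv S T ST by (auto simp: hom_iff Cmp_assoc)
    obtain k where k: "k \<in> hom C z (Src C (sTop T))" "sLft T \<cdot> k = u" "sTop T \<cdot> k = sRgt S \<cdot> v"
      using pullback_lift[OF PT u v' e] .
    have "k \<in> hom C z (Src C (sBot S))" "v \<in> hom C z (Src C (sRgt S))" "sBot S \<cdot> k = sRgt S \<cdot> v"
      using k v S T ST by (auto simp: hom_iff)
    from pullback_lift[OF PS this]
    obtain h where "h \<in> hom C z (Src C (sTop S))" "sLft S \<cdot> h = k" "sTop S \<cdot> h = v" .
    then have "\<exists>h. h \<in> hom C z (Src C (sTop S)) \<and> (sLft T \<cdot> sLft S) \<cdot> h = u \<and> sTop S \<cdot> h = v"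
      using k S T ST by (intro exI[of _ h]) (auto simp: hom_iff Cmp_assoc) }
  note ex = this
  { fix z h k
    assume h: "h \<in> hom C z (Src C (sTop S))" and k: "k \<in> hom C z (Src C (sTop S))"
      and l: "(sLft T \<cdot> sLft S) \<cdot> h = (sLft T \<cdot> sLft S) \<cdot> k" and t: "sTop S \<cdot> h = sTop S \<cdot> k"
    have "sLft S \<cdot> h = sLft S \<cdot> k"
    proof (rule pullback_unique[OF PT])
      show "sLft S \<cdot> h \<in> hom C z (Src C (sTop T))" "sLft S \<cdot> k \<in> hom C z (Src C (sTop T))"
        using h k S T ST by (auto simp: hom_iff)
      show "sLft T \<cdot> (sLft S \<cdot> h) = sLft T \<cdot> (sLft S \<cdot> k)"
        using h k S T ST l by (auto simp: hom_iff Cmp_assoc)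
      have "sRgt S \<cdot> (sTop S \<cdot> h) = sRgt S \<cdot> (sTop S \<cdot> k)" using t by simp
      then show "sTop T \<cdot> (sLft S \<cdot> h) = sTop T \<cdot> (sLft S \<cdot> k)"
        using h k S T ST by (simp add: hom_iff Cmp_assoc[symmetric])
    qed
    then have "h = k"
      using pullback_unique[OF PS h k _ t] by simp }
  note un = this
  show "\<exists>h. h \<in> hom C z (Src C (sTop ?V)) \<and> sLft ?V \<cdot> h = u \<and> sTop ?V \<cdot> h = v"
    if "u \<in> hom C z (Src C (sBot ?V))" "v \<in> hom C z (Src C (sRgt ?V))" "sBot ?V \<cdot> u = sRgt ?V \<cdot> v"
    for z u v using ex[of u z v] that by simp
  show "h = k"
    if "h \<in> hom C z (Src C (sTop ?V))" "k \<in> hom C z (Src C (sTop ?V))"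
      "sLft ?V \<cdot> h = sLft ?V \<cdot> k" "sTop ?V \<cdot> h = sTop ?V \<cdot> k" for z h k
    using un[of h z k] that by simp
qed

end

section \<open>Distinguished squares in a contextual category\<close>

context precontextual
begin

section \<open>Display maps and their factorisation into projections\<close>

lemma Ar_Pr [simp]: "a \<in> Ob C \<Longrightarrow> 1 \<le> Len C a \<Longrightarrow> Pr C a \<in> Ar C"
  and Src_Pr [simp]: "a \<in> Ob C \<Longrightarrow> 1 \<le> Len C a \<Longrightarrow> Src C (Pr C a) = a"
  and Tgt_Pr [simp]: "a \<in> Ob C \<Longrightarrow> 1 \<le> Len C a \<Longrightarrow> Tgt C (Pr C a) = Ft C a"
  using pr_hom[of a] by (simp_all add: hom_def)

lemma Pr_inj: "a \<in> Ob C \<Longrightarrow> 1 \<le> Len C a \<Longrightarrow> b \<in> Ob C \<Longrightarrow> 1 \<le> Len C b \<Longrightarrow>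
    Pr C a = Pr C b \<Longrightarrow> a = b"
  by (metis Src_Pr)

lemma QQ_cases:
  assumes "S \<in> QQ C"
  obtains a b where "a \<in> Ob C" "1 \<le> Len C a" "sLft S = Pr C a" "b \<in> Ob C" "1 \<le> Len C b"
    "sRgt S = Pr C b" "sTop S \<in> hom C a b" "sBot S \<in> hom C (Ft C a) (Ft C b)"
proof -
  obtain a b where ab: "a \<in> Ob C" "1 \<le> Len C a" "sLft S = Pr C a" "b \<in> Ob C" "1 \<le> Len C b"
    "sRgt S = Pr C b" using Q_lft[OF assms] Q_rgt[OF assms] by blast
  with comm_squareD[OF Q_comm[OF assms]] show thesis
    by (intro that[of a b]) (auto simp: hom_iff)
qed

lemma displays_Ar: "f \<in> displays C \<Longrightarrow> f \<in> Ar C"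
  by (induction rule: displays.induct) (auto simp: ft_Ob)

lemma displays_Len: "f \<in> displays C \<Longrightarrow> Len C (Tgt C f) \<le> Len C (Src C f)"
proof (induction rule: displays.induct)
  case (displays_step a f)
  then show ?case using displays_Ar[OF displays_step(3)] len_ft[of a] by simp
qed simp

lemma Pr_displays: "a \<in> Ob C \<Longrightarrow> 1 \<le> Len C a \<Longrightarrow> Pr C a \<in> displays C"
  using displays_step[of a C "Idn C (Ft C a)"] displays_id[of "Ft C a" C] by (simp add: ft_Ob)

lemma displays_comp:
  assumes "f \<in> displays C" "g \<in> displays C" "Src C g = Tgt C f"
  shows "g \<cdot> f \<in> displays C"
  using assms
proof (induction rule: displays.induct)
  case (displays_id a)
  then show ?case by (simp add: displays_Ar)
next
  case (displays_step a f)
  note f = displays_Ar[OF displays_step(3)]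
  note g = displays_Ar[OF displays_step.prems(1)]
  have sg: "Src C g = Tgt C f" using displays_step f by simp
  have "(g \<cdot> f) \<cdot> Pr C a \<in> displays C"
    using displays_step f g sg by (intro displays.displays_step) auto
  then show ?case using displays_step f g sg by (simp add: Cmp_assoc)
qed

text \<open>The display maps out of an object are the composites of the projections of the tower
  below it. Each factor lowers the length by exactly one, so the length of the codomain says where
  to stop.\<close>

lemma displays_eq:
  assumes "f \<in> displays C" "g \<in> displays C" "Src C f = Src C g" "Len C (Tgt C f) = Len C (Tgt C g)"
  shows "f = g"
  using assms
proof (induction arbitrary: g rule: displays.induct)
  case (displays_id a)
  have src: "Src C g = a" and len: "Len C (Tgt C g) = Len C a"
    using displays_id(1) displays_id(3,4)[symmetric] by simp_all
  from displays_id(2) show ?case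
  proof (cases rule: displays.cases)
    \<comment> \<open>A nonempty composite out of \<open>a\<close> strictly lowers the length,
      against \<open>len\<close>.\<close>
    case (displays_step b h)
    have h: "h \<in> Ar C" using displays_step(4) by (rule displays_Ar)
    have "b = a" "Len C (Tgt C h) = Len C a"
      using src len h displays_step(2,3,5) unfolding displays_step(1) by simp_all
    moreover have "Len C (Tgt C h) < Len C b"
      using displays_Len[OF displays_step(4)] displays_step(2,3) unfolding displays_step(5)
      by (simp add: len_ft)
    ultimately show ?thesis by simp
  qed (use src in auto)
next
  case (displays_step a f)
  note f = displays_Ar[OF displays_step(3)]
  have lt: "Len C (Tgt C f) < Len C a"
    using displays_Len[OF displays_step(3)] displays_step(1,2) unfolding displays_step(4)
    by (simp add: len_ft)
  have src: "Src C g = a" and len: "Len C (Tgt C g) = Len C (Tgt C f)"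
    using displays_step.prems(2,3)[symmetric] f displays_step(1,2,4) by simp_all
  note fa = displays_step(4) and IH = displays_step.IH
  from displays_step.prems(1) show ?case
  proof (cases rule: displays.cases)
    case (displays_id b)
    then show ?thesis using src len lt by simp
  next
    case (displays_step b h)
    have h: "h \<in> Ar C" using displays_step(4) by (rule displays_Ar)
    have "Src C g = b" "Tgt C g = Tgt C h"
      using h displays_step(2,3,5) unfolding displays_step(1) by simp_all
    then have ba: "b = a" and t: "Len C (Tgt C f) = Len C (Tgt C h)" using src len by simp_all
    have "f = h" using IH[OF displays_step(4) _ t] fa displays_step(5) ba by simp
    then show ?thesis using displays_step(1) ba by simp
  qed
qed

lemma display_length_1:
  assumes "f \<in> displays C" "display_length C f = 1"
  shows "1 \<le> Len C (Src C f)" "f = Pr C (Src C f)"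
proof -
  have f: "f \<in> Ar C" using assms by (simp add: displays_Ar)
  show l: "1 \<le> Len C (Src C f)" using assms(2) by (simp add: display_length_def)
  have "f \<in> displays C" "Pr C (Src C f) \<in> displays C" using assms f l by (auto intro: Pr_displays)
  then show "f = Pr C (Src C f)"
  proof (rule displays_eq)
    show "Src C f = Src C (Pr C (Src C f))" using f l by simp
    show "Len C (Tgt C f) = Len C (Tgt C (Pr C (Src C f)))"
      using f l assms(2) by (simp add: len_ft display_length_def)
  qed
qed

lemma display_length_Pr: "a \<in> Ob C \<Longrightarrow> 1 \<le> Len C a \<Longrightarrow> display_length C (Pr C a) = 1"
  by (simp add: display_length_def len_ft)

lemma distinguished_comm: "S \<in> distinguished C \<Longrightarrow> comm_square C S"
proof (induction rule: distinguished.induct)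
  case (distinguished_id f)
  then show ?case by (simp add: comm_square_def)
next
  case (distinguished_step S T)
  then show ?case using comm_square_vertical[OF Q_comm] by blast
qed

lemma distinguished_displays: "S \<in> distinguished C \<Longrightarrow> sLft S \<in> displays C \<and> sRgt S \<in> displays C"
proof (induction rule: distinguished.induct)
  case (distinguished_id f)
  then show ?case by (simp add: displays_id)
next
  case (distinguished_step S T)
  note T = comm_squareD[OF distinguished_comm[OF distinguished_step(2)]]
  from QQ_cases[OF distinguished_step(1)] obtain a b where ab: "a \<in> Ob C" "1 \<le> Len C a"
    "sLft S = Pr C a" "b \<in> Ob C" "1 \<le> Len C b" "sRgt S = Pr C b"
    "sBot S \<in> hom C (Ft C a) (Ft C b)" by metis
  have "Src C (sLft T) = Ft C a" "Src C (sRgt T) = Ft C b"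
    using ab(7) T(5,6) distinguished_step(3) by (simp_all add: hom_iff)
  then show ?case
    using ab distinguished_step.IH by (simp add: displays.displays_step)
qed

text \<open>The square is stacked on the empty composite along its bottom; the identity sides then
  cancel.\<close>

lemma QQ_distinguished:
  assumes "S \<in> QQ C"
  shows "S \<in> distinguished C"
proof -
  note S = comm_squareD[OF Q_comm[OF assms]]
  have "\<lparr>sTop = sTop S, sBot = sBot S, sLft = Idn C (Src C (sBot S)) \<cdot> sLft S,
      sRgt = Idn C (Tgt C (sBot S)) \<cdot> sRgt S\<rparr> \<in> distinguished C"
    using distinguished_step[OF assms distinguished_id[of "sBot S" C]] S by simp
  then show ?thesis using S by (cases S) simp
qed

end

context precontextual
begin

text \<open>The source of the composite gives \<open>b\<close>, and \<open>displays_eq\<close> gives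
  the rest. This matches the layers of two distinguished squares with the same right side.\<close>

lemma display_step_cancel:
  assumes "q \<in> displays C" "q' \<in> displays C" "b \<in> Ob C" "1 \<le> Len C b" "b' \<in> Ob C" "1 \<le> Len C b'"
    "Src C q = Ft C b" "Src C q' = Ft C b'" and eq: "q \<cdot> Pr C b = q' \<cdot> Pr C b'"
  shows "b = b'" "q = q'"
proof -
  have q: "q \<in> Ar C" "q' \<in> Ar C" using assms by (simp_all add: displays_Ar)
  have "Src C (q \<cdot> Pr C b) = b" "Src C (q' \<cdot> Pr C b') = b'" "Tgt C (q \<cdot> Pr C b) = Tgt C q"
    "Tgt C (q' \<cdot> Pr C b') = Tgt C q'"
    using assms(1-8) q by simp_all
  then show "b = b'" and "q = q'"
    using eq assms displays_eq[of q q'] by simp_all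
qed

text \<open>Otherwise \<open>q\<close> would end at \<open>b\<close> although it starts strictly
  below \<open>b\<close>. Hence equal right sides cannot belong to a stack of squares and to the
  empty composite.\<close>

lemma display_step_not_Idn:
  assumes "q \<in> displays C" "b \<in> Ob C" "1 \<le> Len C b" "Src C q = Ft C b" "a \<in> Ob C"
  shows "q \<cdot> Pr C b \<noteq> Idn C a"
proof
  assume eq: "q \<cdot> Pr C b = Idn C a"
  have q: "q \<in> Ar C" using assms by (simp add: displays_Ar)
  have "Src C (q \<cdot> Pr C b) = b" "Tgt C (q \<cdot> Pr C b) = Tgt C q" using assms q by simp_all
  then have "Tgt C q = b" using eq assms(5) by simp
  then show False using displays_Len[OF assms(1)] assms(2-4) len_ft[of b] by simp
qed

end

section \<open>Distinguished pullbacks of display maps: existence and uniqueness\<close>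

context contextual
begin

lemma one_Ob [simp]: "one C \<in> Ob C" and Len_one [simp]: "Len C (one C) = 0"
  and one_eqI: "a \<in> Ob C \<Longrightarrow> Len C a = 0 \<Longrightarrow> a = one C"
proof -
  have "one C \<in> Ob C \<and> Len C (one C) = 0"
    unfolding one_def by (rule theI'[OF len0_unique])
  then show "one C \<in> Ob C" "Len C (one C) = 0" by simp_all
  then show "a \<in> Ob C \<Longrightarrow> Len C a = 0 \<Longrightarrow> a = one C" using len0_unique by blast
qed

lemma terminal_one: "terminal C (one C)"
  by (simp add: len0_terminal)

lemma to_one_eq:
  "f \<in> Ar C \<Longrightarrow> g \<in> Ar C \<Longrightarrow> Tgt C f = one C \<Longrightarrow> Tgt C g = one C \<Longrightarrow> Src C f = Src C g \<Longrightarrow> f = g"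
  using terminal_one unfolding terminal_def hom_def by (metis (mono_tags, lifting) Ob_Src mem_Collect_eq)

lemma pullback_Idn: "f \<in> Ar C \<Longrightarrow>
    pullback C \<lparr>sTop = f, sBot = f, sLft = Idn C (Src C f), sRgt = Idn C (Tgt C f)\<rparr>"
  by (rule pullbackI) (auto simp: comm_square_def hom_iff)

lemma distinguished_pullback: "S \<in> distinguished C \<Longrightarrow> pullback C S"
proof (induction rule: distinguished.induct)
  case (distinguished_step S T)
  then show ?case using pullback_vertical[OF Q_pullback] by blast
qed (rule pullback_Idn)

text \<open>The stack is built from below: \<open>p\<close> is pulled back along \<open>f\<close> by
  induction, and \<open>Q_lift\<close> then lifts \<open>Pr C a\<close> along the top edge just
  obtained.\<close>

lemma distinguished_ex:
  assumes "p \<in> displays C" "f \<in> Ar C" "Tgt C f = Tgt C p"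
  shows "\<exists>T \<in> distinguished C. sRgt T = p \<and> sBot T = f"
  using assms
proof (induction rule: displays.induct)
  case (displays_id a)
  then have "Tgt C f = a" by simp
  then show ?case using distinguished_id[OF displays_id(2)]
    by (intro bexI[of _ "\<lparr>sTop = f, sBot = f, sLft = Idn C (Src C f), sRgt = Idn C (Tgt C f)\<rparr>"]) auto
next
  case (displays_step a p)
  have p: "p \<in> Ar C" using displays_step by (simp add: displays_Ar)
  have "Tgt C f = Tgt C p" using displays_step.prems displays_step(1,2,4) p by simp
  from displays_step.IH[OF displays_step.prems(1) this]
  obtain T where T: "T \<in> distinguished C" "sRgt T = p" "sBot T = f" by blast
  note cT = comm_squareD[OF distinguished_comm[OF T(1)]]
  have "Tgt C (sTop T) = Ft C a" using cT(6) T(2) displays_step(4) by simp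
  from Q_lift[OF displays_step(1,2) cT(1) this]
  obtain S where "S \<in> QQ C" "sRgt S = Pr C a" "sBot S = sTop T" by blast
  then have "\<lparr>sTop = sTop S, sBot = sBot T, sLft = sLft T \<cdot> sLft S, sRgt = sRgt T \<cdot> sRgt S\<rparr> \<in> distinguished C"
    and "sRgt T \<cdot> sRgt S = p \<cdot> Pr C a"
    using distinguished_step[of S C T] T by simp_all
  then show ?case using T by (intro rev_bexI) auto
qed

text \<open>Equal right sides factor equally into projections, so both squares have the same number
  of layers. The lower part agrees by induction, and the top layer is the unique lift of one
  projection along the common edge.\<close>

lemma distinguished_unique:
  assumes "T \<in> distinguished C" "U \<in> distinguished C" "sRgt T = sRgt U" "sBot T = sBot U"
  shows "T = U"
  using assms
proof (induction arbitrary: U rule: distinguished.induct)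
  case (distinguished_id f)
  from distinguished_id(2) show ?case
  proof (cases rule: distinguished.cases)
    case (distinguished_id g)
    then show ?thesis using distinguished_id.prems by simp
  next
    case (distinguished_step S V)
    note cV = comm_squareD[OF distinguished_comm[OF distinguished_step(3)]]
    obtain b where b: "b \<in> Ob C" "1 \<le> Len C b" "sRgt S = Pr C b" "Tgt C (sBot S) = Ft C b"
      using QQ_cases[OF distinguished_step(2)] by (metis hom_iff)
    have "sRgt V \<cdot> Pr C b \<noteq> Idn C (Tgt C f)"
      using distinguished_displays[OF distinguished_step(3)] b cV distinguished_step(4)
        \<open>f \<in> Ar C\<close> by (intro display_step_not_Idn) auto
    then show ?thesis using distinguished_id.prems distinguished_step(1) b by simp
  qed
next
  case (distinguished_step S T)
  note ST = distinguished_step(1-3) and IH = distinguished_step.IH and prems = distinguished_step.prems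
  note cT = comm_squareD[OF distinguished_comm[OF ST(2)]]
  obtain b where b: "b \<in> Ob C" "1 \<le> Len C b" "sRgt S = Pr C b" "Tgt C (sBot S) = Ft C b"
    using QQ_cases[OF ST(1)] by (metis hom_iff)
  note dT = conjunct2[OF distinguished_displays[OF ST(2)]]
  have sT: "Src C (sRgt T) = Ft C b" using cT(6) ST(3) b(4) by simp
  from prems(1) show ?case
  proof (cases rule: distinguished.cases)
    case (distinguished_id g)
    have "sRgt T \<cdot> Pr C b \<noteq> Idn C (Tgt C g)"
      using dT b sT distinguished_id(2) by (intro display_step_not_Idn) auto
    then show ?thesis using prems distinguished_id(1) b by simp
  next
    case (distinguished_step S' T')
    note cT' = comm_squareD[OF distinguished_comm[OF distinguished_step(3)]]
    obtain b' where b': "b' \<in> Ob C" "1 \<le> Len C b'" "sRgt S' = Pr C b'" "Tgt C (sBot S') = Ft C b'"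
      using QQ_cases[OF distinguished_step(2)] by (metis hom_iff)
    note dT' = conjunct2[OF distinguished_displays[OF distinguished_step(3)]]
    have sT': "Src C (sRgt T') = Ft C b'" using cT'(6) distinguished_step(4) b'(4) by simp
    have "sRgt T \<cdot> Pr C b = sRgt T' \<cdot> Pr C b'" using prems(2) distinguished_step(1) b b' by simp
    from display_step_cancel[OF dT dT' b(1,2) b'(1,2) sT sT' this]
    have bb: "b = b'" and "sRgt T = sRgt T'" .
    then have "T = T'" using IH[OF distinguished_step(3)] prems(3) distinguished_step(1) by simp
    moreover have "S = S'"
    proof -
      have "sTop T \<in> Ar C" "Tgt C (sTop T) = Ft C b" using cT b ST(3) by simp_all
      from Q_lift[OF b(1,2) this] show ?thesis
        using ST distinguished_step b b' bb \<open>T = T'\<close> by metis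
    qed
    ultimately show ?thesis using distinguished_step(1) by simp
  qed
qed

text \<open>The definitions speak of \<open>distinguished\<close>, whereas horizontal composition,
  lifting and cancellation are available for \<open>QQ\<close>. Gap maps of relative length-1
  display maps are projections, so this bridge applies to every square of gap maps below.\<close>

lemma distinguished_QQ:
  assumes "S \<in> distinguished C" "sRgt S = Pr C b" "b \<in> Ob C" "1 \<le> Len C b"
  shows "S \<in> QQ C"
proof -
  note S = comm_squareD[OF distinguished_comm[OF assms(1)]]
  have "Tgt C (sBot S) = Ft C b" using S(8) assms by simp
  from Q_lift[OF assms(3,4) S(2) this]
  obtain R where R: "R \<in> QQ C" "sRgt R = Pr C b" "sBot R = sBot S" by blast
  then have "S = R" using distinguished_unique[OF assms(1) QQ_distinguished] assms(2) by simp
  then show ?thesis using R by simp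
qed

end

subsection \<open>Gap maps and maps between corners\<close>

text \<open>\<open>dsq\<close>, \<open>corner\<close> and \<open>corner_map\<close> look only at the
  right side and the bottom. Facts about them are therefore stated with top and left side left open;
  \<open>KQ_lift\<close> uses this for a square whose left side is still to be constructed.\<close>

definition cospan :: "('o, 'm, 'x) ctx_scheme \<Rightarrow> 'm square \<Rightarrow> bool" where
  "cospan C S \<longleftrightarrow> sRgt S \<in> displays C \<and> sBot S \<in> Ar C \<and> Tgt C (sBot S) = Tgt C (sRgt S)"

text \<open>A morphism of cospans. The arrow \<open>w\<close> does not occur in
  \<open>corner_map\<close>, but it makes the two composites into the vertex of the second cospan
  agree, so that the description of \<open>corner_map\<close> has a value.\<close>

definition cospan_map ::
  "('o, 'm, 'x) ctx_scheme \<Rightarrow> 'm square \<Rightarrow> 'm square \<Rightarrow> 'm \<Rightarrow> 'm \<Rightarrow> 'm \<Rightarrow> bool" where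
  "cospan_map C S T u v w \<longleftrightarrow> cospan C S \<and> cospan C T \<and>
     u \<in> hom C (Src C (sBot S)) (Src C (sBot T)) \<and> v \<in> hom C (Src C (sRgt S)) (Src C (sRgt T)) \<and>
     w \<in> hom C (Tgt C (sBot S)) (Tgt C (sBot T)) \<and>
     sBot T \<cdot>\<^bsub>C\<^esub> u = w \<cdot>\<^bsub>C\<^esub> sBot S \<and> sRgt T \<cdot>\<^bsub>C\<^esub> v = w \<cdot>\<^bsub>C\<^esub> sRgt S"

lemma dsq_cong: "sRgt S = sRgt T \<Longrightarrow> sBot S = sBot T \<Longrightarrow> dsq C S = dsq C T"
  by (simp add: dsq_def)

lemma corner_cong: "sRgt S = sRgt T \<Longrightarrow> sBot S = sBot T \<Longrightarrow> corner C S = corner C T"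
  by (simp add: corner_def dsq_cong[of S T])

lemma corner_map_cong: "sRgt S = sRgt S' \<Longrightarrow> sBot S = sBot S' \<Longrightarrow> sRgt T = sRgt T' \<Longrightarrow> sBot T = sBot T' \<Longrightarrow>
    corner_map C S T u v = corner_map C S' T' u v"
  unfolding corner_map_def by (simp only: dsq_cong[of S S'] dsq_cong[of T T'] corner_cong[of S S'] corner_cong[of T T'])

context contextual
begin

lemma cospan_comm_square: "comm_square C S \<Longrightarrow> sRgt S \<in> displays C \<Longrightarrow> cospan C S"
  by (simp add: cospan_def comm_square_def)

lemma dsq_eqI:
  assumes "T \<in> distinguished C" "sRgt T = sRgt S" "sBot T = sBot S"
  shows "dsq C S = T"
  unfolding dsq_def dpull_def using assms distinguished_unique
  by (intro the_equality) auto

lemma dsq: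
  assumes "cospan C S"
  shows "dsq C S \<in> distinguished C" "sRgt (dsq C S) = sRgt S" "sBot (dsq C S) = sBot S"
proof -
  obtain T where "T \<in> distinguished C" "sRgt T = sRgt S" "sBot T = sBot S"
    using distinguished_ex[of "sRgt S" "sBot S"] assms unfolding cospan_def by blast
  then show "dsq C S \<in> distinguished C" "sRgt (dsq C S) = sRgt S" "sBot (dsq C S) = sBot S"
    using dsq_eqI[of T S] by simp_all
qed

lemma corner_facts:
  assumes "cospan C S"
  shows "sTop (dsq C S) \<in> hom C (corner C S) (Src C (sRgt S))"
    "sLft (dsq C S) \<in> hom C (corner C S) (Src C (sBot S))"
    "sLft (dsq C S) \<in> displays C"
    "sRgt S \<cdot> sTop (dsq C S) = sBot S \<cdot> sLft (dsq C S)"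
    "corner C S \<in> Ob C"
proof -
  note D = dsq[OF assms]
  note c = comm_squareD[OF distinguished_comm[OF D(1)], unfolded D(2,3)]
  show "sTop (dsq C S) \<in> hom C (corner C S) (Src C (sRgt S))"
    "sLft (dsq C S) \<in> hom C (corner C S) (Src C (sBot S))"
    "sRgt S \<cdot> sTop (dsq C S) = sBot S \<cdot> sLft (dsq C S)"
    "corner C S \<in> Ob C"
    using c by (simp_all add: hom_iff corner_def)
  show "sLft (dsq C S) \<in> displays C" using distinguished_displays[OF D(1)] by simp
qed

lemma corner_eqI:
  assumes "cospan C S" "h \<in> hom C z (corner C S)" "k \<in> hom C z (corner C S)"
    "sLft (dsq C S) \<cdot> h = sLft (dsq C S) \<cdot> k" "sTop (dsq C S) \<cdot> h = sTop (dsq C S) \<cdot> k"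
  shows "h = k"
  using pullback_unique[OF distinguished_pullback[OF dsq(1)[OF assms(1)]]] assms(2-)
  by (simp add: corner_def)

lemma corner_lift:
  assumes "cospan C S" "u \<in> hom C z (Src C (sBot S))" "v \<in> hom C z (Src C (sRgt S))"
    "sBot S \<cdot> u = sRgt S \<cdot> v"
  obtains h where "h \<in> hom C z (corner C S)" "sLft (dsq C S) \<cdot> h = u" "sTop (dsq C S) \<cdot> h = v"
proof -
  have "u \<in> hom C z (Src C (sBot (dsq C S)))" "v \<in> hom C z (Src C (sRgt (dsq C S)))"
    "sBot (dsq C S) \<cdot> u = sRgt (dsq C S) \<cdot> v"
    using assms by (simp_all add: dsq)
  from pullback_lift[OF distinguished_pullback[OF dsq(1)[OF assms(1)]] this] that
  show thesis unfolding corner_def by blast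
qed

lemma gap_eqI:
  assumes "cospan C S" "g \<in> hom C (Src C (sTop S)) (corner C S)"
    "sLft (dsq C S) \<cdot> g = sLft S" "sTop (dsq C S) \<cdot> g = sTop S"
  shows "gap C S = g"
  unfolding gap_def using assms by (intro the_equality) (auto intro: corner_eqI[OF assms(1)])

lemma gap:
  assumes "comm_square C S" "sRgt S \<in> displays C"
  shows "gap C S \<in> hom C (Src C (sTop S)) (corner C S)"
    "sLft (dsq C S) \<cdot> gap C S = sLft S" "sTop (dsq C S) \<cdot> gap C S = sTop S"
proof -
  note cs = cospan_comm_square[OF assms]
  have "sLft S \<in> hom C (Src C (sTop S)) (Src C (sBot S))" "sTop S \<in> hom C (Src C (sTop S)) (Src C (sRgt S))"
    "sBot S \<cdot> sLft S = sRgt S \<cdot> sTop S"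
    using comm_squareD[OF assms(1)] by (simp_all add: hom_iff)
  from corner_lift[OF cs this] obtain g where g: "g \<in> hom C (Src C (sTop S)) (corner C S)"
    "sLft (dsq C S) \<cdot> g = sLft S" "sTop (dsq C S) \<cdot> g = sTop S" .
  with gap_eqI[OF cs g]
  show "gap C S \<in> hom C (Src C (sTop S)) (corner C S)"
    "sLft (dsq C S) \<cdot> gap C S = sLft S" "sTop (dsq C S) \<cdot> gap C S = sTop S" by simp_all
qed

lemma corner_map_eqI:
  assumes "cospan C T" "h \<in> hom C (corner C S) (corner C T)"
    "sLft (dsq C T) \<cdot> h = u \<cdot> sLft (dsq C S)" "sTop (dsq C T) \<cdot> h = v \<cdot> sTop (dsq C S)"
  shows "corner_map C S T u v = h"
  unfolding corner_map_def using assms by (intro the_equality) (auto intro: corner_eqI[OF assms(1)])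

lemma corner_map:
  assumes "cospan_map C S T u v w"
  shows "corner_map C S T u v \<in> hom C (corner C S) (corner C T)"
    "sLft (dsq C T) \<cdot> corner_map C S T u v = u \<cdot> sLft (dsq C S)"
    "sTop (dsq C T) \<cdot> corner_map C S T u v = v \<cdot> sTop (dsq C S)"
proof -
  from assms have S: "cospan C S" and T: "cospan C T"
    and u: "u \<in> hom C (Src C (sBot S)) (Src C (sBot T))"
    and v: "v \<in> hom C (Src C (sRgt S)) (Src C (sRgt T))"
    and w: "w \<in> hom C (Tgt C (sBot S)) (Tgt C (sBot T))"
    and eu: "sBot T \<cdot> u = w \<cdot> sBot S" and ev: "sRgt T \<cdot> v = w \<cdot> sRgt S"
    by (simp_all add: cospan_map_def)
  note cS = corner_facts[OF S]
  have A: "sRgt S \<in> Ar C" "sRgt T \<in> Ar C" "sBot S \<in> Ar C" "sBot T \<in> Ar C"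
    "Tgt C (sBot S) = Tgt C (sRgt S)" "Tgt C (sBot T) = Tgt C (sRgt T)"
    using S T by (auto simp: cospan_def displays_Ar)
  have l: "u \<cdot> sLft (dsq C S) \<in> hom C (corner C S) (Src C (sBot T))"
    and t: "v \<cdot> sTop (dsq C S) \<in> hom C (corner C S) (Src C (sRgt T))"
    using u v cS by (auto simp: hom_iff)
  have "sBot T \<cdot> (u \<cdot> sLft (dsq C S)) = (w \<cdot> sBot S) \<cdot> sLft (dsq C S)"
    using A u cS(2) by (intro Cmp_reassoc eu) (auto simp: hom_iff)
  also have "\<dots> = w \<cdot> (sBot S \<cdot> sLft (dsq C S))"
    using A w cS(2) by (intro Cmp_assoc) (auto simp: hom_iff)
  also have "\<dots> = w \<cdot> (sRgt S \<cdot> sTop (dsq C S))" by (simp add: cS(4))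
  also have "\<dots> = (w \<cdot> sRgt S) \<cdot> sTop (dsq C S)"
    using A w cS(1) by (intro Cmp_assoc[symmetric]) (auto simp: hom_iff)
  also have "\<dots> = (sRgt T \<cdot> v) \<cdot> sTop (dsq C S)" by (simp add: ev)
  also have "\<dots> = sRgt T \<cdot> (v \<cdot> sTop (dsq C S))"
    using A v cS(1) by (intro Cmp_assoc) (auto simp: hom_iff)
  finally have e: "sBot T \<cdot> (u \<cdot> sLft (dsq C S)) = sRgt T \<cdot> (v \<cdot> sTop (dsq C S))" .
  from corner_lift[OF T l t e] obtain h where h: "h \<in> hom C (corner C S) (corner C T)"
    "sLft (dsq C T) \<cdot> h = u \<cdot> sLft (dsq C S)" "sTop (dsq C T) \<cdot> h = v \<cdot> sTop (dsq C S)" .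
  with corner_map_eqI[OF T h]
  show "corner_map C S T u v \<in> hom C (corner C S) (corner C T)"
    "sLft (dsq C T) \<cdot> corner_map C S T u v = u \<cdot> sLft (dsq C S)"
    "sTop (dsq C T) \<cdot> corner_map C S T u v = v \<cdot> sTop (dsq C S)" by simp_all
qed

lemma corner_map_Idn:
  assumes "cospan C S"
  shows "corner_map C S S (Idn C (Src C (sBot S))) (Idn C (Src C (sRgt S))) = Idn C (corner C S)"
  using corner_facts[OF assms] by (intro corner_map_eqI[OF assms]) (auto simp: hom_iff)

text \<open>Functoriality of corners: the composite has the projections that characterise the map on
  the right.\<close>

lemma corner_map_Cmp:
  assumes "cospan_map C S T u v w" "cospan_map C T R u' v' w'"
  shows "corner_map C T R u' v' \<cdot> corner_map C S T u v = corner_map C S R (u' \<cdot> u) (v' \<cdot> v)"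
proof (rule sym, rule corner_map_eqI)
  note m = corner_map[OF assms(1)] and n = corner_map[OF assms(2)]
  from assms have S: "cospan C S" and T: "cospan C T" and R: "cospan C R"
    and u: "u \<in> hom C (Src C (sBot S)) (Src C (sBot T))" "u' \<in> hom C (Src C (sBot T)) (Src C (sBot R))"
    and v: "v \<in> hom C (Src C (sRgt S)) (Src C (sRgt T))" "v' \<in> hom C (Src C (sRgt T)) (Src C (sRgt R))"
    by (simp_all add: cospan_map_def)
  note c = corner_facts[OF S] corner_facts[OF T] corner_facts[OF R]
  show "cospan C R" by fact
  show "corner_map C T R u' v' \<cdot> corner_map C S T u v \<in> hom C (corner C S) (corner C R)"
    using m n by (auto simp: hom_iff)
  have "sLft (dsq C R) \<cdot> (corner_map C T R u' v' \<cdot> corner_map C S T u v) =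
      (u' \<cdot> sLft (dsq C T)) \<cdot> corner_map C S T u v"
    using m(1) n(1) c by (intro Cmp_reassoc n(2)) (auto simp: hom_iff)
  also have "\<dots> = u' \<cdot> (sLft (dsq C T) \<cdot> corner_map C S T u v)"
    using m(1) u c by (intro Cmp_assoc) (auto simp: hom_iff)
  also have "\<dots> = u' \<cdot> (u \<cdot> sLft (dsq C S))" by (simp add: m(2))
  also have "\<dots> = (u' \<cdot> u) \<cdot> sLft (dsq C S)"
    using u c by (intro Cmp_assoc[symmetric]) (auto simp: hom_iff)
  finally show "sLft (dsq C R) \<cdot> (corner_map C T R u' v' \<cdot> corner_map C S T u v) =
      (u' \<cdot> u) \<cdot> sLft (dsq C S)" .
  have "sTop (dsq C R) \<cdot> (corner_map C T R u' v' \<cdot> corner_map C S T u v) =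
      (v' \<cdot> sTop (dsq C T)) \<cdot> corner_map C S T u v"
    using m(1) n(1) c by (intro Cmp_reassoc n(3)) (auto simp: hom_iff)
  also have "\<dots> = v' \<cdot> (sTop (dsq C T) \<cdot> corner_map C S T u v)"
    using m(1) v c by (intro Cmp_assoc) (auto simp: hom_iff)
  also have "\<dots> = v' \<cdot> (v \<cdot> sTop (dsq C S))" by (simp add: m(3))
  also have "\<dots> = (v' \<cdot> v) \<cdot> sTop (dsq C S)"
    using v c by (intro Cmp_assoc[symmetric]) (auto simp: hom_iff)
  finally show "sTop (dsq C R) \<cdot> (corner_map C T R u' v' \<cdot> corner_map C S T u v) =
      (v' \<cdot> v) \<cdot> sTop (dsq C S)" .
qed

text \<open>Maps into a corner are equal once their two projections are, and these reduce to
  \<open>xl\<close> and \<open>xt\<close>.\<close>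

lemma gap_natural:
  assumes S: "comm_square C S" "sRgt S \<in> displays C" and T: "comm_square C T" "sRgt T \<in> displays C"
    and m: "cospan_map C S T u v w" and x: "x \<in> hom C (Src C (sTop S)) (Src C (sTop T))"
    and xl: "sLft T \<cdot> x = u \<cdot> sLft S" and xt: "sTop T \<cdot> x = v \<cdot> sTop S"
  shows "gap C T \<cdot> x = corner_map C S T u v \<cdot> gap C S"
proof (rule corner_eqI)
  note cT = cospan_comm_square[OF T] and cS = cospan_comm_square[OF S]
  note c = corner_facts[OF cS] corner_facts[OF cT]
  note gS = gap[OF S] and gT = gap[OF T] and cm = corner_map[OF m]
  have uv: "u \<in> hom C (Src C (sBot S)) (Src C (sBot T))" "v \<in> hom C (Src C (sRgt S)) (Src C (sRgt T))"
    using m by (simp_all add: cospan_map_def)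
  show "cospan C T" by (rule cT)
  show "gap C T \<cdot> x \<in> hom C (Src C (sTop S)) (corner C T)"
    "corner_map C S T u v \<cdot> gap C S \<in> hom C (Src C (sTop S)) (corner C T)"
    using x gS(1) gT(1) cm(1) by (auto simp: hom_iff)
  have "sLft (dsq C T) \<cdot> (gap C T \<cdot> x) = u \<cdot> sLft S"
    unfolding xl[symmetric] using c gT(1) x by (intro Cmp_reassoc gT(2)) (auto simp: hom_iff)
  also have "\<dots> = u \<cdot> (sLft (dsq C S) \<cdot> gap C S)" by (simp add: gS(2))
  also have "\<dots> = (u \<cdot> sLft (dsq C S)) \<cdot> gap C S"
    using c uv gS(1) by (intro Cmp_assoc[symmetric]) (auto simp: hom_iff)
  also have "\<dots> = sLft (dsq C T) \<cdot> (corner_map C S T u v \<cdot> gap C S)"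
    using c cm(1) gS(1) by (intro Cmp_reassoc[symmetric] cm(2)) (auto simp: hom_iff)
  finally show "sLft (dsq C T) \<cdot> (gap C T \<cdot> x) = sLft (dsq C T) \<cdot> (corner_map C S T u v \<cdot> gap C S)" .
  have "sTop (dsq C T) \<cdot> (gap C T \<cdot> x) = v \<cdot> sTop S"
    unfolding xt[symmetric] using c gT(1) x by (intro Cmp_reassoc gT(3)) (auto simp: hom_iff)
  also have "\<dots> = v \<cdot> (sTop (dsq C S) \<cdot> gap C S)" by (simp add: gS(3))
  also have "\<dots> = (v \<cdot> sTop (dsq C S)) \<cdot> gap C S"
    using c uv gS(1) by (intro Cmp_assoc[symmetric]) (auto simp: hom_iff)
  also have "\<dots> = sTop (dsq C T) \<cdot> (corner_map C S T u v \<cdot> gap C S)"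
    using c cm(1) gS(1) by (intro Cmp_reassoc[symmetric] cm(3)) (auto simp: hom_iff)
  finally show "sTop (dsq C T) \<cdot> (gap C T \<cdot> x) = sTop (dsq C T) \<cdot> (corner_map C S T u v \<cdot> gap C S)" .
qed

text \<open>A display map of length one is the projection of its source; comparing codomains
  identifies the father of the top left vertex with the corner.\<close>

lemma rel_display1D:
  assumes "rel_display1 C S"
  shows "comm_square C S" "sRgt S \<in> displays C" "sLft S \<in> displays C" "cospan C S"
    "Src C (sTop S) \<in> Ob C" "1 \<le> Len C (Src C (sTop S))" "gap C S = Pr C (Src C (sTop S))"
    "Ft C (Src C (sTop S)) = corner C S"
proof -
  show S: "comm_square C S" "sRgt S \<in> displays C" "sLft S \<in> displays C"
    using assms by (simp_all add: rel_display1_def)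
  then show "cospan C S" by (intro cospan_comm_square)
  show o: "Src C (sTop S) \<in> Ob C" using comm_squareD[OF S(1)] by simp
  have "gap C S \<in> displays C" "display_length C (gap C S) = 1"
    using assms by (simp_all add: rel_display1_def)
  from display_length_1[OF this] gap(1)[OF S(1,2)]
  show l: "1 \<le> Len C (Src C (sTop S))" and g: "gap C S = Pr C (Src C (sTop S))"
    by (simp_all add: hom_iff)
  show "Ft C (Src C (sTop S)) = corner C S"
    using gap(1)[OF S(1,2)] l o unfolding g by (simp add: hom_iff)
qed

lemma rel_display1I:
  assumes "comm_square C S" "sRgt S \<in> displays C" "sLft S \<in> displays C" "gap C S = Pr C b"
    "b \<in> Ob C" "1 \<le> Len C b"
  shows "rel_display1 C S"
  using assms unfolding rel_display1_def by (simp add: Pr_displays display_length_Pr)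

end

section \<open>Functors\<close>

lemma fctr_Ob: "F \<in> functors A B \<Longrightarrow> a \<in> Ob A \<Longrightarrow> Fo F a \<in> Ob B"
  by (auto simp: functors_def)

lemma fctr_Ar:
  assumes "F \<in> functors A B" "f \<in> Ar A"
  shows "Fa F f \<in> Ar B" "Src B (Fa F f) = Fo F (Src A f)" "Tgt B (Fa F f) = Fo F (Tgt A f)"
  using assms by (auto simp: functors_def hom_def)

lemma fctr_hom: "F \<in> functors A B \<Longrightarrow> f \<in> hom A a b \<Longrightarrow> Fa F f \<in> hom B (Fo F a) (Fo F b)"
  by (auto simp: functors_def hom_def)

lemma fctr_Idn: "F \<in> functors A B \<Longrightarrow> a \<in> Ob A \<Longrightarrow> Fa F (Idn A a) = Idn B (Fo F a)"
  by (auto simp: functors_def)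

lemma fctr_Cmp: "F \<in> functors A B \<Longrightarrow> f \<in> Ar A \<Longrightarrow> g \<in> Ar A \<Longrightarrow> Src A g = Tgt A f \<Longrightarrow>
    Fa F (g \<cdot>\<^bsub>A\<^esub> f) = Fa F g \<cdot>\<^bsub>B\<^esub> Fa F f"
  by (auto simp: functors_def)

lemma functorsI:
  assumes "Fo F \<in> extensional (Ob A)" "Fa F \<in> extensional (Ar A)"
    "\<And>a. a \<in> Ob A \<Longrightarrow> Fo F a \<in> Ob B"
    "\<And>f. f \<in> Ar A \<Longrightarrow> Fa F f \<in> hom B (Fo F (Src A f)) (Fo F (Tgt A f))"
    "\<And>a. a \<in> Ob A \<Longrightarrow> Fa F (Idn A a) = Idn B (Fo F a)"
    "\<And>f g. f \<in> Ar A \<Longrightarrow> g \<in> Ar A \<Longrightarrow> Src A g = Tgt A f \<Longrightarrow>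
      Fa F (g \<cdot>\<^bsub>A\<^esub> f) = Fa F g \<cdot>\<^bsub>B\<^esub> Fa F f"
  shows "F \<in> functors A B"
  using assms by (auto simp: functors_def PiE_def hom_def)

lemma fctr_eqI:
  assumes "F \<in> functors A B" "G \<in> functors A B'" "\<And>a. a \<in> Ob A \<Longrightarrow> Fo F a = Fo G a"
    "\<And>f. f \<in> Ar A \<Longrightarrow> Fa F f = Fa G f"
  shows "F = G"
proof -
  have "Fo F = Fo G" using assms(1-3)
    by (intro extensionalityI[of _ "Ob A"]) (auto simp: functors_def PiE_def)
  moreover have "Fa F = Fa G" using assms(1,2,4)
    by (intro extensionalityI[of _ "Ar A"]) (auto simp: functors_def PiE_def)
  ultimately show ?thesis by simp
qed

lemma comp_fctr_simps [simp]:
  "a \<in> Ob A \<Longrightarrow> Fo (comp_fctr A G F) a = Fo G (Fo F a)"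
  "f \<in> Ar A \<Longrightarrow> Fa (comp_fctr A G F) f = Fa G (Fa F f)"
  by (simp_all add: comp_fctr_def compose_eq)

lemma id_fctr_simps [simp]:
  "a \<in> Ob A \<Longrightarrow> Fo (id_fctr A) a = a" "f \<in> Ar A \<Longrightarrow> Fa (id_fctr A) f = f"
  by (simp_all add: id_fctr_def)

lemma comp_fctr_extensional [simp]:
  "Fo (comp_fctr A G F) \<in> extensional (Ob A)" "Fa (comp_fctr A G F) \<in> extensional (Ar A)"
  by (simp_all add: comp_fctr_def)

lemma (in category) comp_fctr_functors:
  assumes "F \<in> functors C B" "G \<in> functors B D"
  shows "comp_fctr C G F \<in> functors C D"
  by (rule functorsI) (auto simp: fctr_Ob[OF assms(1)] fctr_Ob[OF assms(2)] fctr_Ar[OF assms(1)]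
      fctr_Ar[OF assms(2)] hom_iff fctr_Idn[OF assms(1)] fctr_Idn[OF assms(2)] fctr_Cmp[OF assms(1)]
      fctr_Cmp[OF assms(2)])

lemma (in category) id_fctr_functors: "id_fctr C \<in> functors C C"
  by (rule functorsI) (auto simp: id_fctr_def hom_iff)

lemma ctx_functorsD:
  assumes "F \<in> ctx_functors A B"
  shows "F \<in> functors A B" "\<And>a. a \<in> Ob A \<Longrightarrow> Len B (Fo F a) = Len A a"
    "\<And>a. a \<in> Ob A \<Longrightarrow> Fo F (Ft A a) = Ft B (Fo F a)"
    "\<And>a. a \<in> Ob A \<Longrightarrow> 1 \<le> Len A a \<Longrightarrow> Fa F (Pr A a) = Pr B (Fo F a)"
    "\<And>S. S \<in> QQ A \<Longrightarrow> map_square (Fa F) S \<in> QQ B"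
  using assms by (auto simp: ctx_functors_def)

lemma map_square_simps [simp]:
  "sTop (map_square h S) = h (sTop S)" "sBot (map_square h S) = h (sBot S)"
  "sLft (map_square h S) = h (sLft S)" "sRgt (map_square h S) = h (sRgt S)"
  by (simp_all add: map_square_def)

lemma square_eqI: "sTop S = sTop T \<Longrightarrow> sBot S = sBot T \<Longrightarrow> sLft S = sLft T \<Longrightarrow> sRgt S = sRgt T \<Longrightarrow>
    (S :: 'm square) = T"
  by simp

context precontextual
begin

lemma QQ_Ar: "S \<in> QQ C \<Longrightarrow> sTop S \<in> Ar C \<and> sBot S \<in> Ar C \<and> sLft S \<in> Ar C \<and> sRgt S \<in> Ar C"
  using comm_squareD[OF Q_comm] by blast

lemma map_square_comp_fctr: "S \<in> QQ C \<Longrightarrow>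
    map_square (Fa (comp_fctr C G F)) S = map_square (Fa G) (map_square (Fa F) S)"
  using QQ_Ar[of S] by (intro square_eqI) simp_all

lemma comp_ctx_functors:
  assumes "F \<in> ctx_functors C B" "G \<in> ctx_functors B D"
  shows "comp_fctr C G F \<in> ctx_functors C D"
proof -
  note F = ctx_functorsD[OF assms(1)] and G = ctx_functorsD[OF assms(2)]
  show ?thesis unfolding ctx_functors_def
    using comp_fctr_functors[OF F(1) G(1)]
    by (auto simp: F G fctr_Ob[OF F(1)] ft_Ob map_square_comp_fctr)
qed

lemma id_ctx_functors: "id_fctr C \<in> ctx_functors C C"
proof -
  have "map_square (Fa (id_fctr C)) S = S" if "S \<in> QQ C" for S
    using QQ_Ar[OF that] by (intro square_eqI) simp_all
  then show ?thesis unfolding ctx_functors_def by (auto simp: id_fctr_functors ft_Ob)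
qed

lemma comp_fctr_id: "F \<in> functors C B \<Longrightarrow> comp_fctr C F (id_fctr C) = F"
  by (rule fctr_eqI[of _ C B]) (auto intro: comp_fctr_functors id_fctr_functors)

lemma id_comp_fctr: "category B \<Longrightarrow> F \<in> functors C B \<Longrightarrow> comp_fctr C (id_fctr B) F = F"
  by (rule fctr_eqI[of _ C B]) (auto intro: comp_fctr_functors category.id_fctr_functors simp: fctr_Ob fctr_Ar)

lemma comp_fctr_assoc:
  assumes "F \<in> functors C B" "G \<in> functors B D" "H \<in> functors D E" "category B"
  shows "comp_fctr C H (comp_fctr C G F) = comp_fctr C (comp_fctr B H G) F"
  using assms by (intro fctr_eqI[of _ C E])
    (auto intro!: comp_fctr_functors category.comp_fctr_functors[of B] simp: fctr_Ob fctr_Ar)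

end

section \<open>The contextual category of chains of sorts\<close>

fun chain_end :: "('o, 'm, 'x) cat_scheme \<Rightarrow> 'o \<Rightarrow> 'm list \<Rightarrow> 'o" where
  "chain_end K t [] = t"
| "chain_end K t (e # es) = Src K e"

fun sort_chain :: "('o, 'm, 'x) cat_scheme \<Rightarrow> 'o \<Rightarrow> 'm set \<Rightarrow> 'm list \<Rightarrow> bool" where
  "sort_chain K t E [] \<longleftrightarrow> True"
| "sort_chain K t E (e # es) \<longleftrightarrow> sort_chain K t E es \<and> e \<in> E \<and> Tgt K e = chain_end K t es"

text \<open>An arrow stores both chains because an arrow of \<open>K\<close> fixes only their ends.
  Length and father are read off the list. A square is a member of \<open>Q\<close> whose vertical
  sides are the heads of two chains.\<close>

definition chain_ctx ::
  "('o, 'm, 'x) cat_scheme \<Rightarrow> 'o \<Rightarrow> 'm set \<Rightarrow> 'm square set \<Rightarrow> ('m list, 'm list \<times> 'm list \<times> 'm) ctx" where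
  "chain_ctx K t E Q =
     \<lparr>Ob = {xs. sort_chain K t E xs},
      Ar = {(xs, ys, f). sort_chain K t E xs \<and> sort_chain K t E ys \<and>
              f \<in> hom K (chain_end K t xs) (chain_end K t ys)},
      Src = fst,
      Tgt = (\<lambda>(xs, ys, f). ys),
      Idn = (\<lambda>xs. (xs, xs, Idn K (chain_end K t xs))),
      Cmp = (\<lambda>(ys', zs, g) (xs, ys, f). (xs, zs, g \<cdot>\<^bsub>K\<^esub> f)),
      Len = length,
      Ft = tl,
      Pr = (\<lambda>xs. (xs, tl xs, hd xs)),
      QQ = {S. \<exists>e es d ds f g. sort_chain K t E (e # es) \<and> sort_chain K t E (d # ds) \<and>
              \<lparr>sTop = f, sBot = g, sLft = e, sRgt = d\<rparr> \<in> Q \<and>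
              S = \<lparr>sTop = (e # es, d # ds, f), sBot = (es, ds, g),
                   sLft = (e # es, es, e), sRgt = (d # ds, ds, d)\<rparr>}\<rparr>"

text \<open>What chains need in order to form a contextual category. \<open>square_Lft\<close>
  allows the left side of a lifted square to be put in front of a chain, and
  \<open>square_lift\<close> becomes the unique lifting of \<open>QQ\<close>.\<close>

locale sort_category = category K for K :: "('o, 'm, 'x) cat_scheme" (structure) +
  fixes t :: 'o and E :: "'m set" and Q :: "'m square set"
  assumes terminal_t: "terminal K t"
    and sort_Ar: "e \<in> E \<Longrightarrow> e \<in> Ar K"
    and square_pullback: "S \<in> Q \<Longrightarrow> pullback K S"
    and square_Lft: "S \<in> Q \<Longrightarrow> sLft S \<in> E"
    and square_Idn: "e \<in> E \<Longrightarrow>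
      \<lparr>sTop = Idn K (Src K e), sBot = Idn K (Tgt K e), sLft = e, sRgt = e\<rparr> \<in> Q"
    and square_Cmp: "S \<in> Q \<Longrightarrow> T \<in> Q \<Longrightarrow> sRgt S = sLft T \<Longrightarrow>
      \<lparr>sTop = sTop T \<cdot> sTop S, sBot = sBot T \<cdot> sBot S, sLft = sLft S, sRgt = sRgt T\<rparr> \<in> Q"
    and square_lift: "e \<in> E \<Longrightarrow> f \<in> Ar K \<Longrightarrow> Tgt K f = Tgt K e \<Longrightarrow>
      \<exists>!S. S \<in> Q \<and> sRgt S = e \<and> sBot S = f"
begin

abbreviation "CC \<equiv> chain_ctx K t E Q"

lemma CC_simps [simp]:
  "xs \<in> Ob CC \<longleftrightarrow> sort_chain K t E xs"
  "(xs, ys, f) \<in> Ar CC \<longleftrightarrow> sort_chain K t E xs \<and> sort_chain K t E ys \<and>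
     f \<in> hom K (chain_end K t xs) (chain_end K t ys)"
  "Src CC (xs, ys, f) = xs" "Tgt CC (xs, ys, f) = ys"
  "Idn CC xs = (xs, xs, Idn K (chain_end K t xs))"
  "Cmp CC (ys', zs, g) (xs, ys, f) = (xs, zs, g \<cdot> f)"
  "Len CC = length" "Ft CC = tl" "Pr CC xs = (xs, tl xs, hd xs)"
  by (simp_all add: chain_ctx_def)

lemma CC_hom [simp]: "(xs, ys, f) \<in> hom CC a b \<longleftrightarrow> xs = a \<and> ys = b \<and> sort_chain K t E a \<and> sort_chain K t E b \<and>
     f \<in> hom K (chain_end K t a) (chain_end K t b)"
  by (auto simp: hom_iff[of _ CC])

lemma CC_homE:
  assumes "f \<in> hom CC a b"
  obtains k where "f = (a, b, k)" "sort_chain K t E a" "sort_chain K t E b"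
    "k \<in> hom K (chain_end K t a) (chain_end K t b)"
  using assms by (cases f) auto

lemma CC_QQ: "S \<in> QQ CC \<longleftrightarrow> (\<exists>e es d ds f g. sort_chain K t E (e # es) \<and> sort_chain K t E (d # ds) \<and>
     \<lparr>sTop = f, sBot = g, sLft = e, sRgt = d\<rparr> \<in> Q \<and>
     S = \<lparr>sTop = (e # es, d # ds, f), sBot = (es, ds, g), sLft = (e # es, es, e), sRgt = (d # ds, ds, d)\<rparr>)"
  by (simp add: chain_ctx_def)

lemma CC_QQI:
  assumes "sort_chain K t E (e # es)" "sort_chain K t E (d # ds)"
    "\<lparr>sTop = f, sBot = g, sLft = e, sRgt = d\<rparr> \<in> Q"
  shows "\<lparr>sTop = (e # es, d # ds, f), sBot = (es, ds, g), sLft = (e # es, es, e), sRgt = (d # ds, ds, d)\<rparr> \<in> QQ CC"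
  unfolding CC_QQ using assms by (intro exI conjI) (assumption | rule refl)+

lemma t_Ob [simp]: "t \<in> Ob K"
  using terminal_t by (simp add: terminal_def)

lemma chain_end_Ob: "sort_chain K t E xs \<Longrightarrow> chain_end K t xs \<in> Ob K"
  by (cases xs) (auto simp: sort_Ar)

lemma square_comm: "S \<in> Q \<Longrightarrow> comm_square K S"
  by (intro pullback_comm square_pullback)

lemma category_CC: "category CC"
proof
  fix f assume "f \<in> Ar CC"
  then show "Src CC f \<in> Ob CC" "Tgt CC f \<in> Ob CC" by (cases f; simp)+
next
  fix a assume "a \<in> Ob CC"
  then show "Idn CC a \<in> hom CC a a" by (simp add: hom_iff chain_end_Ob)
next
  fix f g a b c assume "f \<in> hom CC a b" "g \<in> hom CC b c"
  then show "Cmp CC g f \<in> hom CC a c" by (auto elim!: CC_homE intro: cmp_hom)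
next
  fix f a b assume "f \<in> hom CC a b"
  then show "Cmp CC f (Idn CC a) = f" "Cmp CC (Idn CC b) f = f"
    by (auto elim!: CC_homE simp: hom_iff[of _ K])
next
  fix f g h a b c d assume "f \<in> hom CC a b" "g \<in> hom CC b c" "h \<in> hom CC c d"
  then show "Cmp CC h (Cmp CC g f) = Cmp CC (Cmp CC h g) f"
    by (auto elim!: CC_homE intro: cmp_assoc)
qed

text \<open>Arrows of \<open>CC\<close> between two given chains are the arrows of \<open>K\<close>
  between their ends, so lifts and their uniqueness are inherited from the square in
  \<open>Q\<close>.\<close>

lemma CC_pullback:
  assumes "S \<in> QQ CC"
  shows "pullback CC S"
proof -
  interpret CC: category CC by (rule category_CC)
  from assms obtain e es d ds f g where ch: "sort_chain K t E (e # es)" "sort_chain K t E (d # ds)"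
    and q: "\<lparr>sTop = f, sBot = g, sLft = e, sRgt = d\<rparr> \<in> Q" (is "?S \<in> Q")
    and S: "S = \<lparr>sTop = (e # es, d # ds, f), sBot = (es, ds, g), sLft = (e # es, es, e), sRgt = (d # ds, ds, d)\<rparr>"
    unfolding CC_QQ by blast
  note c = comm_squareD[OF square_comm[OF q], simplified]
  note pb = square_pullback[OF q]
  show ?thesis
  proof (rule CC.pullbackI)
    show "comm_square CC S" using ch c by (simp add: S comm_square_def hom_iff)
  next
    fix z u v
    assume u: "u \<in> hom CC z (Src CC (sBot S))" and v: "v \<in> hom CC z (Src CC (sRgt S))"
      and uv: "Cmp CC (sBot S) u = Cmp CC (sRgt S) v"
    from u v obtain u' v' where u': "u = (z, es, u')" "u' \<in> hom K (chain_end K t z) (chain_end K t es)"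
      and v': "v = (z, d # ds, v')" "v' \<in> hom K (chain_end K t z) (Src K d)" and z: "sort_chain K t E z"
      by (auto elim!: CC_homE simp: S)
    have "u' \<in> hom K (chain_end K t z) (Src K (sBot ?S))" "v' \<in> hom K (chain_end K t z) (Src K (sRgt ?S))"
      "sBot ?S \<cdot> u' = sRgt ?S \<cdot> v'" using u' v' uv c ch by (auto simp: S)
    from pullback_lift[OF pb this] obtain h where "h \<in> hom K (chain_end K t z) (Src K f)" "e \<cdot> h = u'" "f \<cdot> h = v'"
      by auto
    then show "\<exists>h. h \<in> hom CC z (Src CC (sTop S)) \<and> Cmp CC (sLft S) h = u \<and> Cmp CC (sTop S) h = v"
      using ch c z u' v' by (intro exI[of _ "(z, e # es, h)"]) (simp add: S)
  next
    fix z h k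
    assume "h \<in> hom CC z (Src CC (sTop S))" "k \<in> hom CC z (Src CC (sTop S))"
      "Cmp CC (sLft S) h = Cmp CC (sLft S) k" "Cmp CC (sTop S) h = Cmp CC (sTop S) k"
    then show "h = k"
      using pullback_unique[OF pb] c by (auto elim!: CC_homE simp: S)
  qed
qed

lemma contextual_CC: "contextual CC"
proof -
  interpret CC: category CC by (rule category_CC)
  show ?thesis
  proof (unfold_locales)
    fix a assume "a \<in> Ob CC"
    then show "Ft CC a \<in> Ob CC" by (cases a) auto
    show "Len CC (Ft CC a) = Len CC a - 1" by simp
    show "Ft CC a = a" if "Len CC a = 0" using that by simp
    show "Pr CC a \<in> hom CC a (Ft CC a)" if "1 \<le> Len CC a"
      using that \<open>a \<in> Ob CC\<close> by (cases a) (auto simp: hom_iff sort_Ar)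
    show "terminal CC a" if "Len CC a = 0"
    proof -
      have "\<exists>!f. f \<in> hom CC xs []" if "xs \<in> Ob CC" for xs
      proof -
        have "\<exists>!f. f \<in> hom K (chain_end K t xs) t"
          using terminal_t that chain_end_Ob[of xs] by (simp add: terminal_def)
        then obtain f where f: "f \<in> hom K (chain_end K t xs) t"
          "\<And>g. g \<in> hom K (chain_end K t xs) t \<Longrightarrow> g = f" by blast
        show ?thesis
        proof (rule ex1I)
          show "(xs, [], f) \<in> hom CC xs []" using that f(1) by simp
          fix g assume "g \<in> hom CC xs []"
          then obtain k where "g = (xs, [], k)" "k \<in> hom K (chain_end K t xs) t"
            by (auto elim: CC_homE)
          then show "g = (xs, [], f)" using f(2)[of k] by simp
        qed
      qed
      then show ?thesis using that by (simp add: terminal_def)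
    qed
    show "\<lparr>sTop = Idn CC a, sBot = Idn CC (Ft CC a), sLft = Pr CC a, sRgt = Pr CC a\<rparr> \<in> QQ CC"
      if "1 \<le> Len CC a"
    proof -
      from that obtain e es where a: "a = e # es" by (cases a) auto
      then have e: "e \<in> E" "Tgt K e = chain_end K t es" and ch: "sort_chain K t E (e # es)"
        using \<open>a \<in> Ob CC\<close> by simp_all
      show ?thesis using CC_QQI[OF ch ch square_Idn[OF e(1)]] e by (simp add: a)
    qed
    fix f assume l: "1 \<le> Len CC a" and f: "f \<in> Ar CC" and tf: "Tgt CC f = Ft CC a"
    from l obtain e es where a: "a = e # es" by (cases a) auto
    then have e: "e \<in> E" "Tgt K e = chain_end K t es" and es: "sort_chain K t E es"
      using \<open>a \<in> Ob CC\<close> by simp_all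
    from f tf a obtain xs k where fk: "f = (xs, es, k)" by (cases f) auto
    then have xs: "sort_chain K t E xs" and k: "k \<in> hom K (chain_end K t xs) (chain_end K t es)" using f by auto
    have "k \<in> Ar K" "Tgt K k = Tgt K e" using k e by (simp_all add: hom_iff)
    from square_lift[OF e(1) this] obtain S where S: "S \<in> Q" "sRgt S = e" "sBot S = k"
      and un: "\<And>S'. S' \<in> Q \<Longrightarrow> sRgt S' = e \<Longrightarrow> sBot S' = k \<Longrightarrow> S' = S" by blast
    note c = comm_squareD[OF square_comm[OF S(1)]]
    let ?d = "sLft S"
    \<comment> \<open>The pulled back object is the source chain of \<open>f\<close>, lengthened by
      the left side of the lifted square.\<close>
    have ch: "sort_chain K t E (?d # xs)" using xs square_Lft[OF S(1)] c S k by (simp add: hom_iff)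
    have ch': "sort_chain K t E (e # es)" using \<open>a \<in> Ob CC\<close> a by simp
    have q: "\<lparr>sTop = sTop S, sBot = k, sLft = ?d, sRgt = e\<rparr> \<in> Q" using S by (cases S) simp
    have R: "\<lparr>sTop = (?d # xs, a, sTop S), sBot = f, sLft = (?d # xs, xs, ?d), sRgt = Pr CC a\<rparr> \<in> QQ CC"
      using CC_QQI[OF ch ch' q] by (simp add: a fk)
    show "\<exists>!S. S \<in> QQ CC \<and> sRgt S = Pr CC a \<and> sBot S = f"
    proof (rule ex1I, rule conjI, rule R)
      fix T assume T: "T \<in> QQ CC \<and> sRgt T = Pr CC a \<and> sBot T = f"
      then obtain e' es' d' ds' f' g' where
        T': "\<lparr>sTop = f', sBot = g', sLft = e', sRgt = d'\<rparr> \<in> Q"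
        "T = \<lparr>sTop = (e' # es', d' # ds', f'), sBot = (es', ds', g'), sLft = (e' # es', es', e'), sRgt = (d' # ds', ds', d')\<rparr>"
        unfolding CC_QQ by blast
      with T have "es' = xs" "g' = k" "d' = e" "ds' = es" by (simp_all add: a fk)
      moreover from this un[OF T'(1)] have "f' = sTop S" "e' = ?d" by auto
      ultimately show "T = \<lparr>sTop = (?d # xs, a, sTop S), sBot = f, sLft = (?d # xs, xs, ?d), sRgt = Pr CC a\<rparr>"
        using T'(2) by (simp add: a fk)
    qed simp
  next
    fix S assume S: "S \<in> QQ CC"
    show "pullback CC S" by (rule CC_pullback[OF S])
    then show "comm_square CC S" by (rule pullback_comm)
    from S obtain e es d ds f g where S': "sort_chain K t E (e # es)" "sort_chain K t E (d # ds)"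
      "\<lparr>sTop = f, sBot = g, sLft = e, sRgt = d\<rparr> \<in> Q"
      "S = \<lparr>sTop = (e # es, d # ds, f), sBot = (es, ds, g), sLft = (e # es, es, e), sRgt = (d # ds, ds, d)\<rparr>"
      unfolding CC_QQ by blast
    from S'(1) show "\<exists>a\<in>Ob CC. 1 \<le> Len CC a \<and> sLft S = Pr CC a"
      unfolding S'(4) by (intro bexI[of _ "e # es"]) simp_all
    from S'(2) show "\<exists>a\<in>Ob CC. 1 \<le> Len CC a \<and> sRgt S = Pr CC a"
      unfolding S'(4) by (intro bexI[of _ "d # ds"]) simp_all
    fix T assume T: "T \<in> QQ CC" and ST: "sRgt S = sLft T"
    from T obtain d0 ds0 d' ds' f' g' where T': "sort_chain K t E (d0 # ds0)" "sort_chain K t E (d' # ds')"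
      "\<lparr>sTop = f', sBot = g', sLft = d0, sRgt = d'\<rparr> \<in> Q"
      "T = \<lparr>sTop = (d0 # ds0, d' # ds', f'), sBot = (ds0, ds', g'), sLft = (d0 # ds0, ds0, d0), sRgt = (d' # ds', ds', d')\<rparr>"
      unfolding CC_QQ by blast
    have d: "d0 = d" "ds0 = ds" using ST unfolding S'(4) T'(4) by simp_all
    have "\<lparr>sTop = f' \<cdot> f, sBot = g' \<cdot> g, sLft = e, sRgt = d'\<rparr> \<in> Q"
      using square_Cmp[OF S'(3) T'(3)] d by simp
    from CC_QQI[OF S'(1) T'(2) this]
    show "\<lparr>sTop = Cmp CC (sTop T) (sTop S), sBot = Cmp CC (sBot T) (sBot S), sLft = sLft S, sRgt = sRgt T\<rparr> \<in> QQ CC"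
      unfolding S'(4) T'(4) d by simp
  next
    show "\<exists>!a. a \<in> Ob CC \<and> Len CC a = 0" by (rule ex1I[of _ "[]"]) simp_all
  qed
qed

end

section \<open>Models and the universal property of the reflection\<close>

text \<open>As \<open>K\<close> has neither length nor father, the conditions mention only
  \<open>t\<close>, sorts and squares; the tower below an object of \<open>A\<close> becomes the
  chain of the images of its projections.\<close>

definition models ::
  "('p, 'n, 'y) ctx_scheme \<Rightarrow> ('o, 'm, 'x) cat_scheme \<Rightarrow> 'o \<Rightarrow> 'm set \<Rightarrow> 'm square set \<Rightarrow> ('p, 'n, 'o, 'm) fctr set"
  where
  "models A K t E Q = {T \<in> functors A K.
     (\<forall>a \<in> Ob A. Len A a = 0 \<longrightarrow> Fo T a = t) \<and>
     (\<forall>a \<in> Ob A. 1 \<le> Len A a \<longrightarrow> Fa T (Pr A a) \<in> E) \<and>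
     (\<forall>S \<in> QQ A. map_square (Fa T) S \<in> Q)}"

lemma modelsD:
  assumes "T \<in> models A K t E Q"
  shows "T \<in> functors A K" "\<And>a. a \<in> Ob A \<Longrightarrow> Len A a = 0 \<Longrightarrow> Fo T a = t"
    "\<And>a. a \<in> Ob A \<Longrightarrow> 1 \<le> Len A a \<Longrightarrow> Fa T (Pr A a) \<in> E"
    "\<And>S. S \<in> QQ A \<Longrightarrow> map_square (Fa T) S \<in> Q"
  using assms by (auto simp: models_def)

text \<open>The number counts the projections still to be taken. Recursion along \<open>Ft\<close>
  itself would not terminate, since \<open>Ft\<close> is the identity at length 0.\<close>

fun sort_history :: "('p, 'n, 'y) ctx_scheme \<Rightarrow> ('p, 'n, 'o, 'm) fctr \<Rightarrow> nat \<Rightarrow> 'p \<Rightarrow> 'm list" where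
  "sort_history A T 0 a = []"
| "sort_history A T (Suc n) a = Fa T (Pr A a) # sort_history A T n (Ft A a)"

definition history :: "('p, 'n, 'y) ctx_scheme \<Rightarrow> ('p, 'n, 'o, 'm) fctr \<Rightarrow> 'p \<Rightarrow> 'm list" where
  "history A T a = sort_history A T (Len A a) a"

definition chain_functor ::
  "('p, 'n, 'y) ctx_scheme \<Rightarrow> ('p, 'n, 'o, 'm) fctr \<Rightarrow> ('p, 'n, 'm list, 'm list \<times> 'm list \<times> 'm) fctr" where
  "chain_functor A T = \<lparr>Fo = (\<lambda>a \<in> Ob A. history A T a),
     Fa = (\<lambda>f \<in> Ar A. (history A T (Src A f), history A T (Tgt A f), Fa T f))\<rparr>"

definition top_functor ::
  "('o, 'm, 'x) cat_scheme \<Rightarrow> 'o \<Rightarrow> ('p, 'n, 'y) ctx_scheme \<Rightarrow>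
   ('p, 'n, 'm list, 'm list \<times> 'm list \<times> 'm) fctr \<Rightarrow> ('p, 'n, 'o, 'm) fctr" where
  "top_functor K t A H = \<lparr>Fo = (\<lambda>a \<in> Ob A. chain_end K t (Fo H a)),
     Fa = (\<lambda>f \<in> Ar A. snd (snd (Fa H f)))\<rparr>"

lemma chain_functor_simps [simp]:
  "a \<in> Ob A \<Longrightarrow> Fo (chain_functor A T) a = history A T a"
  "f \<in> Ar A \<Longrightarrow> Fa (chain_functor A T) f = (history A T (Src A f), history A T (Tgt A f), Fa T f)"
  by (simp_all add: chain_functor_def)

lemma top_functor_simps [simp]:
  "a \<in> Ob A \<Longrightarrow> Fo (top_functor K t A H) a = chain_end K t (Fo H a)"
  "f \<in> Ar A \<Longrightarrow> Fa (top_functor K t A H) f = snd (snd (Fa H f))"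
  by (simp_all add: top_functor_def)

context precontextual
begin

lemma history_0 [simp]: "Len C a = 0 \<Longrightarrow> history C T a = []"
  by (simp add: history_def)

lemma history_pos:
  assumes "a \<in> Ob C" "1 \<le> Len C a"
  shows "history C T a = Fa T (Pr C a) # history C T (Ft C a)"
proof -
  obtain n where "Len C a = Suc n" using assms by (cases "Len C a") auto
  then show ?thesis using assms by (simp add: history_def len_ft)
qed

end

section \<open>Models correspond to contextual functors into chains\<close>

context sort_category
begin

lemma history_chain:
  assumes "precontextual A" "T \<in> models A K t E Q" "a \<in> Ob A"
  shows "sort_chain K t E (history A T a) \<and> chain_end K t (history A T a) = Fo T a
    \<and> length (history A T a) = Len A a"
  using assms(3)
proof (induction "Len A a" arbitrary: a)
  case 0
  interpret A: precontextual A by fact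
  show ?case using 0 modelsD(2)[OF assms(2)] by simp
next
  case (Suc n)
  interpret A: precontextual A by fact
  note T = modelsD[OF assms(2)]
  have l: "1 \<le> Len A a" and n: "n = Len A (Ft A a)" and o: "Ft A a \<in> Ob A"
    using Suc A.len_ft[of a] A.ft_Ob[of a] by simp_all
  have "Fa T (Pr A a) \<in> E" "Tgt K (Fa T (Pr A a)) = Fo T (Ft A a)" "Src K (Fa T (Pr A a)) = Fo T a"
    using T(3)[OF Suc.prems l] fctr_Ar[OF T(1), of "Pr A a"] l Suc.prems by simp_all
  then show ?case using Suc.hyps(1)[OF n o] n Suc.hyps(2) A.history_pos[OF Suc.prems l, of T] by simp
qed

lemma chain_functor_ctx:
  assumes "precontextual A" and T: "T \<in> models A K t E Q"
  shows "chain_functor A T \<in> ctx_functors A CC"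
proof -
  interpret A: precontextual A by fact
  note m = modelsD[OF T] and h = history_chain[OF assms]
  have "chain_functor A T \<in> functors A CC"
  proof (rule functorsI)
    show "Fo (chain_functor A T) \<in> extensional (Ob A)" "Fa (chain_functor A T) \<in> extensional (Ar A)"
      by (simp_all add: chain_functor_def)
  next
    fix f g assume "f \<in> Ar A" "g \<in> Ar A" "Src A g = Tgt A f"
    then show "Fa (chain_functor A T) (Cmp A g f) = Cmp CC (Fa (chain_functor A T) g) (Fa (chain_functor A T) f)"
      by (simp add: fctr_Cmp[OF m(1)])
  qed (use h in \<open>simp_all add: fctr_Ar[OF m(1)] hom_iff[of _ K] fctr_Idn[OF m(1)]\<close>)
  moreover have "map_square (Fa (chain_functor A T)) S \<in> QQ CC" if S: "S \<in> QQ A" for S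
  proof -
    obtain a b where ab: "a \<in> Ob A" "1 \<le> Len A a" "sLft S = Pr A a" "b \<in> Ob A" "1 \<le> Len A b"
      "sRgt S = Pr A b" "sTop S \<in> hom A a b" "sBot S \<in> hom A (Ft A a) (Ft A b)"
      using A.QQ_cases[OF S] .
    note hp = A.history_pos[OF ab(1,2), of T] A.history_pos[OF ab(4,5), of T]
    have "\<lparr>sTop = (history A T a, history A T b, Fa T (sTop S)),
       sBot = (history A T (Ft A a), history A T (Ft A b), Fa T (sBot S)),
       sLft = (history A T a, history A T (Ft A a), Fa T (Pr A a)),
       sRgt = (history A T b, history A T (Ft A b), Fa T (Pr A b))\<rparr> \<in> QQ CC"
      unfolding hp
    proof (rule CC_QQI)
      show "sort_chain K t E (Fa T (Pr A a) # history A T (Ft A a))"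
        "sort_chain K t E (Fa T (Pr A b) # history A T (Ft A b))"
        using h[OF ab(1)] h[OF ab(4)] hp by auto
      show "\<lparr>sTop = Fa T (sTop S), sBot = Fa T (sBot S), sLft = Fa T (Pr A a), sRgt = Fa T (Pr A b)\<rparr> \<in> Q"
        using m(4)[OF S] ab by (simp add: map_square_def)
    qed
    then show ?thesis using ab by (simp add: map_square_def hom_iff)
  qed
  ultimately show ?thesis
    using h by (auto simp: ctx_functors_def A.ft_Ob A.history_pos A.ft_len0 le_Suc_eq)
      (metis A.history_0 A.history_pos A.ft_len0 One_nat_def list.sel(2,3) not_less_eq_eq le_zero_eq)
qed

lemma top_functor_model:
  assumes "precontextual A" and H: "H \<in> ctx_functors A CC"
  shows "top_functor K t A H \<in> models A K t E Q"
proof -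
  interpret A: precontextual A by fact
  note h = ctx_functorsD[OF H]
  have arr: "\<exists>k. Fa H f = (Fo H (Src A f), Fo H (Tgt A f), k) \<and>
      k \<in> hom K (chain_end K t (Fo H (Src A f))) (chain_end K t (Fo H (Tgt A f)))" if "f \<in> Ar A" for f
    using fctr_Ar[OF h(1) that] by (cases "Fa H f") auto
  have chain: "sort_chain K t E (Fo H a)" if "a \<in> Ob A" for a
    using fctr_Ob[OF h(1) that] by simp
  have "top_functor K t A H \<in> functors A K"
  proof (rule functorsI)
    show "Fo (top_functor K t A H) \<in> extensional (Ob A)" "Fa (top_functor K t A H) \<in> extensional (Ar A)"
      by (simp_all add: top_functor_def)
  next
    fix f assume "f \<in> Ar A"
    then show "Fa (top_functor K t A H) f \<in> hom K (Fo (top_functor K t A H) (Src A f)) (Fo (top_functor K t A H) (Tgt A f))"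
      using arr[of f] by auto
  next
    fix f g assume fg: "f \<in> Ar A" "g \<in> Ar A" "Src A g = Tgt A f"
    then show "Fa (top_functor K t A H) (Cmp A g f) = Fa (top_functor K t A H) g \<cdot> Fa (top_functor K t A H) f"
      using fctr_Cmp[OF h(1) fg] arr[of f] arr[of g] by auto
  qed (use chain in \<open>simp_all add: chain_end_Ob fctr_Idn[OF h(1)]\<close>)
  moreover have "Fo (top_functor K t A H) a = t" if "a \<in> Ob A" "Len A a = 0" for a
    using h(2)[of a] that by simp
  moreover have "Fa (top_functor K t A H) (Pr A a) \<in> E" if "a \<in> Ob A" "1 \<le> Len A a" for a
    using h(2,4)[of a] that chain[of a] by (cases "Fo H a") simp_all
  moreover have "map_square (Fa (top_functor K t A H)) S \<in> Q" if S: "S \<in> QQ A" for S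
  proof -
    obtain e es d ds f g where "\<lparr>sTop = f, sBot = g, sLft = e, sRgt = d\<rparr> \<in> Q"
     "map_square (Fa H) S = \<lparr>sTop = (e # es, d # ds, f), sBot = (es, ds, g), sLft = (e # es, es, e), sRgt = (d # ds, ds, d)\<rparr>"
      using h(5)[OF S] unfolding CC_QQ by blast
    then show ?thesis using A.QQ_Ar[OF S] by (simp add: map_square_def)
  qed
  ultimately show ?thesis unfolding models_def by blast
qed

lemma top_chain_functor:
  assumes "precontextual A" and T: "T \<in> models A K t E Q"
  shows "top_functor K t A (chain_functor A T) = T"
  using top_functor_model[OF assms(1) chain_functor_ctx[OF assms]] modelsD(1)[OF T] history_chain[OF assms]
  by (intro fctr_eqI[of _ A K _ K]) (auto simp: modelsD(1))

text \<open>A contextual functor has no freedom in its lists: preservation of \<open>Pr\<close>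
  fixes the head and preservation of \<open>Ft\<close> the tail. By induction on the length it is
  recovered from the ends of its chains.\<close>

lemma chain_top_functor:
  assumes "precontextual A" and H: "H \<in> ctx_functors A CC"
  shows "chain_functor A (top_functor K t A H) = H"
proof -
  interpret A: precontextual A by fact
  note h = ctx_functorsD[OF H]
  have hist: "history A (top_functor K t A H) a = Fo H a" if "a \<in> Ob A" for a
    using that
  proof (induction "Len A a" arbitrary: a)
    case 0
    then show ?case using h(2)[of a] by simp
  next
    case (Suc n)
    then have l: "1 \<le> Len A a" by simp
    have "length (Fo H a) = Suc n" using h(2) Suc by simp
    then obtain e es where c: "Fo H a = e # es" by (cases "Fo H a") auto
    have "history A (top_functor K t A H) (Ft A a) = es"
      using Suc A.len_ft[of a] A.ft_Ob[of a] h(3)[of a] c by simp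
    then show ?case using A.history_pos[OF Suc.prems l, of "top_functor K t A H"] h(4)[OF Suc.prems l] Suc.prems l c by simp
  qed
  have "Fa H f = (Fo H (Src A f), Fo H (Tgt A f), snd (snd (Fa H f)))" if "f \<in> Ar A" for f
    using fctr_Ar[OF h(1) that] by (cases "Fa H f") auto
  with hist show ?thesis
    using ctx_functorsD(1)[OF chain_functor_ctx[OF assms(1) top_functor_model[OF assms]]] h(1)
    by (intro fctr_eqI[of _ A CC _ CC]) auto
qed

text \<open>Naturality of the correspondence in \<open>A\<close>; it turns the universal property
  for contextual functors into one for models.\<close>

lemma top_functor_comp:
  assumes "U \<in> functors A B"
  shows "top_functor K t A (comp_fctr A H U) = comp_fctr A (top_functor K t B H) U"
proof -
  have "Fo (top_functor K t A (comp_fctr A H U)) = Fo (comp_fctr A (top_functor K t B H) U)"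
    by (rule extensionalityI[of _ "Ob A"]) (auto simp: top_functor_def[of K t A] fctr_Ob[OF assms])
  moreover have "Fa (top_functor K t A (comp_fctr A H U)) = Fa (comp_fctr A (top_functor K t B H) U)"
    by (rule extensionalityI[of _ "Ar A"]) (auto simp: top_functor_def[of K t A] fctr_Ar[OF assms])
  ultimately show ?thesis by simp
qed

end

subsection \<open>Transport of structure to the type of the reflection\<close>

text \<open>\<open>reflection\<close> quantifies only over contextual categories on the type
  \<open>'u\<close>, and chains live on another type. Renaming along injections moves them;
  \<open>inv\<close> is used only on the images, which are the new carriers.\<close>

definition transport :: "('o \<Rightarrow> 'p) \<Rightarrow> ('m \<Rightarrow> 'n) \<Rightarrow> ('o, 'm) ctx \<Rightarrow> ('p, 'n) ctx" where
  "transport i j D =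
     \<lparr>Ob = i ` Ob D, Ar = j ` Ar D, Src = i \<circ> Src D \<circ> inv j, Tgt = i \<circ> Tgt D \<circ> inv j,
      Idn = j \<circ> Idn D \<circ> inv i, Cmp = (\<lambda>g f. j (Cmp D (inv j g) (inv j f))),
      Len = Len D \<circ> inv i, Ft = i \<circ> Ft D \<circ> inv i, Pr = j \<circ> Pr D \<circ> inv i,
      QQ = map_square j ` QQ D\<rparr>"

lemma contextual_transport:
  assumes "contextual D" "inj i" "inj j"
  shows "contextual (transport i j D)"
proof -
  interpret D: contextual D by fact
  let ?T = "transport i j D"
  have inv [simp]: "inv i (i a) = a" "inv j (j f) = f" for a f using assms by simp_all
  have ij [simp]: "i a = i b \<longleftrightarrow> a = b" "j f = j g \<longleftrightarrow> f = g" for a b f g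
    using assms by (simp_all add: inj_eq)
  have im [simp]: "i a \<in> i ` X \<longleftrightarrow> a \<in> X" "j f \<in> j ` Y \<longleftrightarrow> f \<in> Y" for a f X Y
    using assms by (simp_all add: inj_image_mem_iff)
  have T [simp]: "Ob ?T = i ` Ob D" "Ar ?T = j ` Ar D" "Src ?T (j f) = i (Src D f)" "Tgt ?T (j f) = i (Tgt D f)"
    "Idn ?T (i a) = j (Idn D a)" "Cmp ?T (j g) (j f) = j (Cmp D g f)"
    "Len ?T (i a) = Len D a" "Ft ?T (i a) = i (Ft D a)" "Pr ?T (i a) = j (Pr D a)" "QQ ?T = map_square j ` QQ D"
    for a f g by (simp_all add: transport_def)
  have hom: "f \<in> hom ?T x y \<longleftrightarrow> (\<exists>f' a b. f = j f' \<and> x = i a \<and> y = i b \<and> f' \<in> hom D a b)" for f x y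
    by (auto simp: hom_iff)
  have hom' [simp]: "j f \<in> hom ?T (i a) (i b) \<longleftrightarrow> f \<in> hom D a b" for f a b by (simp add: hom_iff)
  have comm: "comm_square ?T (map_square j S) \<longleftrightarrow> comm_square D S" for S
    by (simp add: comm_square_def)
  interpret T: category ?T
  proof
    fix f g h a b c d assume "f \<in> hom ?T a b" "g \<in> hom ?T b c" "h \<in> hom ?T c d"
    then show "Cmp ?T h (Cmp ?T g f) = Cmp ?T (Cmp ?T h g) f"
      by (auto simp: hom intro: D.cmp_assoc)
  next
    fix f g a b c assume "f \<in> hom ?T a b" "g \<in> hom ?T b c"
    then show "Cmp ?T g f \<in> hom ?T a c" by (auto simp: hom intro: D.cmp_hom)
  next
    fix f a b assume "f \<in> hom ?T a b"
    then show "Cmp ?T f (Idn ?T a) = f" "Cmp ?T (Idn ?T b) f = f" by (auto simp: hom_iff)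
  qed (auto simp: hom_iff)
  have pb: "pullback ?T (map_square j S)" if "pullback D S" for S
  proof (rule T.pullbackI)
    note pc = pullback_comm[OF that]
    note c = comm_squareD[OF pc]
    show "comm_square ?T (map_square j S)" by (simp add: comm pc)
    { fix z u v assume "u \<in> hom ?T z (Src ?T (sBot (map_square j S)))" "v \<in> hom ?T z (Src ?T (sRgt (map_square j S)))"
        "Cmp ?T (sBot (map_square j S)) u = Cmp ?T (sRgt (map_square j S)) v"
      then obtain z' u' v' where "z = i z'" "u = j u'" "v = j v'" "u' \<in> hom D z' (Src D (sBot S))"
        "v' \<in> hom D z' (Src D (sRgt S))" "Cmp D (sBot S) u' = Cmp D (sRgt S) v'" by (auto simp: hom)
      with pullback_lift[OF that, of u' z' v'] obtain h where "h \<in> hom D z' (Src D (sTop S))"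
        "Cmp D (sLft S) h = u'" "Cmp D (sTop S) h = v'" by blast
      then show "\<exists>h. h \<in> hom ?T z (Src ?T (sTop (map_square j S))) \<and> Cmp ?T (sLft (map_square j S)) h = u \<and>
          Cmp ?T (sTop (map_square j S)) h = v"
        using \<open>z = i z'\<close> \<open>u = j u'\<close> \<open>v = j v'\<close> by (intro exI[of _ "j h"]) simp }
    { fix z h k assume "h \<in> hom ?T z (Src ?T (sTop (map_square j S)))" "k \<in> hom ?T z (Src ?T (sTop (map_square j S)))"
        "Cmp ?T (sLft (map_square j S)) h = Cmp ?T (sLft (map_square j S)) k"
        "Cmp ?T (sTop (map_square j S)) h = Cmp ?T (sTop (map_square j S)) k"
      then show "h = k" by (auto simp: hom intro: D.pullback_unique[OF that]) }
  qed
  show ?thesis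
  proof unfold_locales
    fix x assume "x \<in> Ob ?T"
    then obtain a where a: "x = i a" "a \<in> Ob D" by auto
    then show "Ft ?T x \<in> Ob ?T" "1 \<le> Len ?T x \<Longrightarrow> Len ?T (Ft ?T x) = Len ?T x - 1"
      "Len ?T x = 0 \<Longrightarrow> Ft ?T x = x" "1 \<le> Len ?T x \<Longrightarrow> Pr ?T x \<in> hom ?T x (Ft ?T x)"
      by (simp_all add: D.ft_Ob D.len_ft D.ft_len0 D.pr_hom)
    show "terminal ?T x" if "Len ?T x = 0"
    proof -
      have "\<exists>!f. f \<in> hom ?T (i b) x" if b: "b \<in> Ob D" for b
      proof -
        have "\<exists>!f. f \<in> hom D b a"
          using D.len0_terminal[of a] a \<open>Len ?T x = 0\<close> b by (simp add: terminal_def)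
        then obtain f where f: "f \<in> hom D b a" "\<And>g. g \<in> hom D b a \<Longrightarrow> g = f" by blast
        show ?thesis
        proof (rule ex1I)
          show "j f \<in> hom ?T (i b) x" using f(1) a by simp
          fix g assume "g \<in> hom ?T (i b) x"
          then obtain g' where "g = j g'" "g' \<in> hom D b a" using a by (auto simp: hom)
          then show "g = j f" using f(2)[of g'] by simp
        qed
      qed
      then show ?thesis using a by (auto simp: terminal_def)
    qed
    show "\<lparr>sTop = Idn ?T x, sBot = Idn ?T (Ft ?T x), sLft = Pr ?T x, sRgt = Pr ?T x\<rparr> \<in> QQ ?T" if "1 \<le> Len ?T x"
    proof -
      have "map_square j \<lparr>sTop = Idn D a, sBot = Idn D (Ft D a), sLft = Pr D a, sRgt = Pr D a\<rparr> \<in> QQ ?T"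
        using D.Q_id[of a] a that by simp
      then show ?thesis by (simp add: map_square_def a)
    qed
    fix f assume f: "f \<in> Ar ?T" "Tgt ?T f = Ft ?T x" and l: "1 \<le> Len ?T x"
    then obtain f' where f': "f = j f'" "f' \<in> Ar D" "Tgt D f' = Ft D a" using a by auto
    have "\<exists>!S. S \<in> QQ D \<and> sRgt S = Pr D a \<and> sBot S = f'"
      using D.Q_lift[of a f'] a f' l by simp
    then obtain S where S: "S \<in> QQ D" "sRgt S = Pr D a" "sBot S = f'"
      and un: "\<And>S'. S' \<in> QQ D \<Longrightarrow> sRgt S' = Pr D a \<Longrightarrow> sBot S' = f' \<Longrightarrow> S' = S" by blast
    show "\<exists>!S. S \<in> QQ ?T \<and> sRgt S = Pr ?T x \<and> sBot S = f"
    proof (rule ex1I)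
      show "map_square j S \<in> QQ ?T \<and> sRgt (map_square j S) = Pr ?T x \<and> sBot (map_square j S) = f"
        using S a f' by simp
      fix R assume "R \<in> QQ ?T \<and> sRgt R = Pr ?T x \<and> sBot R = f"
      then obtain R' where "R' \<in> QQ D" "R = map_square j R'" "sRgt R' = Pr D a" "sBot R' = f'"
        using a f' by auto
      then show "R = map_square j S" using un by simp
    qed
  next
    fix S assume "S \<in> QQ ?T"
    then obtain S' where S': "S = map_square j S'" "S' \<in> QQ D" by auto
    show "pullback ?T S" using pb D.Q_pullback S' by simp
    then show "comm_square ?T S" by (rule pullback_comm)
    show "\<exists>a\<in>Ob ?T. 1 \<le> Len ?T a \<and> sLft S = Pr ?T a" using D.Q_lft[OF S'(2)] S' by auto
    show "\<exists>a\<in>Ob ?T. 1 \<le> Len ?T a \<and> sRgt S = Pr ?T a" using D.Q_rgt[OF S'(2)] S' by auto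
    fix R assume "R \<in> QQ ?T" "sRgt S = sLft R"
    then obtain R' where R': "R = map_square j R'" "R' \<in> QQ D" "sRgt S' = sLft R'" using S' by auto
    have "map_square j \<lparr>sTop = Cmp D (sTop R') (sTop S'), sBot = Cmp D (sBot R') (sBot S'), sLft = sLft S', sRgt = sRgt R'\<rparr> \<in> QQ ?T"
      using D.Q_horizontal[OF S'(2) R'(2,3)] by simp
    then show "\<lparr>sTop = Cmp ?T (sTop R) (sTop S), sBot = Cmp ?T (sBot R) (sBot S), sLft = sLft S, sRgt = sRgt R\<rparr> \<in> QQ ?T"
      by (simp add: map_square_def S' R')
  next
    obtain a where a: "a \<in> Ob D" "Len D a = 0" "\<And>b. b \<in> Ob D \<Longrightarrow> Len D b = 0 \<Longrightarrow> b = a"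
      using D.len0_unique by blast
    show "\<exists>!x. x \<in> Ob ?T \<and> Len ?T x = 0" 
    proof (rule ex1I)
      show "i a \<in> Ob ?T \<and> Len ?T (i a) = 0" using a(1,2) by simp
      fix x assume "x \<in> Ob ?T \<and> Len ?T x = 0"
      then obtain b where "x = i b" "b \<in> Ob D" "Len D b = 0" by auto
      then show "x = i a" using a(3)[of b] by simp
    qed
  qed
qed

lemma transport_functors:
  assumes "contextual D" "inj i" "inj j"
  defines "J \<equiv> \<lparr>Fo = restrict i (Ob D), Fa = restrict j (Ar D)\<rparr>"
    and "J' \<equiv> \<lparr>Fo = restrict (inv i) (i ` Ob D), Fa = restrict (inv j) (j ` Ar D)\<rparr>"
  shows "J \<in> ctx_functors D (transport i j D)" "J' \<in> ctx_functors (transport i j D) D"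
    "comp_fctr D J' J = id_fctr D" "comp_fctr (transport i j D) J J' = id_fctr (transport i j D)"
proof -
  interpret D: contextual D by fact
  let ?T = "transport i j D"
  interpret T: contextual ?T by (rule contextual_transport[OF assms(1-3)])
  have inv [simp]: "inv i (i a) = a" "inv j (j f) = f" for a f using assms by simp_all
  have T [simp]: "Ob ?T = i ` Ob D" "Ar ?T = j ` Ar D" "Src ?T (j f) = i (Src D f)" "Tgt ?T (j f) = i (Tgt D f)"
    "Idn ?T (i a) = j (Idn D a)" "Cmp ?T (j g) (j f) = j (Cmp D g f)"
    "Len ?T (i a) = Len D a" "Ft ?T (i a) = i (Ft D a)" "Pr ?T (i a) = j (Pr D a)" "QQ ?T = map_square j ` QQ D"
    for a f g by (simp_all add: transport_def)
  have ij: "i a = i b \<longleftrightarrow> a = b" "j f = j g \<longleftrightarrow> f = g" for a b f g using assms by (simp_all add: inj_eq)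
  have sq: "map_square (Fa J) S = map_square j S" "map_square (Fa J') (map_square j S) = S" if "S \<in> QQ D" for S
    using D.QQ_Ar[OF that] by (simp_all add: J_def J'_def map_square_def)
  have JF: "J \<in> functors D ?T"
    by (rule functorsI) (auto simp: J_def hom_iff)
  moreover have J'F: "J' \<in> functors ?T D"
    by (rule functorsI) (auto simp: J'_def hom_iff ij)
  ultimately show "J \<in> ctx_functors D ?T" "J' \<in> ctx_functors ?T D"
    unfolding ctx_functors_def by (auto simp: sq) (auto simp: J_def J'_def D.ft_Ob)
  show "comp_fctr D J' J = id_fctr D"
    by (rule fctr_eqI[OF D.comp_fctr_functors[OF JF J'F] D.id_fctr_functors]) (auto simp: J_def J'_def)
  show "comp_fctr ?T J J' = id_fctr ?T"
    by (rule fctr_eqI[OF T.comp_fctr_functors[OF J'F JF] T.id_fctr_functors]) (auto simp: J_def J'_def)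
qed

text \<open>Extend into the renamed copy of \<open>D\<close>, then return along the inverse
  renaming. Renaming a competitor \<open>G'\<close> gives an extension into the copy, whence
  uniqueness.\<close>

lemma reflection_universal:
  fixes A L :: "('u, 'u) ctx" and D :: "('o, 'm) ctx" and i :: "'o \<Rightarrow> 'u" and j :: "'m \<Rightarrow> 'u"
  assumes "precontextual A" "reflection A L \<iota>" "contextual D" "inj i" "inj j" "F \<in> ctx_functors A D"
  shows "\<exists>!G. G \<in> ctx_functors L D \<and> comp_fctr A G \<iota> = F"
proof -
  interpret A: precontextual A by fact
  interpret D: contextual D by fact
  have Lc: "contextual L" and \<iota>: "\<iota> \<in> ctx_functors A L" using assms(2) by (simp_all add: reflection_def)
  interpret L: contextual L by fact
  let ?T = "transport i j D"
  have Tc: "contextual ?T" by (rule contextual_transport[OF assms(3-5)])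
  interpret T: contextual ?T by (rule Tc)
  obtain J J' where J: "J \<in> ctx_functors D ?T" "J' \<in> ctx_functors ?T D" "comp_fctr D J' J = id_fctr D"
    "comp_fctr ?T J J' = id_fctr ?T"
    using transport_functors[OF assms(3-5)] by blast
  note f = ctx_functorsD(1)
  have "\<exists>!G. G \<in> ctx_functors L ?T \<and> comp_fctr A G \<iota> = comp_fctr A J F"
    using assms(2) Tc A.comp_ctx_functors[OF assms(6) J(1)] by (simp add: reflection_def)
  then obtain G where G: "G \<in> ctx_functors L ?T" "comp_fctr A G \<iota> = comp_fctr A J F"
    and un: "\<And>G'. G' \<in> ctx_functors L ?T \<Longrightarrow> comp_fctr A G' \<iota> = comp_fctr A J F \<Longrightarrow> G' = G" by blast
  show ?thesis
  proof (rule ex1I, intro conjI)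
    show "comp_fctr L J' G \<in> ctx_functors L D" by (rule L.comp_ctx_functors[OF G(1) J(2)])
    have "comp_fctr A (comp_fctr L J' G) \<iota> = comp_fctr A J' (comp_fctr A J F)"
      using A.comp_fctr_assoc[OF f[OF \<iota>] f[OF G(1)] f[OF J(2)] L.category_axioms] G(2) by simp
    also have "\<dots> = F"
      using A.comp_fctr_assoc[OF f[OF assms(6)] f[OF J(1)] f[OF J(2)] D.category_axioms]
      by (simp add: J(3) A.id_comp_fctr[OF D.category_axioms f[OF assms(6)]])
    finally show "comp_fctr A (comp_fctr L J' G) \<iota> = F" .
    fix G' assume G': "G' \<in> ctx_functors L D \<and> comp_fctr A G' \<iota> = F"
    then have g: "G' \<in> ctx_functors L D" by simp
    have "comp_fctr L J G' = G"
    proof (rule un)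
      show "comp_fctr L J G' \<in> ctx_functors L ?T" by (rule L.comp_ctx_functors[OF g J(1)])
      show "comp_fctr A (comp_fctr L J G') \<iota> = comp_fctr A J F"
        using A.comp_fctr_assoc[OF f[OF \<iota>] f[OF g] f[OF J(1)] L.category_axioms] G' by simp
    qed
    then have "comp_fctr L J' G = comp_fctr L (comp_fctr D J' J) G'"
      using L.comp_fctr_assoc[OF f[OF g] f[OF J(1)] f[OF J(2)] D.category_axioms] by simp
    then show "G' = comp_fctr L J' G"
      by (simp add: J(3) L.id_comp_fctr[OF D.category_axioms f[OF g]])
  qed
qed

section \<open>Injections of products and lists into an infinite type\<close>

lemma ex_inj_prod:
  assumes "infinite (UNIV :: 'u set)" "\<exists>f :: 'a \<Rightarrow> 'u. inj f" "\<exists>g :: 'b \<Rightarrow> 'u. inj g"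
  shows "\<exists>h :: 'a \<times> 'b \<Rightarrow> 'u. inj h"
proof -
  obtain f :: "'a \<Rightarrow> 'u" and g :: "'b \<Rightarrow> 'u" where fg: "inj f" "inj g" using assms by blast
  obtain p :: "'u \<times> 'u \<Rightarrow> 'u" where "bij_betw p (UNIV \<times> UNIV) UNIV"
    using card_of_ordIso[of "UNIV \<times> UNIV :: ('u \<times> 'u) set" "UNIV :: 'u set"]
      card_of_Times_same_infinite[OF assms(1)] by blast
  then have p: "inj p" by (simp add: bij_betw_def)
  have "inj (\<lambda>x. p (f (fst x), g (snd x)))"
  proof (rule injI)
    fix x y assume "p (f (fst x), g (snd x)) = p (f (fst y), g (snd y))"
    from injD[OF p this] have "f (fst x) = f (fst y)" "g (snd x) = g (snd y)" by simp_all
    then show "x = y" using injD[OF fg(1)] injD[OF fg(2)] by (simp add: prod_eq_iff)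
  qed
  then show ?thesis by blast
qed

text \<open>Iterated pairing. The code \<open>c\<close> of the empty list may lie in the range of
  \<open>p\<close>, so a code need not reveal the length of its list.\<close>

fun encode_list :: "'u \<Rightarrow> ('a \<times> 'u \<Rightarrow> 'u) \<Rightarrow> 'a list \<Rightarrow> 'u" where
  "encode_list c p [] = c"
| "encode_list c p (x # xs) = p (x, encode_list c p xs)"

lemma encode_list_inj:
  assumes p: "inj p" and "length xs = length ys" "encode_list c p xs = encode_list c p ys"
  shows "xs = ys"
  using assms(2,3)
proof (induction xs arbitrary: ys)
  case (Cons x xs)
  then obtain y zs where ys: "ys = y # zs" by (cases ys) auto
  then have "p (x, encode_list c p xs) = p (y, encode_list c p zs)" using Cons.prems by simp
  then have "(x, encode_list c p xs) = (y, encode_list c p zs)" by (rule injD[OF p])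
  then show ?case using Cons ys by simp
qed simp

text \<open>\<open>encode_list_inj\<close> compares lists of equal length; the length is therefore
  recorded next to the code, through an injection of \<open>nat\<close> into
  \<open>'u\<close>.\<close>

lemma ex_inj_list:
  assumes "infinite (UNIV :: 'u set)" "\<exists>f :: 'a \<Rightarrow> 'u. inj f"
  shows "\<exists>h :: 'a list \<Rightarrow> 'u. inj h"
proof -
  obtain n :: "nat \<Rightarrow> 'u" where n: "inj n"
    using assms(1) infinite_countable_subset by blast
  have "\<exists>f :: 'u \<Rightarrow> 'u. inj f" using inj_on_id by blast
  then obtain p :: "'a \<times> 'u \<Rightarrow> 'u" and q :: "nat \<times> 'u \<Rightarrow> 'u" where pq: "inj p" "inj q"
    using ex_inj_prod[OF assms] ex_inj_prod[OF assms(1), where ?'a = nat and ?'b = 'u] n by blast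
  have "inj (\<lambda>xs. q (length xs, encode_list undefined p xs))"
  proof (rule injI)
    fix xs ys assume "q (length xs, encode_list undefined p xs) = q (length ys, encode_list undefined p ys)"
    then have "length xs = length ys" "encode_list undefined p xs = encode_list undefined p ys"
      using injD[OF pq(2)] by blast+
    then show "xs = ys" by (rule encode_list_inj[OF pq(1)])
  qed
  then show ?thesis by blast
qed

text \<open>A model is a contextual functor into chains, and the reflection extends that functor
  once the chains are encoded in \<open>'u\<close>. The correspondence is natural in the domain, so
  restriction along \<open>\<iota>\<close> and uniqueness carry over.\<close>

theorem (in sort_category) model_extension:
  fixes A L :: "('u, 'u) ctx"
  assumes A: "precontextual A" and R: "reflection A L \<iota>"
    and inf: "infinite (UNIV :: 'u set)" and "\<exists>f :: 'm \<Rightarrow> 'u. inj f"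
    and T: "T \<in> models A K t E Q"
  shows "\<exists>!T'. T' \<in> models L K t E Q \<and> comp_fctr A T' \<iota> = T"
proof -
  interpret A: precontextual A by fact
  have Lc: "contextual L" and \<iota>: "\<iota> \<in> ctx_functors A L" using R by (simp_all add: reflection_def)
  interpret L: contextual L by fact
  note \<iota>F = ctx_functorsD(1)[OF \<iota>] and Lp = L.precontextual_axioms
  have l: "\<exists>f :: 'm list \<Rightarrow> 'u. inj f" by (rule ex_inj_list[OF inf assms(4)])
  then obtain i :: "'m list \<Rightarrow> 'u" where i: "inj i" by blast
  obtain j :: "'m list \<times> 'm list \<times> 'm \<Rightarrow> 'u" where j: "inj j"
    using ex_inj_prod[OF inf l ex_inj_prod[OF inf l assms(4)]] by blast
  have "\<exists>!G. G \<in> ctx_functors L CC \<and> comp_fctr A G \<iota> = chain_functor A T"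
    by (rule reflection_universal[OF A R contextual_CC i j chain_functor_ctx[OF A T]])
  then obtain G where G: "G \<in> ctx_functors L CC" "comp_fctr A G \<iota> = chain_functor A T"
    and un: "\<And>G'. G' \<in> ctx_functors L CC \<Longrightarrow> comp_fctr A G' \<iota> = chain_functor A T \<Longrightarrow> G' = G" by blast
  show ?thesis
  proof (rule ex1I, intro conjI)
    show "top_functor K t L G \<in> models L K t E Q" by (rule top_functor_model[OF Lp G(1)])
    show "comp_fctr A (top_functor K t L G) \<iota> = T"
      using top_functor_comp[OF \<iota>F, of G] G(2) top_chain_functor[OF A T] by simp
    fix T' assume T': "T' \<in> models L K t E Q \<and> comp_fctr A T' \<iota> = T"
    then have m: "T' \<in> models L K t E Q" by simp
    note c = chain_functor_ctx[OF Lp m]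
    have "chain_functor L T' = G"
    proof (rule un[OF c])
      \<comment> \<open>Two contextual functors into chains agree as soon as their top functors
        do.\<close>
      have "comp_fctr A (chain_functor L T') \<iota> = chain_functor A (top_functor K t A (comp_fctr A (chain_functor L T') \<iota>))"
        by (rule chain_top_functor[OF A A.comp_ctx_functors[OF \<iota> c], symmetric])
      then show "comp_fctr A (chain_functor L T') \<iota> = chain_functor A T"
        using top_functor_comp[OF \<iota>F, of "chain_functor L T'"] top_chain_functor[OF Lp m] T' by simp
    qed
    then show "T' = top_functor K t L G" using top_chain_functor[OF Lp m] by simp
  qed
qed

text \<open>
  If \<open>P\<close> exhibits sorts and squares as lying over projections and squares in \<open>Q\<close> of \<open>L\<close>, then the
  extension of a model over \<open>\<iota>\<close> is a section of \<open>P\<close>, since the identity is the only contextual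
  endofunctor of \<open>L\<close> under \<open>\<iota>\<close>.
\<close>

theorem (in sort_category) model_extension_over:
  fixes A L :: "('u, 'u) ctx"
  assumes A: "precontextual A" and R: "reflection A L \<iota>"
    and inf: "infinite (UNIV :: 'u set)" and inj: "\<exists>f :: 'm \<Rightarrow> 'u. inj f"
    and P: "P \<in> functors K L" "Fo P t = one L"
    and PE: "\<And>e. e \<in> E \<Longrightarrow> 1 \<le> Len L (Fo P (Src K e)) \<and> Fa P e = Pr L (Fo P (Src K e))"
    and PQ: "\<And>S. S \<in> Q \<Longrightarrow> map_square (Fa P) S \<in> QQ L"
    and T: "T \<in> models A K t E Q" and PT: "comp_fctr A P T = \<iota>"
  shows "\<exists>T'. T' \<in> models L K t E Q \<and> comp_fctr A T' \<iota> = T \<and> comp_fctr L P T' = id_fctr L"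
proof -
  interpret A: precontextual A by fact
  have Lc: "contextual L" and \<iota>: "\<iota> \<in> ctx_functors A L" using R by (simp_all add: reflection_def)
  interpret L: contextual L by fact
  obtain T' where T': "T' \<in> models L K t E Q" "comp_fctr A T' \<iota> = T"
    using model_extension[OF A R inf inj T] by blast
  note m = modelsD[OF T'(1)]
  let ?G = "comp_fctr L P T'"
  have F: "?G \<in> functors L L" by (rule L.comp_fctr_functors[OF m(1) P(1)])
  have pr: "1 \<le> Len L (Fo ?G a) \<and> Fa ?G (Pr L a) = Pr L (Fo ?G a) \<and> Fo ?G (Ft L a) = Ft L (Fo ?G a)"
    if a: "a \<in> Ob L" "1 \<le> Len L a" for a
  proof -
    have s: "Src K (Fa T' (Pr L a)) = Fo T' a" using fctr_Ar(2)[OF m(1), of "Pr L a"] a by simp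
    have l: "1 \<le> Len L (Fo ?G a)" and p: "Fa ?G (Pr L a) = Pr L (Fo ?G a)"
      using PE[OF m(3)[OF a]] s a by simp_all
    moreover have "Fo ?G (Ft L a) = Tgt L (Fa ?G (Pr L a))" using fctr_Ar(3)[OF F, of "Pr L a"] a by simp
    ultimately show ?thesis using fctr_Ob[OF F a(1)] by simp
  qed
  \<comment> \<open>\<open>PE\<close> says only that these lengths are positive. Equality follows by
    counting down along \<open>Ft\<close>, with \<open>Fo P t = one L\<close> at the bottom.\<close>
  have len: "Len L (Fo ?G a) = Len L a" if "a \<in> Ob L" for a
    using that
  proof (induction "Len L a" arbitrary: a)
    case 0
    then show ?case using m(2) P(2) by simp
  next
    case (Suc n)
    then have a: "1 \<le> Len L a" by simp
    have "Len L (Fo ?G (Ft L a)) = Len L (Ft L a)"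
      using Suc L.ft_Ob L.len_ft[of a] by simp
    moreover have "Fo ?G (Ft L a) = Ft L (Fo ?G a)" and p: "1 \<le> Len L (Fo ?G a)"
      using pr[OF Suc.prems a] by blast+
    moreover have "Len L (Ft L (Fo ?G a)) = Len L (Fo ?G a) - 1"
      using L.len_ft[OF fctr_Ob[OF F Suc.prems]] pr[OF Suc.prems a] by blast
    ultimately show ?case using L.len_ft[OF Suc.prems a] a by simp
  qed
  have "?G \<in> ctx_functors L L"
    unfolding ctx_functors_def
  proof (intro CollectI conjI ballI impI F len)
    fix a assume a: "a \<in> Ob L"
    show "Fo ?G (Ft L a) = Ft L (Fo ?G a)"
    proof (cases "Len L a = 0")
      case True
      then show ?thesis using a len[OF a] fctr_Ob[OF F a] L.ft_len0 by metis
    qed (use pr[OF a] in simp)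
    show "Fa ?G (Pr L a) = Pr L (Fo ?G a)" if "1 \<le> Len L a" using pr[OF a that] by simp
  next
    fix S assume S: "S \<in> QQ L"
    show "map_square (Fa ?G) S \<in> QQ L"
      using L.map_square_comp_fctr[OF S, of P T'] PQ[OF m(4)[OF S]] by simp
  qed
  moreover have "comp_fctr A ?G \<iota> = \<iota>"
    using A.comp_fctr_assoc[OF ctx_functorsD(1)[OF \<iota>] m(1) P(1) L.category_axioms] T'(2) PT by simp
  moreover have "comp_fctr A (id_fctr L) \<iota> = \<iota>"
    by (rule A.id_comp_fctr[OF L.category_axioms ctx_functorsD(1)[OF \<iota>]])
  moreover have "\<exists>!G. G \<in> ctx_functors L L \<and> comp_fctr A G \<iota> = \<iota>"
    using R Lc \<iota> unfolding reflection_def by blast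
  ultimately have "?G = id_fctr L" using L.id_ctx_functors by blast
  then show ?thesis using T' by blast
qed

section \<open>Functors preserving display maps\<close>

lemma disp_Ob: "F \<in> Ob (disp_fun_cat A C) \<longleftrightarrow> F \<in> functors A C \<and>
    (\<forall>f \<in> displays A. Fa F f \<in> displays C) \<and> (\<forall>a \<in> Ob A. Len A a = 0 \<longrightarrow> Fo F a = one C)"
  by (simp add: disp_fun_cat_def full_subcat_def fun_cat_def)

lemma disp_Ar: "\<tau> \<in> Ar (disp_fun_cat A C) \<longleftrightarrow> NDom \<tau> \<in> Ob (disp_fun_cat A C) \<and> NCod \<tau> \<in> Ob (disp_fun_cat A C) \<and>
    NCmp \<tau> \<in> extensional (Ob A) \<and> (\<forall>a \<in> Ob A. NCmp \<tau> a \<in> hom C (Fo (NDom \<tau>) a) (Fo (NCod \<tau>) a)) \<and>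
    (\<forall>f \<in> Ar A. comm_square C (natsq A \<tau> f))"
  by (auto simp: disp_fun_cat_def full_subcat_def fun_cat_def)

lemma disp_simps [simp]:
  "Src (disp_fun_cat A C) = NDom" "Tgt (disp_fun_cat A C) = NCod"
  "Idn (disp_fun_cat A C) F = \<lparr>NDom = F, NCod = F, NCmp = (\<lambda>a \<in> Ob A. Idn C (Fo F a))\<rparr>"
  "Cmp (disp_fun_cat A C) \<tau> \<sigma> = \<lparr>NDom = NDom \<sigma>, NCod = NCod \<tau>, NCmp = (\<lambda>a \<in> Ob A. NCmp \<tau> a \<cdot>\<^bsub>C\<^esub> NCmp \<sigma> a)\<rparr>"
  by (simp_all add: disp_fun_cat_def full_subcat_def fun_cat_def)

lemma disp_hom: "\<tau> \<in> hom (disp_fun_cat A C) F G \<longleftrightarrow> \<tau> \<in> Ar (disp_fun_cat A C) \<and> NDom \<tau> = F \<and> NCod \<tau> = G"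
  by (simp add: hom_def)

lemma natsq_simps [simp]:
  "sTop (natsq A \<pi> f) = NCmp \<pi> (Src A f)" "sBot (natsq A \<pi> f) = NCmp \<pi> (Tgt A f)"
  "sLft (natsq A \<pi> f) = Fa (NDom \<pi>) f" "sRgt (natsq A \<pi> f) = Fa (NCod \<pi>) f"
  by (simp_all add: natsq_def)

lemma disp_ArD:
  assumes "\<tau> \<in> Ar (disp_fun_cat A C)"
  shows "NDom \<tau> \<in> Ob (disp_fun_cat A C)" "NCod \<tau> \<in> Ob (disp_fun_cat A C)" "NCmp \<tau> \<in> extensional (Ob A)"
    "NDom \<tau> \<in> functors A C" "NCod \<tau> \<in> functors A C"
    "\<And>a. a \<in> Ob A \<Longrightarrow> NCmp \<tau> a \<in> hom C (Fo (NDom \<tau>) a) (Fo (NCod \<tau>) a)"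
    "\<And>f. f \<in> Ar A \<Longrightarrow> Fa (NCod \<tau>) f \<cdot>\<^bsub>C\<^esub> NCmp \<tau> (Src A f) = NCmp \<tau> (Tgt A f) \<cdot>\<^bsub>C\<^esub> Fa (NDom \<tau>) f"
    "\<And>f. f \<in> Ar A \<Longrightarrow> comm_square C (natsq A \<tau> f)"
  using assms unfolding disp_Ar disp_Ob by (auto simp: comm_square_def)

lemma comm_natsqI:
  assumes "category A" "F \<in> functors A C" "G \<in> functors A C" "NDom \<tau> = F" "NCod \<tau> = G" "f \<in> Ar A"
    "\<And>a. a \<in> Ob A \<Longrightarrow> NCmp \<tau> a \<in> hom C (Fo F a) (Fo G a)"
    "Fa G f \<cdot>\<^bsub>C\<^esub> NCmp \<tau> (Src A f) = NCmp \<tau> (Tgt A f) \<cdot>\<^bsub>C\<^esub> Fa F f"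
  shows "comm_square C (natsq A \<tau> f)"
proof -
  interpret A: category A by fact
  have "NCmp \<tau> (Src A f) \<in> hom C (Fo F (Src A f)) (Fo G (Src A f))"
    "NCmp \<tau> (Tgt A f) \<in> hom C (Fo F (Tgt A f)) (Fo G (Tgt A f))"
    using assms(6,7) by simp_all
  then show ?thesis
    using assms(4-6,8) fctr_Ar[OF assms(2,6)] fctr_Ar[OF assms(3,6)]
    by (simp add: comm_square_def hom_iff)
qed

text \<open>Display maps are composites of projections and are closed under composition; the image
  of a projection may have any length.\<close>

lemma preserves_displaysI:
  assumes "precontextual A" "precontextual C" and F: "F \<in> functors A C"
    and p: "\<And>a. a \<in> Ob A \<Longrightarrow> 1 \<le> Len A a \<Longrightarrow> Fa F (Pr A a) \<in> displays C"
    and f: "f \<in> displays A"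
  shows "Fa F f \<in> displays C"
proof -
  interpret A: precontextual A by fact
  interpret C: precontextual C by fact
  show ?thesis using f
  proof (induction rule: displays.induct)
    case (displays_id a)
    then show ?case using fctr_Idn[OF F] fctr_Ob[OF F] displays.displays_id by metis
  next
    case (displays_step a f)
    note f = A.displays_Ar[OF displays_step(3)]
    have "Fa F f \<cdot>\<^bsub>C\<^esub> Fa F (Pr A a) \<in> displays C"
      using displays_step f p[OF displays_step(1,2)] fctr_Ar[OF F f] fctr_Ar[OF F A.Ar_Pr[OF displays_step(1,2)]]
      by (intro C.displays_comp) simp_all
    then show ?case using fctr_Cmp[OF F A.Ar_Pr[OF displays_step(1,2)] f] displays_step(1,2,4) by simp
  qed
qed

lemma (in contextual) ex_to_one: "a \<in> Ob C \<Longrightarrow> \<exists>f. f \<in> hom C a (one C)"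
  using terminal_one by (auto simp: terminal_def)

lemma indexed_sortD:
  assumes "indexed_sort A C \<pi>"
  shows "\<pi> \<in> Ar (disp_fun_cat A C)"
    "\<And>a. a \<in> Ob A \<Longrightarrow> 1 \<le> Len A a \<Longrightarrow> rel_display1 C (natsq A \<pi> (Pr A a))"
    "\<And>S. S \<in> QQ A \<Longrightarrow>
      \<lparr>sTop = Fa (NDom \<pi>) (sTop S),
       sBot = corner_map C (natsq A \<pi> (sLft S)) (natsq A \<pi> (sRgt S)) (Fa (NDom \<pi>) (sBot S)) (Fa (NCod \<pi>) (sTop S)),
       sLft = gap C (natsq A \<pi> (sLft S)), sRgt = gap C (natsq A \<pi> (sRgt S))\<rparr> \<in> distinguished C"
  using assms unfolding indexed_sort_def by (auto simp: Let_def)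

section \<open>Indexed sorts as models\<close>

text \<open>The comma category of \<open>C\<close> over \<open>F\<close>. A section of its
  projection to \<open>L\<close> is a functor together with a natural transformation to
  \<open>F\<close>, which is the raw material of an indexed sort.\<close>

definition comma_cat ::
  "('o, 'm, 'x) ctx_scheme \<Rightarrow> ('p, 'n, 'y) ctx_scheme \<Rightarrow> ('o, 'm, 'p, 'n) fctr \<Rightarrow>
   ('o \<times> 'n, ('o \<times> 'n) \<times> ('o \<times> 'n) \<times> 'm \<times> 'n) cat" where
  "comma_cat L C F =
     \<lparr>Ob = {(a, \<pi>). a \<in> Ob L \<and> \<pi> \<in> Ar C \<and> Tgt C \<pi> = Fo F a},
      Ar = {((a, \<pi>), (b, \<rho>), f, k). f \<in> hom L a b \<and> \<pi> \<in> Ar C \<and> Tgt C \<pi> = Fo F a \<and>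
              \<rho> \<in> Ar C \<and> Tgt C \<rho> = Fo F b \<and> k \<in> hom C (Src C \<pi>) (Src C \<rho>) \<and>
              \<rho> \<cdot>\<^bsub>C\<^esub> k = Fa F f \<cdot>\<^bsub>C\<^esub> \<pi>},
      Src = fst,
      Tgt = (\<lambda>(x, y, f, k). y),
      Idn = (\<lambda>(a, \<pi>). ((a, \<pi>), (a, \<pi>), Idn L a, Idn C (Src C \<pi>))),
      Cmp = (\<lambda>(y', z, g, l) (x, y, f, k). (x, z, g \<cdot>\<^bsub>L\<^esub> f, l \<cdot>\<^bsub>C\<^esub> k))\<rparr>"

fun base_arr :: "('o \<times> 'n) \<times> ('o \<times> 'n) \<times> 'm \<times> 'n \<Rightarrow> 'm" where
  "base_arr (x, y, f, k) = f"

fun fibre_arr :: "('o \<times> 'n) \<times> ('o \<times> 'n) \<times> 'm \<times> 'n \<Rightarrow> 'n" where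
  "fibre_arr (x, y, f, k) = k"

text \<open>Laid out as \<open>natsq\<close>, so that sorts and squares of the comma category become
  the clauses of \<open>indexed_sort\<close> (see \<open>csq\<close> in
  \<open>sort_model\<close>).\<close>

fun comma_square :: "('o, 'm, 'p, 'n) fctr \<Rightarrow> ('o \<times> 'n) \<times> ('o \<times> 'n) \<times> 'm \<times> 'n \<Rightarrow> 'n square" where
  "comma_square F ((a, \<pi>), (b, \<rho>), f, k) = \<lparr>sTop = \<pi>, sBot = \<rho>, sLft = k, sRgt = Fa F f\<rparr>"

definition comma_sorts ::
  "('o, 'm, 'x) ctx_scheme \<Rightarrow> ('p, 'n, 'y) ctx_scheme \<Rightarrow> ('o, 'm, 'p, 'n) fctr \<Rightarrow>
   (('o \<times> 'n) \<times> ('o \<times> 'n) \<times> 'm \<times> 'n) set" where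
  "comma_sorts L C F = {e \<in> Ar (comma_cat L C F).
     (\<exists>a \<in> Ob L. 1 \<le> Len L a \<and> base_arr e = Pr L a) \<and> rel_display1 C (comma_square F e)}"

definition comma_squares ::
  "('o, 'm, 'x) ctx_scheme \<Rightarrow> ('p, 'n, 'y) ctx_scheme \<Rightarrow> ('o, 'm, 'p, 'n) fctr \<Rightarrow>
   (('o \<times> 'n) \<times> ('o \<times> 'n) \<times> 'm \<times> 'n) square set" where
  "comma_squares L C F = {S. comm_square (comma_cat L C F) S \<and>
     sLft S \<in> comma_sorts L C F \<and> sRgt S \<in> comma_sorts L C F \<and> map_square base_arr S \<in> QQ L \<and>
     \<lparr>sTop = fibre_arr (sTop S),
      sBot = corner_map C (comma_square F (sLft S)) (comma_square F (sRgt S))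
               (fibre_arr (sBot S)) (Fa F (base_arr (sTop S))),
      sLft = gap C (comma_square F (sLft S)),
      sRgt = gap C (comma_square F (sRgt S))\<rparr> \<in> distinguished C}"

locale display_functor = L: contextual L + C: contextual C
  for L :: "('o, 'm, 'x) ctx_scheme" and C :: "('p, 'n, 'y) ctx_scheme" (structure) +
  fixes F :: "('o, 'm, 'p, 'n) fctr"
  assumes F_disp: "F \<in> Ob (disp_fun_cat L C)"
begin

lemma F_functor: "F \<in> functors L C"
  and F_displays: "f \<in> displays L \<Longrightarrow> Fa F f \<in> displays C"
  and F_one: "Fo F (one L) = one C"
  using F_disp unfolding disp_Ob by simp_all

lemmas F_Ob [simp] = fctr_Ob[OF F_functor]
lemmas F_Ar [simp] = fctr_Ar[OF F_functor]
lemmas F_Idn [simp] = fctr_Idn[OF F_functor]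
lemmas F_Cmp = fctr_Cmp[OF F_functor]

abbreviation "KK \<equiv> comma_cat L C F"
abbreviation "KE \<equiv> comma_sorts L C F"
abbreviation "KQ \<equiv> comma_squares L C F"

lemma KK_simps [simp]:
  "(a, \<pi>) \<in> Ob KK \<longleftrightarrow> a \<in> Ob L \<and> \<pi> \<in> Ar C \<and> Tgt C \<pi> = Fo F a"
  "((a, \<pi>), (b, \<rho>), f, k) \<in> Ar KK \<longleftrightarrow> f \<in> hom L a b \<and> \<pi> \<in> Ar C \<and> Tgt C \<pi> = Fo F a \<and>
     \<rho> \<in> Ar C \<and> Tgt C \<rho> = Fo F b \<and> k \<in> hom C (Src C \<pi>) (Src C \<rho>) \<and>
     \<rho> \<cdot> k = Fa F f \<cdot> \<pi>"
  "Src KK (x, y, f, k) = x" "Tgt KK (x, y, f, k) = y"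
  "Idn KK (a, \<pi>) = ((a, \<pi>), (a, \<pi>), Idn L a, Idn C (Src C \<pi>))"
  "Cmp KK (y', z, g, l) (x, y, f, k) = (x, z, g \<cdot>\<^bsub>L\<^esub> f, l \<cdot> k)"
  by (simp_all add: comma_cat_def)

lemma KK_homE:
  assumes "h \<in> hom KK (a, \<pi>) (b, \<rho>)"
  obtains f k where "h = ((a, \<pi>), (b, \<rho>), f, k)" "f \<in> hom L a b" "\<pi> \<in> Ar C" "Tgt C \<pi> = Fo F a"
     "\<rho> \<in> Ar C" "Tgt C \<rho> = Fo F b" "k \<in> hom C (Src C \<pi>) (Src C \<rho>)" "\<rho> \<cdot> k = Fa F f \<cdot> \<pi>"
  using assms by (cases h) (auto simp: hom_iff[of _ KK])

lemma KK_hom [simp]: "((a, \<pi>), (b, \<rho>), f, k) \<in> hom KK (a', \<pi>') (b', \<rho>') \<longleftrightarrow>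
    a = a' \<and> \<pi> = \<pi>' \<and> b = b' \<and> \<rho> = \<rho>' \<and> f \<in> hom L a b \<and> \<pi> \<in> Ar C \<and> Tgt C \<pi> = Fo F a \<and>
     \<rho> \<in> Ar C \<and> Tgt C \<rho> = Fo F b \<and> k \<in> hom C (Src C \<pi>) (Src C \<rho>) \<and>
     \<rho> \<cdot> k = Fa F f \<cdot> \<pi>"
  by (auto simp: hom_iff[of _ KK])

lemma KK_Cmp_comm:
  assumes "f \<in> hom L a b" "\<pi> \<in> Ar C" "Tgt C \<pi> = Fo F a" "\<rho> \<in> Ar C" "Tgt C \<rho> = Fo F b"
     "k \<in> hom C (Src C \<pi>) (Src C \<rho>)" "\<rho> \<cdot> k = Fa F f \<cdot> \<pi>"
    and "g \<in> hom L b c" "\<sigma> \<in> Ar C" "Tgt C \<sigma> = Fo F c" "l \<in> hom C (Src C \<rho>) (Src C \<sigma>)"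
      "\<sigma> \<cdot> l = Fa F g \<cdot> \<rho>"
  shows "\<sigma> \<cdot> (l \<cdot> k) = Fa F (g \<cdot>\<^bsub>L\<^esub> f) \<cdot> \<pi>"
proof -
  have "\<sigma> \<cdot> (l \<cdot> k) = (Fa F g \<cdot> \<rho>) \<cdot> k"
    using assms by (intro C.Cmp_reassoc assms(12)) (auto simp: hom_iff)
  also have "\<dots> = Fa F g \<cdot> (\<rho> \<cdot> k)"
    using assms(1-6,8) by (intro C.Cmp_assoc) (auto simp: hom_iff)
  also have "\<dots> = Fa F g \<cdot> (Fa F f \<cdot> \<pi>)" by (simp add: assms(7))
  also have "\<dots> = (Fa F g \<cdot> Fa F f) \<cdot> \<pi>"
    using assms(1-6,8) by (intro C.Cmp_assoc[symmetric]) (auto simp: hom_iff)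
  also have "\<dots> = Fa F (g \<cdot>\<^bsub>L\<^esub> f) \<cdot> \<pi>"
    using assms(1,8) by (simp add: F_Cmp hom_iff)
  finally show ?thesis .
qed

lemma category_KK: "category KK"
proof
  fix h assume h: "h \<in> Ar KK"
  obtain a \<pi> b \<rho> f k where e: "h = ((a, \<pi>), (b, \<rho>), f, k)" by (metis prod.collapse)
  then show "Src KK h \<in> Ob KK" "Tgt KK h \<in> Ob KK" using h by (auto simp: hom_iff)
next
  fix x assume "x \<in> Ob KK"
  then show "Idn KK x \<in> hom KK x x" by (cases x) (auto simp: hom_iff[of _ C] hom_iff[of _ L])
next
  fix h g x y z assume h: "h \<in> hom KK x y" and g: "g \<in> hom KK y z"
  obtain a \<pi> b \<rho> c \<sigma> where xyz: "x = (a, \<pi>)" "y = (b, \<rho>)" "z = (c, \<sigma>)" by (metis prod.collapse)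
  from KK_homE[OF h[unfolded xyz]] obtain f k where f: "h = ((a, \<pi>), (b, \<rho>), f, k)" "f \<in> hom L a b" "\<pi> \<in> Ar C" "Tgt C \<pi> = Fo F a"
     "\<rho> \<in> Ar C" "Tgt C \<rho> = Fo F b" "k \<in> hom C (Src C \<pi>) (Src C \<rho>)" "\<rho> \<cdot> k = Fa F f \<cdot> \<pi>" .
  from KK_homE[OF g[unfolded xyz]] obtain f' k' where g: "g = ((b, \<rho>), (c, \<sigma>), f', k')" "f' \<in> hom L b c" "\<rho> \<in> Ar C" "Tgt C \<rho> = Fo F b"
     "\<sigma> \<in> Ar C" "Tgt C \<sigma> = Fo F c" "k' \<in> hom C (Src C \<rho>) (Src C \<sigma>)" "\<sigma> \<cdot> k' = Fa F f' \<cdot> \<rho>" .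
  show "Cmp KK g h \<in> hom KK x z"
    using KK_Cmp_comm[OF f(2-8) g(2,5-8)] f(3,4) g(5,6) C.cmp_hom[OF f(7) g(7)] L.cmp_hom[OF f(2) g(2)]
    by (simp add: f(1) g(1) xyz)
next
  fix h x y assume h: "h \<in> hom KK x y"
  obtain a \<pi> b \<rho> where xy: "x = (a, \<pi>)" "y = (b, \<rho>)" by (metis prod.collapse)
  from KK_homE[OF h[unfolded xy]] obtain f k where "h = ((a, \<pi>), (b, \<rho>), f, k)" "f \<in> hom L a b" "k \<in> hom C (Src C \<pi>) (Src C \<rho>)" .
  then show "Cmp KK h (Idn KK x) = h" "Cmp KK (Idn KK y) h = h" by (simp_all add: xy hom_iff)
next
  fix h g i x y z w assume h: "h \<in> hom KK x y" and g: "g \<in> hom KK y z" and i: "i \<in> hom KK z w"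
  obtain a \<pi> b \<rho> c \<sigma> d \<tau> where xyz: "x = (a, \<pi>)" "y = (b, \<rho>)" "z = (c, \<sigma>)" "w = (d, \<tau>)" by (metis prod.collapse)
  from KK_homE[OF h[unfolded xyz]] obtain f k where f: "h = ((a, \<pi>), (b, \<rho>), f, k)" "f \<in> hom L a b" "k \<in> hom C (Src C \<pi>) (Src C \<rho>)" .
  from KK_homE[OF g[unfolded xyz]] obtain f' k' where g: "g = ((b, \<rho>), (c, \<sigma>), f', k')" "f' \<in> hom L b c" "k' \<in> hom C (Src C \<rho>) (Src C \<sigma>)" .
  from KK_homE[OF i[unfolded xyz]] obtain f'' k'' where i: "i = ((c, \<sigma>), (d, \<tau>), f'', k'')" "f'' \<in> hom L c d" "k'' \<in> hom C (Src C \<sigma>) (Src C \<tau>)" .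
  show "Cmp KK i (Cmp KK g h) = Cmp KK (Cmp KK i g) h"
    using L.cmp_assoc[OF f(2) g(2) i(2)] C.cmp_assoc[OF f(3) g(3) i(3)] by (simp add: f(1) g(1) i(1))
qed

lemma terminal_KK: "terminal KK (one L, Idn C (one C))"
  unfolding terminal_def
proof (intro conjI ballI)
  show "(one L, Idn C (one C)) \<in> Ob KK" by (simp add: F_one)
  fix x assume x: "x \<in> Ob KK"
  obtain a \<pi> where xa: "x = (a, \<pi>)" by (metis prod.collapse)
  then have a: "a \<in> Ob L" "\<pi> \<in> Ar C" "Tgt C \<pi> = Fo F a" using x by simp_all
  have "\<exists>f. f \<in> hom L a (one L)" "\<exists>k. k \<in> hom C (Src C \<pi>) (one C)"
    using L.ex_to_one C.ex_to_one a by simp_all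
  then obtain f k where f: "f \<in> hom L a (one L)" and k: "k \<in> hom C (Src C \<pi>) (one C)" by blast
  have "Idn C (one C) \<cdot> k = Fa F f \<cdot> \<pi>"
    using f k a F_one by (intro C.to_one_eq) (auto simp: hom_iff)
  then have "((a, \<pi>), (one L, Idn C (one C)), f, k) \<in> hom KK x (one L, Idn C (one C))"
    using f k a F_one by (simp add: xa)
  then show "\<exists>!h. h \<in> hom KK x (one L, Idn C (one C))"
  proof (rule ex1I)
    fix h assume "h \<in> hom KK x (one L, Idn C (one C))"
    from KK_homE[OF this[unfolded xa]] obtain f' k' where h: "h = ((a, \<pi>), (one L, Idn C (one C)), f', k')"
      "f' \<in> hom L a (one L)" "k' \<in> hom C (Src C \<pi>) (Src C (Idn C (one C)))" .
    have "f' = f" "k' = k" using h f k L.to_one_eq[of f' f] C.to_one_eq[of k' k] by (simp_all add: hom_iff)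
    then show "h = ((a, \<pi>), (one L, Idn C (one C)), f, k)" using h by simp
  qed
qed

lemma KE_cases:
  assumes "e \<in> KE"
  obtains a \<pi> \<rho> k where "e = ((a, \<pi>), (Ft L a, \<rho>), Pr L a, k)" "a \<in> Ob L" "1 \<le> Len L a"
    "\<pi> \<in> Ar C" "Tgt C \<pi> = Fo F a" "\<rho> \<in> Ar C" "Tgt C \<rho> = Fo F (Ft L a)" "k \<in> hom C (Src C \<pi>) (Src C \<rho>)"
    "\<rho> \<cdot> k = Fa F (Pr L a) \<cdot> \<pi>"
    "rel_display1 C (comma_square F e)"
proof -
  obtain a \<pi> b \<rho> f k where e: "e = ((a, \<pi>), (b, \<rho>), f, k)" by (metis prod.collapse)
  with assms obtain c where c: "c \<in> Ob L" "1 \<le> Len L c" "f = Pr L c" and K: "e \<in> Ar KK"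
    and r: "rel_display1 C (comma_square F e)"
    by (auto simp: comma_sorts_def)
  have "c = a" "b = Ft L a" using K e c by (auto simp: hom_iff)
  then show thesis using that[of a \<pi> \<rho> k] e c K r by simp
qed

text \<open>The last conclusion is the point: the components of a square between sorts form a
  morphism of cospans, so the map between corners demanded by \<open>comma_squares\<close>
  exists.\<close>

lemma KQ_cases:
  assumes "comm_square KK S" "sLft S \<in> KE" "sRgt S \<in> KE"
  obtains a' \<pi>' \<rho>' l a \<pi> \<rho> r f' k' f k where
    "S = \<lparr>sTop = ((a', \<pi>'), (a, \<pi>), f', k'), sBot = ((Ft L a', \<rho>'), (Ft L a, \<rho>), f, k),
          sLft = ((a', \<pi>'), (Ft L a', \<rho>'), Pr L a', l), sRgt = ((a, \<pi>), (Ft L a, \<rho>), Pr L a, r)\<rparr>"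
    "a' \<in> Ob L" "1 \<le> Len L a'" "a \<in> Ob L" "1 \<le> Len L a"
    "rel_display1 C \<lparr>sTop = \<pi>', sBot = \<rho>', sLft = l, sRgt = Fa F (Pr L a')\<rparr>"
    "rel_display1 C \<lparr>sTop = \<pi>, sBot = \<rho>, sLft = r, sRgt = Fa F (Pr L a)\<rparr>"
    "f' \<in> hom L a' a" "f \<in> hom L (Ft L a') (Ft L a)"
    "\<pi>' \<in> hom C (Src C \<pi>') (Fo F a')" "\<pi> \<in> hom C (Src C \<pi>) (Fo F a)"
    "\<rho>' \<in> hom C (Src C \<rho>') (Fo F (Ft L a'))" "\<rho> \<in> hom C (Src C \<rho>) (Fo F (Ft L a))"
    "k' \<in> hom C (Src C \<pi>') (Src C \<pi>)" "k \<in> hom C (Src C \<rho>') (Src C \<rho>)"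
    "l \<in> hom C (Src C \<pi>') (Src C \<rho>')" "r \<in> hom C (Src C \<pi>) (Src C \<rho>)"
    "\<pi> \<cdot> k' = Fa F f' \<cdot> \<pi>'" "\<rho> \<cdot> k = Fa F f \<cdot> \<rho>'"
    "Pr L a \<cdot>\<^bsub>L\<^esub> f' = f \<cdot>\<^bsub>L\<^esub> Pr L a'" "r \<cdot> k' = k \<cdot> l"
    "cospan_map C \<lparr>sTop = \<pi>', sBot = \<rho>', sLft = l, sRgt = Fa F (Pr L a')\<rparr>
       \<lparr>sTop = \<pi>, sBot = \<rho>, sLft = r, sRgt = Fa F (Pr L a)\<rparr> k (Fa F f') (Fa F f)"
proof -
  note c = comm_squareD[OF assms(1)]
  from KE_cases[OF assms(2)] obtain a' \<pi>' \<rho>' l where l: "sLft S = ((a', \<pi>'), (Ft L a', \<rho>'), Pr L a', l)"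
    "a' \<in> Ob L" "1 \<le> Len L a'" "\<pi>' \<in> Ar C" "Tgt C \<pi>' = Fo F a'" "\<rho>' \<in> Ar C" "Tgt C \<rho>' = Fo F (Ft L a')" "l \<in> hom C (Src C \<pi>') (Src C \<rho>')"
    "\<rho>' \<cdot> l = Fa F (Pr L a') \<cdot> \<pi>'" and rl: "rel_display1 C (comma_square F (sLft S))" .
  from KE_cases[OF assms(3)] obtain a \<pi> \<rho> r where r: "sRgt S = ((a, \<pi>), (Ft L a, \<rho>), Pr L a, r)"
    "a \<in> Ob L" "1 \<le> Len L a" "\<pi> \<in> Ar C" "Tgt C \<pi> = Fo F a" "\<rho> \<in> Ar C" "Tgt C \<rho> = Fo F (Ft L a)" "r \<in> hom C (Src C \<pi>) (Src C \<rho>)"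
    "\<rho> \<cdot> r = Fa F (Pr L a) \<cdot> \<pi>" and rr: "rel_display1 C (comma_square F (sRgt S))" .
  have "sTop S \<in> hom KK (a', \<pi>') (a, \<pi>)" using c(1,5,6) l(1) r(1) by (simp add: hom_iff[of _ KK])
  from KK_homE[OF this] obtain f' k' where t: "sTop S = ((a', \<pi>'), (a, \<pi>), f', k')" "f' \<in> hom L a' a"
    "k' \<in> hom C (Src C \<pi>') (Src C \<pi>)" "\<pi> \<cdot> k' = Fa F f' \<cdot> \<pi>'" .
  have "sBot S \<in> hom KK (Ft L a', \<rho>') (Ft L a, \<rho>)" using c(2,7,8) l(1) r(1) by (simp add: hom_iff[of _ KK])
  from KK_homE[OF this] obtain f k where b: "sBot S = ((Ft L a', \<rho>'), (Ft L a, \<rho>), f, k)"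
    "f \<in> hom L (Ft L a') (Ft L a)" "k \<in> hom C (Src C \<rho>') (Src C \<rho>)" "\<rho> \<cdot> k = Fa F f \<cdot> \<rho>'" .
  have cm: "Pr L a \<cdot>\<^bsub>L\<^esub> f' = f \<cdot>\<^bsub>L\<^esub> Pr L a'" "r \<cdot> k' = k \<cdot> l"
    using c(9) l(1) r(1) t(1) b(1) by simp_all
  have rl': "rel_display1 C \<lparr>sTop = \<pi>', sBot = \<rho>', sLft = l, sRgt = Fa F (Pr L a')\<rparr>"
    and rr': "rel_display1 C \<lparr>sTop = \<pi>, sBot = \<rho>, sLft = r, sRgt = Fa F (Pr L a)\<rparr>"
    using rl rr l(1) r(1) by simp_all
  have S: "S = \<lparr>sTop = ((a', \<pi>'), (a, \<pi>), f', k'), sBot = ((Ft L a', \<rho>'), (Ft L a, \<rho>), f, k),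
          sLft = ((a', \<pi>'), (Ft L a', \<rho>'), Pr L a', l), sRgt = ((a, \<pi>), (Ft L a, \<rho>), Pr L a, r)\<rparr>"
    using l(1) r(1) t(1) b(1) by (cases S) simp
  have "Fa F (Pr L a) \<cdot> Fa F f' = Fa F f \<cdot> Fa F (Pr L a')"
    using F_Cmp[of f' "Pr L a"] F_Cmp[of "Pr L a'" f] cm(1) l(2,3) r(2,3) t(2) b(2) by (simp add: hom_iff)
  then have "cospan_map C \<lparr>sTop = \<pi>', sBot = \<rho>', sLft = l, sRgt = Fa F (Pr L a')\<rparr>
       \<lparr>sTop = \<pi>, sBot = \<rho>, sLft = r, sRgt = Fa F (Pr L a)\<rparr> k (Fa F f') (Fa F f)"
    using C.rel_display1D(4)[OF rl'] C.rel_display1D(4)[OF rr'] l(2-7) r(2-7) t(2) b(2-4)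
    by (simp add: cospan_map_def hom_iff)
  with S l(2-8) r(2-8) t b rl' rr' cm show thesis
    by (intro that[of a' \<pi>' a \<pi> f' k' \<rho>' \<rho> f k l r]) (simp_all add: in_hom hom_iff)
qed

text \<open>A cone is lifted in three stages: its base by the pullback in \<open>L\<close>, its
  fibre to the corner of the left naturality square \<open>?N\<close>, and from there to the top
  left vertex by the distinguished square of gap maps. Uniqueness is tested along the same
  stages.\<close>

lemma KQ_pullback:
  assumes S: "S \<in> KQ"
  shows "pullback KK S"
proof -
  interpret K: category KK by (rule category_KK)
  from S have cS: "comm_square KK S" and E: "sLft S \<in> KE" "sRgt S \<in> KE" and LQ: "map_square base_arr S \<in> QQ L"
    and D: "\<lparr>sTop = fibre_arr (sTop S),
      sBot = corner_map C (comma_square F (sLft S)) (comma_square F (sRgt S))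
               (fibre_arr (sBot S)) (Fa F (base_arr (sTop S))),
      sLft = gap C (comma_square F (sLft S)),
      sRgt = gap C (comma_square F (sRgt S))\<rparr> \<in> distinguished C"
    by (simp_all add: comma_squares_def)
  from KQ_cases[OF cS E] obtain a' \<pi>' \<rho>' l a \<pi> \<rho> r f' k' f k where
    Se: "S = \<lparr>sTop = ((a', \<pi>'), (a, \<pi>), f', k'), sBot = ((Ft L a', \<rho>'), (Ft L a, \<rho>), f, k),
          sLft = ((a', \<pi>'), (Ft L a', \<rho>'), Pr L a', l), sRgt = ((a, \<pi>), (Ft L a, \<rho>), Pr L a, r)\<rparr>"
    and a: "a' \<in> Ob L" "1 \<le> Len L a'" "a \<in> Ob L" "1 \<le> Len L a"
    and rl: "rel_display1 C \<lparr>sTop = \<pi>', sBot = \<rho>', sLft = l, sRgt = Fa F (Pr L a')\<rparr>"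
    and rr: "rel_display1 C \<lparr>sTop = \<pi>, sBot = \<rho>, sLft = r, sRgt = Fa F (Pr L a)\<rparr>"
    and f: "f' \<in> hom L a' a" "f \<in> hom L (Ft L a') (Ft L a)"
    and \<pi>: "\<pi>' \<in> hom C (Src C \<pi>') (Fo F a')" "\<pi> \<in> hom C (Src C \<pi>) (Fo F a)"
    "\<rho>' \<in> hom C (Src C \<rho>') (Fo F (Ft L a'))" "\<rho> \<in> hom C (Src C \<rho>) (Fo F (Ft L a))"
    and k: "k' \<in> hom C (Src C \<pi>') (Src C \<pi>)" "k \<in> hom C (Src C \<rho>') (Src C \<rho>)"
    "l \<in> hom C (Src C \<pi>') (Src C \<rho>')" "r \<in> hom C (Src C \<pi>) (Src C \<rho>)"
    and e: "\<pi> \<cdot> k' = Fa F f' \<cdot> \<pi>'" "\<rho> \<cdot> k = Fa F f \<cdot> \<rho>'"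
    "Pr L a \<cdot>\<^bsub>L\<^esub> f' = f \<cdot>\<^bsub>L\<^esub> Pr L a'" "r \<cdot> k' = k \<cdot> l"
    and cm: "cospan_map C \<lparr>sTop = \<pi>', sBot = \<rho>', sLft = l, sRgt = Fa F (Pr L a')\<rparr>
       \<lparr>sTop = \<pi>, sBot = \<rho>, sLft = r, sRgt = Fa F (Pr L a)\<rparr> k (Fa F f') (Fa F f)" .
  let ?N = "\<lparr>sTop = \<pi>', sBot = \<rho>', sLft = l, sRgt = Fa F (Pr L a')\<rparr>"
  let ?M = "\<lparr>sTop = \<pi>, sBot = \<rho>, sLft = r, sRgt = Fa F (Pr L a)\<rparr>"
  note rN = C.rel_display1D[OF rl] and rM = C.rel_display1D[OF rr]
  note gN = C.gap[OF rN(1,2), simplified] and gM = C.gap[OF rM(1,2), simplified]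
  note cN = C.corner_facts[OF rN(4), simplified] and cM = C.corner_facts[OF rM(4), simplified]
  note m = C.corner_map[OF cm]
  let ?m = "corner_map C ?N ?M k (Fa F f')"
  have D': "pullback C \<lparr>sTop = k', sBot = ?m, sLft = gap C ?N, sRgt = gap C ?M\<rparr>"
    using C.distinguished_pullback[OF D] by (simp add: Se)
  have LP: "pullback L \<lparr>sTop = f', sBot = f, sLft = Pr L a', sRgt = Pr L a\<rparr>"
    using L.Q_pullback[OF LQ] by (simp add: Se map_square_def)
  show ?thesis
  proof (rule K.pullbackI[OF cS])
    fix z u v assume u: "u \<in> hom KK z (Src KK (sBot S))" and v: "v \<in> hom KK z (Src KK (sRgt S))"
      and uv: "sBot S \<cdot>\<^bsub>KK\<^esub> u = sRgt S \<cdot>\<^bsub>KK\<^esub> v"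
    obtain x \<zeta> where z: "z = (x, \<zeta>)" by (metis prod.collapse)
    have "u \<in> hom KK (x, \<zeta>) (Ft L a', \<rho>')" "v \<in> hom KK (x, \<zeta>) (a, \<pi>)" using u v by (simp_all add: Se z)
    from KK_homE[OF this(1)] KK_homE[OF this(2)] obtain fu ku fv kv
      where u': "u = ((x, \<zeta>), (Ft L a', \<rho>'), fu, ku)" "fu \<in> hom L x (Ft L a')" "\<zeta> \<in> Ar C" "Tgt C \<zeta> = Fo F x"
        "ku \<in> hom C (Src C \<zeta>) (Src C \<rho>')" "\<rho>' \<cdot> ku = Fa F fu \<cdot> \<zeta>"
      and v': "v = ((x, \<zeta>), (a, \<pi>), fv, kv)" "fv \<in> hom L x a"
        "kv \<in> hom C (Src C \<zeta>) (Src C \<pi>)" "\<pi> \<cdot> kv = Fa F fv \<cdot> \<zeta>" by metis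
    have x: "x \<in> Ob L" using u'(2) by (auto simp: hom_iff)
    have uv': "f \<cdot>\<^bsub>L\<^esub> fu = Pr L a \<cdot>\<^bsub>L\<^esub> fv" "k \<cdot> ku = r \<cdot> kv"
      using uv by (simp_all add: Se u'(1) v'(1))
    have "fu \<in> hom L x (Src L f)" "fv \<in> hom L x (Src L (Pr L a))" using u' v' f a by (simp_all add: hom_iff)
    \<comment> \<open>The base component is settled in \<open>L\<close> before the fibre is
      considered.\<close>
    then obtain w where w: "w \<in> hom L x a'" "Pr L a' \<cdot>\<^bsub>L\<^esub> w = fu" "f' \<cdot>\<^bsub>L\<^esub> w = fv"
      using pullback_lift[OF LP, of fu x fv] uv' f by (auto simp: hom_iff)
    have Fw: "Fa F w \<cdot> \<zeta> \<in> hom C (Src C \<zeta>) (Fo F a')" using w u' by (auto simp: hom_iff)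
    have "\<rho>' \<cdot> ku = Fa F (Pr L a') \<cdot> (Fa F w \<cdot> \<zeta>)"
      unfolding u'(6) w(2)[symmetric] using w(1) a u'(3,4) by (simp add: F_Cmp hom_iff C.Cmp_assoc)
    \<comment> \<open>The given arrow \<open>ku\<close> and the image of \<open>w\<close> after
      \<open>\<zeta>\<close> are the two legs of a map into the corner of \<open>?N\<close>.\<close>
    with C.corner_lift[OF rN(4), of ku "Src C \<zeta>" "Fa F w \<cdot> \<zeta>"] u'(5) Fw a
    obtain c where c: "c \<in> hom C (Src C \<zeta>) (corner C ?N)" "sLft (dsq C ?N) \<cdot> c = ku"
      "sTop (dsq C ?N) \<cdot> c = Fa F w \<cdot> \<zeta>" by auto
    \<comment> \<open>The cone condition for the square of gap maps, tested on the two projections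
      of the corner of \<open>?M\<close>.\<close>
    have "?m \<cdot> c = gap C ?M \<cdot> kv"
    proof (rule C.corner_eqI[OF rM(4)])
      show "?m \<cdot> c \<in> hom C (Src C \<zeta>) (corner C ?M)" using m(1) c(1) by (auto simp: hom_iff)
      show "gap C ?M \<cdot> kv \<in> hom C (Src C \<zeta>) (corner C ?M)" using gM(1) v'(3) by (auto simp: hom_iff)
      have "sLft (dsq C ?M) \<cdot> (?m \<cdot> c) = (k \<cdot> sLft (dsq C ?N)) \<cdot> c"
        using m(1) c(1) cM by (intro C.Cmp_reassoc m(2)) (auto simp: hom_iff)
      also have "\<dots> = k \<cdot> (sLft (dsq C ?N) \<cdot> c)"
        using k(2) cN c(1) by (intro C.Cmp_assoc) (auto simp: hom_iff)
      also have "\<dots> = r \<cdot> kv" by (simp add: c(2) uv'(2))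
      also have "\<dots> = sLft (dsq C ?M) \<cdot> (gap C ?M \<cdot> kv)"
        using gM(1) v'(3) cM by (intro C.Cmp_reassoc[symmetric] gM(2)) (auto simp: hom_iff)
      finally show "sLft (dsq C ?M) \<cdot> (?m \<cdot> c) = sLft (dsq C ?M) \<cdot> (gap C ?M \<cdot> kv)" .
      have "sTop (dsq C ?M) \<cdot> (?m \<cdot> c) = (Fa F f' \<cdot> sTop (dsq C ?N)) \<cdot> c"
        using m(1) c(1) cM by (intro C.Cmp_reassoc m(3)) (auto simp: hom_iff)
      also have "\<dots> = Fa F f' \<cdot> (sTop (dsq C ?N) \<cdot> c)"
        using f(1) cN c(1) a by (intro C.Cmp_assoc) (auto simp: hom_iff)
      also have "\<dots> = Fa F f' \<cdot> (Fa F w \<cdot> \<zeta>)" by (simp add: c(3))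
      also have "\<dots> = Fa F fv \<cdot> \<zeta>"
        unfolding w(3)[symmetric] using w(1) f(1) u'(3,4) by (simp add: F_Cmp hom_iff C.Cmp_assoc)
      also have "\<dots> = \<pi> \<cdot> kv" by (simp add: v'(4))
      also have "\<dots> = sTop (dsq C ?M) \<cdot> (gap C ?M \<cdot> kv)"
        using gM(1) v'(3) cM by (intro C.Cmp_reassoc[symmetric] gM(3)) (auto simp: hom_iff)
      finally show "sTop (dsq C ?M) \<cdot> (?m \<cdot> c) = sTop (dsq C ?M) \<cdot> (gap C ?M \<cdot> kv)" .
    qed
    moreover have "c \<in> hom C (Src C \<zeta>) (Src C ?m)" "kv \<in> hom C (Src C \<zeta>) (Src C (gap C ?M))"
      using c(1) m(1) v'(3) gM(1) by (auto simp: hom_iff)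
    ultimately obtain h where h: "h \<in> hom C (Src C \<zeta>) (Src C \<pi>')" "gap C ?N \<cdot> h = c" "k' \<cdot> h = kv"
      using pullback_lift[OF D', of c "Src C \<zeta>" kv] k(1) by (auto simp: hom_iff)
    have "\<pi>' \<cdot> h = sTop (dsq C ?N) \<cdot> c"
      unfolding h(2)[symmetric] using h(1) gN(1) cN by (intro C.Cmp_reassoc[symmetric] gN(3)) (auto simp: hom_iff)
    moreover have "l \<cdot> h = sLft (dsq C ?N) \<cdot> c"
      unfolding h(2)[symmetric] using h(1) gN(1) cN by (intro C.Cmp_reassoc[symmetric] gN(2)) (auto simp: hom_iff)
    ultimately show "\<exists>h. h \<in> hom KK z (Src KK (sTop S)) \<and> sLft S \<cdot>\<^bsub>KK\<^esub> h = u \<and> sTop S \<cdot>\<^bsub>KK\<^esub> h = v"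
      using h w c u' v' \<pi> by (intro exI[of _ "((x, \<zeta>), (a', \<pi>'), w, h)"]) (simp add: Se z hom_iff)
  next
    fix z h1 h2 assume h: "h1 \<in> hom KK z (Src KK (sTop S))" "h2 \<in> hom KK z (Src KK (sTop S))"
      and eq: "sLft S \<cdot>\<^bsub>KK\<^esub> h1 = sLft S \<cdot>\<^bsub>KK\<^esub> h2" "sTop S \<cdot>\<^bsub>KK\<^esub> h1 = sTop S \<cdot>\<^bsub>KK\<^esub> h2"
    obtain x \<zeta> where z: "z = (x, \<zeta>)" by (metis prod.collapse)
    have "h1 \<in> hom KK (x, \<zeta>) (a', \<pi>')" "h2 \<in> hom KK (x, \<zeta>) (a', \<pi>')" using h by (simp_all add: Se z)
    from KK_homE[OF this(1)] KK_homE[OF this(2)] obtain w1 k1 w2 k2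
      where h1: "h1 = ((x, \<zeta>), (a', \<pi>'), w1, k1)" "w1 \<in> hom L x a'" "k1 \<in> hom C (Src C \<zeta>) (Src C \<pi>')"
        "\<pi>' \<cdot> k1 = Fa F w1 \<cdot> \<zeta>"
      and h2: "h2 = ((x, \<zeta>), (a', \<pi>'), w2, k2)" "w2 \<in> hom L x a'" "k2 \<in> hom C (Src C \<zeta>) (Src C \<pi>')"
        "\<pi>' \<cdot> k2 = Fa F w2 \<cdot> \<zeta>" by metis
    have w: "w1 = w2"
      using L.pullback_unique[OF LP, of w1 x w2] eq h1 h2 f a by (simp add: Se hom_iff)
    have "gap C ?N \<cdot> k1 = gap C ?N \<cdot> k2"
    proof (rule C.corner_eqI[OF rN(4)])
      show "gap C ?N \<cdot> k1 \<in> hom C (Src C \<zeta>) (corner C ?N)" "gap C ?N \<cdot> k2 \<in> hom C (Src C \<zeta>) (corner C ?N)"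
        using gN(1) h1(3) h2(3) by (auto simp: hom_iff)
      have t: "sTop (dsq C ?N) \<cdot> (gap C ?N \<cdot> ki) = \<pi>' \<cdot> ki"
        and l: "sLft (dsq C ?N) \<cdot> (gap C ?N \<cdot> ki) = l \<cdot> ki" if "ki \<in> hom C (Src C \<zeta>) (Src C \<pi>')" for ki
        using that gN(1) cN by (intro C.Cmp_reassoc gN(2,3); auto simp: hom_iff)+
      show "sLft (dsq C ?N) \<cdot> (gap C ?N \<cdot> k1) = sLft (dsq C ?N) \<cdot> (gap C ?N \<cdot> k2)"
        using l[OF h1(3)] l[OF h2(3)] eq(1) by (simp add: Se h1(1) h2(1))
      show "sTop (dsq C ?N) \<cdot> (gap C ?N \<cdot> k1) = sTop (dsq C ?N) \<cdot> (gap C ?N \<cdot> k2)"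
        using t[OF h1(3)] t[OF h2(3)] h1(4) h2(4) w by simp
    qed
    then have "k1 = k2"
      using C.pullback_unique[OF D', of k1 "Src C \<zeta>" k2] eq(2) h1 h2 k(1) by (simp add: Se hom_iff)
    then show "h1 = h2" using h1(1) h2(1) w by simp
  qed
qed

end

section \<open>Comma squares: identities, composition and unique lifts\<close>

context display_functor
begin

lemma base_Cmp [simp]: "base_arr (Cmp KK g f) = base_arr g \<cdot>\<^bsub>L\<^esub> base_arr f"
  and fibre_Cmp [simp]: "fibre_arr (Cmp KK g f) = fibre_arr g \<cdot> fibre_arr f"
  by (cases f; cases g; simp)+

lemma KK_arr: "h \<in> Ar KK \<Longrightarrow> base_arr h \<in> hom L (fst (Src KK h)) (fst (Tgt KK h))"
  "h \<in> Ar KK \<Longrightarrow> fibre_arr h \<in> hom C (Src C (snd (Src KK h))) (Src C (snd (Tgt KK h)))"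
  by (cases h; auto)+

text \<open>The right side of the square of gap maps is a projection, so
  \<open>distinguished\<close> improves to \<open>QQ\<close>, where the contextual axioms
  apply.\<close>

lemma KQ_D:
  assumes S: "S \<in> KQ"
  shows "comm_square KK S" "sLft S \<in> KE" "sRgt S \<in> KE" "map_square base_arr S \<in> QQ L"
    "\<lparr>sTop = fibre_arr (sTop S),
      sBot = corner_map C (comma_square F (sLft S)) (comma_square F (sRgt S))
               (fibre_arr (sBot S)) (Fa F (base_arr (sTop S))),
      sLft = gap C (comma_square F (sLft S)),
      sRgt = gap C (comma_square F (sRgt S))\<rparr> \<in> QQ C"
    "cospan_map C (comma_square F (sLft S)) (comma_square F (sRgt S))
       (fibre_arr (sBot S)) (Fa F (base_arr (sTop S))) (Fa F (base_arr (sBot S)))"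
proof -
  show c: "comm_square KK S" "sLft S \<in> KE" "sRgt S \<in> KE" and "map_square base_arr S \<in> QQ L"
    using S by (simp_all add: comma_squares_def)
  have "rel_display1 C (comma_square F (sRgt S))" using c(3) by (simp add: comma_sorts_def)
  note r = C.rel_display1D[OF this]
  have "\<lparr>sTop = fibre_arr (sTop S),
      sBot = corner_map C (comma_square F (sLft S)) (comma_square F (sRgt S))
               (fibre_arr (sBot S)) (Fa F (base_arr (sTop S))),
      sLft = gap C (comma_square F (sLft S)),
      sRgt = gap C (comma_square F (sRgt S))\<rparr> \<in> distinguished C"
    using S by (simp add: comma_squares_def)
  then show "\<lparr>sTop = fibre_arr (sTop S),
      sBot = corner_map C (comma_square F (sLft S)) (comma_square F (sRgt S))
               (fibre_arr (sBot S)) (Fa F (base_arr (sTop S))),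
      sLft = gap C (comma_square F (sLft S)),
      sRgt = gap C (comma_square F (sRgt S))\<rparr> \<in> QQ C"
    by (rule C.distinguished_QQ[OF _ _ r(5,6)]) (simp add: r(7))
  show "cospan_map C (comma_square F (sLft S)) (comma_square F (sRgt S))
       (fibre_arr (sBot S)) (Fa F (base_arr (sTop S))) (Fa F (base_arr (sBot S)))"
  proof (rule KQ_cases[OF c], goal_cases)
    case 1
    show ?case using 1(22) unfolding 1(1) by simp
  qed
qed

lemma KQ_Idn:
  assumes "e \<in> KE"
  shows "\<lparr>sTop = Idn KK (Src KK e), sBot = Idn KK (Tgt KK e), sLft = e, sRgt = e\<rparr> \<in> KQ"
proof -
  interpret K: category KK by (rule category_KK)
  from KE_cases[OF assms] obtain a \<pi> \<rho> k where e: "e = ((a, \<pi>), (Ft L a, \<rho>), Pr L a, k)" "a \<in> Ob L" "1 \<le> Len L a"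
    "\<pi> \<in> Ar C" "Tgt C \<pi> = Fo F a" "\<rho> \<in> Ar C" "Tgt C \<rho> = Fo F (Ft L a)" "k \<in> hom C (Src C \<pi>) (Src C \<rho>)"
    and r: "rel_display1 C (comma_square F e)" .
  note r' = C.rel_display1D[OF r]
  let ?M = "comma_square F e"
  have "corner_map C ?M ?M (Idn C (Src C \<rho>)) (Idn C (Fo F a)) = Idn C (corner C ?M)"
    using C.corner_map_Idn[OF r'(4)] e by simp
  then have "\<lparr>sTop = Idn C (Src C \<pi>), sBot = corner_map C ?M ?M (Idn C (Src C \<rho>)) (Idn C (Fo F a)),
      sLft = gap C ?M, sRgt = gap C ?M\<rparr> \<in> QQ C"
    using C.Q_id[OF r'(5,6)] r'(7,8) e(1) by simp
  then have "\<lparr>sTop = Idn C (Src C \<pi>), sBot = corner_map C ?M ?M (Idn C (Src C \<rho>)) (Idn C (Fo F a)),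
      sLft = gap C ?M, sRgt = gap C ?M\<rparr> \<in> distinguished C"
    by (rule C.QQ_distinguished)
  moreover have "e \<in> Ar KK" using assms by (simp add: comma_sorts_def)
  moreover from this have "comm_square KK \<lparr>sTop = Idn KK (Src KK e), sBot = Idn KK (Tgt KK e), sLft = e, sRgt = e\<rparr>"
    by (simp add: comm_square_def)
  ultimately show ?thesis
    using assms L.Q_id[OF e(2,3)] e unfolding comma_squares_def by (simp add: map_square_def)
qed

text \<open>Squares of gap maps compose horizontally in \<open>C\<close>, and functoriality of
  \<open>corner_map\<close> identifies the composite of their bottoms with the bottom that the
  pasted square must have.\<close>

lemma KQ_Cmp:
  assumes S: "S \<in> KQ" and T: "T \<in> KQ" and ST: "sRgt S = sLft T"
  shows "\<lparr>sTop = sTop T \<cdot>\<^bsub>KK\<^esub> sTop S, sBot = sBot T \<cdot>\<^bsub>KK\<^esub> sBot S, sLft = sLft S, sRgt = sRgt T\<rparr> \<in> KQ"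
proof -
  interpret K: category KK by (rule category_KK)
  note s = KQ_D[OF S] and t = KQ_D[OF T]
  note cs = comm_squareD[OF s(1)] and ct = comm_squareD[OF t(1)]
  have "\<lparr>sTop = fibre_arr (sTop T) \<cdot> fibre_arr (sTop S),
      sBot = corner_map C (comma_square F (sLft T)) (comma_square F (sRgt T)) (fibre_arr (sBot T)) (Fa F (base_arr (sTop T)))
        \<cdot> corner_map C (comma_square F (sLft S)) (comma_square F (sRgt S)) (fibre_arr (sBot S)) (Fa F (base_arr (sTop S))),
      sLft = gap C (comma_square F (sLft S)),
      sRgt = gap C (comma_square F (sRgt T))\<rparr> \<in> QQ C"
    using C.Q_horizontal[OF s(5) t(5)] ST by simp
  moreover have "corner_map C (comma_square F (sLft T)) (comma_square F (sRgt T)) (fibre_arr (sBot T)) (Fa F (base_arr (sTop T)))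
        \<cdot> corner_map C (comma_square F (sLft S)) (comma_square F (sRgt S)) (fibre_arr (sBot S)) (Fa F (base_arr (sTop S)))
      = corner_map C (comma_square F (sLft S)) (comma_square F (sRgt T)) (fibre_arr (sBot T) \<cdot> fibre_arr (sBot S))
         (Fa F (base_arr (sTop T)) \<cdot> Fa F (base_arr (sTop S)))"
    using C.corner_map_Cmp[OF s(6)[unfolded ST] t(6)] ST by simp
  moreover have "Fa F (base_arr (sTop T)) \<cdot> Fa F (base_arr (sTop S)) = Fa F (base_arr (sTop T) \<cdot>\<^bsub>L\<^esub> base_arr (sTop S))"
    using KK_arr(1)[OF cs(1)] KK_arr(1)[OF ct(1)] cs(6) ct(5) ST
    by (intro F_Cmp[symmetric]) (auto simp: hom_iff)
  ultimately have "\<lparr>sTop = fibre_arr (sTop T) \<cdot> fibre_arr (sTop S),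
      sBot = corner_map C (comma_square F (sLft S)) (comma_square F (sRgt T)) (fibre_arr (sBot T) \<cdot> fibre_arr (sBot S))
         (Fa F (base_arr (sTop T) \<cdot>\<^bsub>L\<^esub> base_arr (sTop S))),
      sLft = gap C (comma_square F (sLft S)),
      sRgt = gap C (comma_square F (sRgt T))\<rparr> \<in> distinguished C"
    using C.QQ_distinguished by simp
  moreover have "map_square base_arr \<lparr>sTop = sTop T \<cdot>\<^bsub>KK\<^esub> sTop S, sBot = sBot T \<cdot>\<^bsub>KK\<^esub> sBot S, sLft = sLft S, sRgt = sRgt T\<rparr> \<in> QQ L"
    using L.Q_horizontal[OF s(4) t(4)] ST by (simp add: map_square_def)
  ultimately show ?thesis
    using K.comm_square_horizontal[OF s(1) t(1) ST] s(2) t(3) unfolding comma_squares_def by simp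
qed

text \<open>The base is lifted in \<open>L\<close>. The fibre over the new vertex is found by
  lifting the gap map of \<open>e\<close>, which is a projection, along the map between corners; its
  structure arrows are the lifted projection followed by the legs of the corner. Each choice is
  forced by a unique lift, hence uniqueness.\<close>

lemma KQ_lift:
  assumes e: "e \<in> KE" and h: "h \<in> Ar KK" and eh: "Tgt KK h = Tgt KK e"
  shows "\<exists>!S. S \<in> KQ \<and> sRgt S = e \<and> sBot S = h"
proof -
  interpret K: category KK by (rule category_KK)
  from KE_cases[OF e] obtain a \<pi> \<rho> r where er: "e = ((a, \<pi>), (Ft L a, \<rho>), Pr L a, r)" and a: "a \<in> Ob L" "1 \<le> Len L a"
    and \<pi>: "\<pi> \<in> Ar C" "Tgt C \<pi> = Fo F a" and \<rho>: "\<rho> \<in> Ar C" "Tgt C \<rho> = Fo F (Ft L a)" and r: "r \<in> hom C (Src C \<pi>) (Src C \<rho>)"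
    "\<rho> \<cdot> r = Fa F (Pr L a) \<cdot> \<pi>"
    and rd: "rel_display1 C (comma_square F e)" .
  let ?M = "comma_square F e"
  have M: "?M = \<lparr>sTop = \<pi>, sBot = \<rho>, sLft = r, sRgt = Fa F (Pr L a)\<rparr>" by (simp add: er)
  note d = C.rel_display1D[OF rd]
  obtain b \<sigma> where sh: "Src KK h = (b, \<sigma>)" by (metis prod.collapse)
  then have "h \<in> hom KK (b, \<sigma>) (Ft L a, \<rho>)" using h eh er by (simp add: hom_iff[of _ KK])
  from KK_homE[OF this] obtain f k where hk: "h = ((b, \<sigma>), (Ft L a, \<rho>), f, k)" and f: "f \<in> hom L b (Ft L a)"
     and \<sigma>: "\<sigma> \<in> Ar C" "Tgt C \<sigma> = Fo F b" and k: "k \<in> hom C (Src C \<sigma>) (Src C \<rho>)" "\<rho> \<cdot> k = Fa F f \<cdot> \<sigma>" .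
  obtain R where R: "R \<in> QQ L" "sRgt R = Pr L a" "sBot R = f"
    and unR: "\<And>R'. R' \<in> QQ L \<Longrightarrow> sRgt R' = Pr L a \<Longrightarrow> sBot R' = f \<Longrightarrow> R' = R"
  proof -
    have "f \<in> Ar L" "Tgt L f = Ft L a" using f by (simp_all add: hom_iff)
    from L.Q_lift[OF a this] that show thesis by blast
  qed
  obtain a' where a': "a' \<in> Ob L" "1 \<le> Len L a'" "sLft R = Pr L a'" "sTop R \<in> hom L a' a" "b = Ft L a'"
  proof -
    obtain a' c where ac: "a' \<in> Ob L" "1 \<le> Len L a'" "sLft R = Pr L a'" "c \<in> Ob L" "1 \<le> Len L c"
      "sRgt R = Pr L c" "sTop R \<in> hom L a' c" "sBot R \<in> hom L (Ft L a') (Ft L c)"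
      using L.QQ_cases[OF R(1)] .
    have "Pr L c = Pr L a" using ac(6) R(2) by simp
    then have c: "c = a" by (rule L.Pr_inj[OF ac(4,5) a])
    have "b = Ft L a'" using ac(8) f unfolding R(3) by (simp add: hom_iff)
    with ac(1-3) ac(7)[unfolded c] show thesis by (rule that)
  qed
  \<comment> \<open>Only the bottom and the right side of \<open>?B\<close> count. Top and left side
    are placeholders, since the real ones, \<open>\<pi>'\<close> and \<open>l\<close>, are defined
    from the corner of \<open>?B\<close>.\<close>
  let ?B = "\<lparr>sTop = \<sigma>, sBot = \<sigma>, sLft = \<sigma>, sRgt = Fa F (Pr L a')\<rparr>"
  have cN: "cospan C ?B"
    using \<sigma> a' by (simp add: cospan_def F_displays[OF L.Pr_displays])
  note cf = C.corner_facts[OF cN, simplified]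
  have Fsq: "Fa F (Pr L a) \<cdot> Fa F (sTop R) = Fa F f \<cdot> Fa F (Pr L a')"
    using comm_squareD(9)[OF L.Q_comm[OF R(1)]] F_Cmp[of "sTop R" "Pr L a"] F_Cmp[of "Pr L a'" f] R a a' f
    by (simp add: hom_iff)
  have cm: "cospan_map C ?B ?M k (Fa F (sTop R)) (Fa F f)"
    using cN d(4) k \<sigma> \<rho> a a' f Fsq unfolding cospan_map_def M by (simp add: hom_iff)
  note m = C.corner_map[OF cm]
  let ?m = "corner_map C ?B ?M k (Fa F (sTop R))"
  let ?g = "Src C \<pi>"
  have sM: "Src C (sTop ?M) = ?g" by (simp add: M)
  note g = d(5-8)[unfolded sM]
  have "?m \<in> Ar C" "Tgt C ?m = Ft C ?g" using m(1) g(4) by (simp_all add: hom_iff)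
  from C.Q_lift[OF g(1,2) this] obtain V where V: "V \<in> QQ C" "sRgt V = Pr C ?g" "sBot V = ?m"
    and unV: "\<And>V'. V' \<in> QQ C \<Longrightarrow> sRgt V' = Pr C ?g \<Longrightarrow> sBot V' = ?m \<Longrightarrow> V' = V" by blast
  obtain g' where g': "g' \<in> Ob C" "1 \<le> Len C g'" "sLft V = Pr C g'" "sTop V \<in> hom C g' ?g" "Ft C g' = corner C ?B"
  proof -
    obtain g' c where ac: "g' \<in> Ob C" "1 \<le> Len C g'" "sLft V = Pr C g'" "c \<in> Ob C" "1 \<le> Len C c"
      "sRgt V = Pr C c" "sTop V \<in> hom C g' c" "sBot V \<in> hom C (Ft C g') (Ft C c)"
      using C.QQ_cases[OF V(1)] .
    have "Pr C c = Pr C ?g" using ac(6) V(2) by simp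
    then have c: "c = ?g" by (rule C.Pr_inj[OF ac(4,5) g(1,2)])
    have "Ft C g' = corner C ?B" using ac(8) m(1) unfolding V(3) by (simp add: hom_iff)
    with ac(1-3) ac(7)[unfolded c] show thesis by (rule that)
  qed
  define \<pi>' where "\<pi>' = sTop (dsq C ?B) \<cdot> Pr C g'"
  define l where "l = sLft (dsq C ?B) \<cdot> Pr C g'"
  have pg: "Pr C g' \<in> hom C g' (corner C ?B)" using C.pr_hom[OF g'(1,2)] g'(5) by simp
  have \<pi>': "\<pi>' \<in> hom C g' (Fo F a')" and l: "l \<in> hom C g' (Src C \<sigma>)"
    unfolding \<pi>'_def l_def using pg cf(1,2) a' by (auto intro: C.cmp_hom)
  have l\<sigma>: "Fa F (Pr L a') \<cdot> \<pi>' = \<sigma> \<cdot> l"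
  proof -
    have "Fa F (Pr L a') \<cdot> \<pi>' = (\<sigma> \<cdot> sLft (dsq C ?B)) \<cdot> Pr C g'"
      unfolding \<pi>'_def using a' cf(1) pg by (intro C.Cmp_reassoc cf(4)) (auto simp: hom_iff)
    also have "\<dots> = \<sigma> \<cdot> l"
      unfolding l_def using \<sigma> cf(2) pg by (intro C.Cmp_assoc) (auto simp: hom_iff)
    finally show ?thesis .
  qed
  \<comment> \<open>The true left naturality square. It shares its corner with \<open>?B\<close>,
    and its gap map is \<open>Pr C g'\<close> by the choice of \<open>\<pi>'\<close> and
    \<open>l\<close>.\<close>
  let ?N = "\<lparr>sTop = \<pi>', sBot = \<sigma>, sLft = l, sRgt = Fa F (Pr L a')\<rparr>"
  have dN: "dsq C ?N = dsq C ?B" and coN: "corner C ?N = corner C ?B"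
    by (rule dsq_cong corner_cong; simp)+
  have cN': "cospan C ?N" using cN by (simp add: cospan_def)
  have gapN: "gap C ?N = Pr C g'"
  proof (rule C.gap_eqI[OF cN'])
    show "Pr C g' \<in> hom C (Src C (sTop ?N)) (corner C ?N)"
      by (subst coN) (use pg \<pi>' in \<open>simp add: hom_iff\<close>)
    show "sLft (dsq C ?N) \<cdot> Pr C g' = sLft ?N" by (subst dN) (simp add: l_def)
    show "sTop (dsq C ?N) \<cdot> Pr C g' = sTop ?N" by (subst dN) (simp add: \<pi>'_def)
  qed
  have commN: "comm_square C ?N"
    using \<pi>' l \<sigma> a' l\<sigma> by (simp add: comm_square_def hom_iff)
  have "l \<in> displays C"
    unfolding l_def using cf(2,3) g' pg by (intro C.displays_comp C.Pr_displays) (auto simp: hom_iff)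
  then have rdN: "rel_display1 C ?N"
    using commN gapN g' a' by (intro C.rel_display1I) (simp_all add: F_displays[OF L.Pr_displays])
  have mN: "corner_map C ?N ?M k (Fa F (sTop R)) = ?m" by (rule corner_map_cong) simp_all
  let ?e' = "((a', \<pi>'), (b, \<sigma>), Pr L a', l)"
  let ?t = "((a', \<pi>'), (a, \<pi>), sTop R, sTop V)"
  let ?S = "\<lparr>sTop = ?t, sBot = h, sLft = ?e', sRgt = e\<rparr>"
  have e'A: "?e' \<in> Ar KK" using \<pi>' \<sigma> a' l l\<sigma> by (simp add: hom_iff)
  then have e'E: "?e' \<in> KE" using rdN a' unfolding comma_sorts_def by auto
  have gV: "Pr C ?g \<cdot> sTop V = ?m \<cdot> Pr C g'"
    using comm_squareD(9)[OF C.Q_comm[OF V(1)]] V g' by simp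
  note gM = C.gap[OF d(1,2), unfolded d(7) sM]
  have tV: "\<pi> \<cdot> sTop V = Fa F (sTop R) \<cdot> \<pi>'" and lV: "r \<cdot> sTop V = k \<cdot> l"
  proof -
    note cM = C.corner_facts[OF d(4)]
    have "\<pi> \<cdot> sTop V = sTop (dsq C ?M) \<cdot> (Pr C ?g \<cdot> sTop V)"
      using gM(1,3) cM(1) g'(4) by (intro C.Cmp_reassoc[symmetric]) (auto simp: hom_iff M)
    also have "\<dots> = (Fa F (sTop R) \<cdot> sTop (dsq C ?B)) \<cdot> Pr C g'"
      unfolding gV using m(1) cM(1) pg by (intro C.Cmp_reassoc m(3)) (auto simp: hom_iff)
    also have "\<dots> = Fa F (sTop R) \<cdot> \<pi>'"
      unfolding \<pi>'_def using a'(1,2,4) cf(1) pg by (intro C.Cmp_assoc) (auto simp: hom_iff)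
    finally show "\<pi> \<cdot> sTop V = Fa F (sTop R) \<cdot> \<pi>'" .
    have "r \<cdot> sTop V = sLft (dsq C ?M) \<cdot> (Pr C ?g \<cdot> sTop V)"
      using gM(1,2) cM(2) g'(4) by (intro C.Cmp_reassoc[symmetric]) (auto simp: hom_iff M)
    also have "\<dots> = (k \<cdot> sLft (dsq C ?B)) \<cdot> Pr C g'"
      unfolding gV using m(1) cM(2) pg by (intro C.Cmp_reassoc m(2)) (auto simp: hom_iff)
    also have "\<dots> = k \<cdot> l"
      unfolding l_def using k(1) cf(2) pg by (intro C.Cmp_assoc) (auto simp: hom_iff)
    finally show "r \<cdot> sTop V = k \<cdot> l" .
  qed
  have tA: "?t \<in> Ar KK" using \<pi>' \<pi> a'(4) g'(4) tV by (simp add: hom_iff)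
  have RL: "Pr L a \<cdot>\<^bsub>L\<^esub> sTop R = f \<cdot>\<^bsub>L\<^esub> Pr L a'"
    using comm_squareD(9)[OF L.Q_comm[OF R(1)]] R a' by simp
  have eA: "e \<in> Ar KK" using e by (simp add: comma_sorts_def)
  have "comm_square KK ?S"
    unfolding comm_square_def using tA e'A h eA RL lV by (simp add: hk er)
  moreover have "map_square base_arr ?S \<in> QQ L"
    using R a'(3) by (cases R) (simp add: map_square_def hk er)
  moreover have "\<lparr>sTop = sTop V, sBot = corner_map C ?N ?M k (Fa F (sTop R)), sLft = gap C ?N, sRgt = gap C ?M\<rparr> = V"
    unfolding mN gapN g(3) by (rule square_eqI) (simp_all add: V g')
  then have "\<lparr>sTop = sTop V, sBot = corner_map C ?N ?M k (Fa F (sTop R)), sLft = gap C ?N, sRgt = gap C ?M\<rparr> \<in> distinguished C"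
    using C.QQ_distinguished[OF V(1)] by simp
  ultimately have SQ: "?S \<in> KQ"
    using e e'E unfolding comma_squares_def by (simp add: hk)
  show ?thesis
  proof (rule ex1I)
    show "?S \<in> KQ \<and> sRgt ?S = e \<and> sBot ?S = h" using SQ by simp
    fix T assume T: "T \<in> KQ \<and> sRgt T = e \<and> sBot T = h"
    then have TQ: "T \<in> KQ" by simp
    note t = KQ_D[OF TQ]
    note ct = comm_squareD[OF t(1)]
    from KE_cases[OF t(2)] obtain a'' \<pi>'' \<rho>'' l'' where T': "sLft T = ((a'', \<pi>''), (Ft L a'', \<rho>''), Pr L a'', l'')"
      and a'': "a'' \<in> Ob L" "1 \<le> Len L a''" and \<pi>'': "\<pi>'' \<in> Ar C" "Tgt C \<pi>'' = Fo F a''"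
      and rd'': "rel_display1 C (comma_square F (sLft T))" .
    have "Tgt KK (sLft T) = (b, \<sigma>)" using ct(7) T sh by simp
    then have b'': "Ft L a'' = b" "\<rho>'' = \<sigma>" using T' by simp_all
    have "map_square base_arr T = R" by (rule unR) (use t(4) T in \<open>simp_all add: er hk\<close>)
    then have bt: "base_arr (sTop T) = sTop R" "Pr L a'' = sLft R"
      using T' by (auto simp: map_square_def)
    have "Pr L a'' = Pr L a'" using bt(2) a'(3) by simp
    then have aa: "a'' = a'" by (rule L.Pr_inj[OF a'' a'(1,2)])
    let ?N' = "comma_square F (sLft T)"
    have N': "?N' = \<lparr>sTop = \<pi>'', sBot = \<sigma>, sLft = l'', sRgt = Fa F (Pr L a')\<rparr>" using T' b'' aa by simp
    have dN': "dsq C ?N' = dsq C ?B" by (rule dsq_cong) (simp_all add: N')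
    have mN': "corner_map C ?N' ?M k (Fa F (sTop R)) = ?m" by (rule corner_map_cong) (simp_all add: N')
    have "\<lparr>sTop = fibre_arr (sTop T), sBot = corner_map C ?N' ?M k (Fa F (sTop R)),
        sLft = gap C ?N', sRgt = gap C ?M\<rparr> = V"
      using t(5) T mN' g(3) bt(1) by (intro unV) (simp_all add: hk)
    then have Vt: "fibre_arr (sTop T) = sTop V" "gap C ?N' = Pr C g'" using g'(3) by auto
    note dd = C.rel_display1D[OF rd'']
    \<comment> \<open>Top and left side of a square are its gap map followed by the legs of the
      corner, and the gap map is already known to be \<open>Pr C g'\<close>.\<close>
    have "\<pi>'' = \<pi>'" "l'' = l"
      using C.gap(2,3)[OF dd(1,2)] Vt(2) unfolding dN' \<pi>'_def l_def by (simp_all add: N')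
    then have "sLft T = ?e'" using T' aa b'' by simp
    moreover have "sTop T = ?t"
    proof -
      have "Src KK (sTop T) = (a', \<pi>')" "Tgt KK (sTop T) = (a, \<pi>)"
        using ct(5,6) \<open>sLft T = ?e'\<close> T by (simp_all add: er)
      then show ?thesis using Vt(1) bt(1) by (cases "sTop T") simp
    qed
    ultimately show "T = ?S" using T by (cases T) simp
  qed
qed

sublocale K: sort_category KK "(one L, Idn C (one C))" KE KQ
proof (rule sort_category.intro[OF category_KK], unfold_locales)
  show "terminal KK (one L, Idn C (one C))" by (rule terminal_KK)
  show "e \<in> Ar KK" if "e \<in> KE" for e using that by (simp add: comma_sorts_def)
  show "pullback KK S" if "S \<in> KQ" for S by (rule KQ_pullback[OF that])
  show "sLft S \<in> KE" if "S \<in> KQ" for S by (rule KQ_D(2)[OF that])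
qed (rule KQ_Idn KQ_Cmp KQ_lift; assumption)+

definition base_functor :: "('o \<times> 'n, ('o \<times> 'n) \<times> ('o \<times> 'n) \<times> 'm \<times> 'n, 'o, 'm) fctr" where
  "base_functor = \<lparr>Fo = restrict fst (Ob KK), Fa = restrict base_arr (Ar KK)\<rparr>"

lemma base_functor: "base_functor \<in> functors KK L"
proof (rule functorsI)
  fix x assume "x \<in> Ob KK"
  then show "Fo base_functor x \<in> Ob L" "Fa base_functor (Idn KK x) = Idn L (Fo base_functor x)"
    using K.Ar_Idn[of x] by (cases x; simp add: base_functor_def hom_iff)+
next
  fix f assume "f \<in> Ar KK"
  then show "Fa base_functor f \<in> hom L (Fo base_functor (Src KK f)) (Fo base_functor (Tgt KK f))"
    using KK_arr(1)[of f] by (simp add: base_functor_def)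
qed (simp_all add: base_functor_def)

end

lemma functor_comm_square:
  assumes "F \<in> functors A B" "comm_square A S"
  shows "comm_square B (map_square (Fa F) S)"
proof -
  note c = comm_squareD[OF assms(2)]
  have "Fa F (sRgt S \<cdot>\<^bsub>A\<^esub> sTop S) = Fa F (sBot S \<cdot>\<^bsub>A\<^esub> sLft S)" by (simp add: c(9))
  then show ?thesis
    using c(1-8) fctr_Ar[OF assms(1)] fctr_Cmp[OF assms(1) c(1,4)] fctr_Cmp[OF assms(1) c(3,2)]
    by (simp add: comm_square_def)
qed

section \<open>Indexed sorts and models in the comma category\<close>

context display_functor
begin

definition sort_model ::
  "('a, 'b, 'z) ctx_scheme \<Rightarrow> ('a, 'b, 'o, 'm) fctr \<Rightarrow> ('a, 'b, 'p, 'n) ntrans \<Rightarrow>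
   ('a, 'b, 'o \<times> 'n, ('o \<times> 'n) \<times> ('o \<times> 'n) \<times> 'm \<times> 'n) fctr" where
  "sort_model B U \<pi> =
     \<lparr>Fo = (\<lambda>b \<in> Ob B. (Fo U b, NCmp \<pi> b)),
      Fa = (\<lambda>f \<in> Ar B. ((Fo U (Src B f), NCmp \<pi> (Src B f)), (Fo U (Tgt B f), NCmp \<pi> (Tgt B f)),
                       Fa U f, Fa (NDom \<pi>) f))\<rparr>"

lemma sort_model_simps [simp]:
  "b \<in> Ob B \<Longrightarrow> Fo (sort_model B U \<pi>) b = (Fo U b, NCmp \<pi> b)"
  "f \<in> Ar B \<Longrightarrow> Fa (sort_model B U \<pi>) f = ((Fo U (Src B f), NCmp \<pi> (Src B f)), (Fo U (Tgt B f), NCmp \<pi> (Tgt B f)),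
                       Fa U f, Fa (NDom \<pi>) f)"
  by (simp_all add: sort_model_def)

text \<open>The comma square of the image of \<open>f\<close> is the naturality square of
  \<open>\<pi>\<close> at \<open>f\<close>, so each clause of \<open>indexed_sort\<close> becomes a
  clause of \<open>models\<close>. The functor \<open>U\<close> is arbitrary in order to cover both
  \<open>\<iota>\<close> on \<open>A\<close> and the identity on \<open>L\<close>.\<close>

lemma sort_model:
  assumes "precontextual B" and U: "U \<in> ctx_functors B L" and \<pi>: "indexed_sort B C \<pi>"
    and cod: "NCod \<pi> = comp_fctr B F U"
  shows "sort_model B U \<pi> \<in> models B KK (one L, Idn C (one C)) KE KQ"
proof -
  interpret B: precontextual B by fact
  note u = ctx_functorsD[OF U]
  note p = indexed_sortD[OF \<pi>]
  note D = disp_ArD[OF p(1)]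
  let ?T = "sort_model B U \<pi>"
  have cmp: "NCmp \<pi> a \<in> hom C (Fo (NDom \<pi>) a) (Fo F (Fo U a))" if "a \<in> Ob B" for a
    using D(6)[OF that] that by (simp add: cod)
  have nat: "Fa F (Fa U f) \<cdot> NCmp \<pi> (Src B f) = NCmp \<pi> (Tgt B f) \<cdot> Fa (NDom \<pi>) f" if "f \<in> Ar B" for f
    using D(7)[OF that] that by (simp add: cod)
  have F: "?T \<in> functors B KK"
  proof (rule functorsI)
    fix a assume a: "a \<in> Ob B"
    show "Fo ?T a \<in> Ob KK" using cmp[OF a] fctr_Ob[OF u(1) a] a by (simp add: hom_iff)
    show "Fa ?T (Idn B a) = Idn KK (Fo ?T a)"
      using cmp[OF a] a by (simp add: fctr_Idn[OF u(1)] fctr_Idn[OF D(4)] hom_iff)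
  next
    fix f assume f: "f \<in> Ar B"
    show "Fa ?T f \<in> hom KK (Fo ?T (Src B f)) (Fo ?T (Tgt B f))"
      using cmp[OF B.src_Ob[OF f]] cmp[OF B.tgt_Ob[OF f]] fctr_Ar[OF u(1) f] fctr_Ar[OF D(4) f] nat[OF f] f
      by (simp add: hom_iff[of _ C] hom_iff[of _ L])
  next
    fix f g assume "f \<in> Ar B" "g \<in> Ar B" "Src B g = Tgt B f"
    then show "Fa ?T (Cmp B g f) = Cmp KK (Fa ?T g) (Fa ?T f)"
      by (simp add: fctr_Cmp[OF u(1)] fctr_Cmp[OF D(4)])
  qed (simp_all add: sort_model_def)
  have csq: "comma_square F (Fa ?T f) = natsq B \<pi> f" if "f \<in> Ar B" for f
    using that by (intro square_eqI) (simp_all add: cod)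
  have one: "Fo ?T a = (one L, Idn C (one C))" if a: "a \<in> Ob B" "Len B a = 0" for a
  proof -
    have "Fo U a = one L" using u(2) a fctr_Ob[OF u(1)] by (intro L.one_eqI) simp_all
    moreover from this have "NCmp \<pi> a = Idn C (one C)"
      using cmp[OF a(1)] D(1) a F_one unfolding disp_Ob by (intro C.to_one_eq) (auto simp: hom_iff)
    ultimately show ?thesis using a by simp
  qed
  have srt: "Fa ?T (Pr B a) \<in> KE" if a: "a \<in> Ob B" "1 \<le> Len B a" for a
  proof -
    have "Fa ?T (Pr B a) \<in> Ar KK" by (rule fctr_Ar(1)[OF F B.Ar_Pr[OF a]])
    moreover have "rel_display1 C (comma_square F (Fa ?T (Pr B a)))"
      unfolding csq[OF B.Ar_Pr[OF a]] by (rule p(2)[OF a])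
    moreover have "base_arr (Fa ?T (Pr B a)) = Pr L (Fo U a)" using u(4)[OF a] B.Ar_Pr[OF a] by simp
    moreover have "Fo U a \<in> Ob L" "1 \<le> Len L (Fo U a)" using u(2)[OF a(1)] a fctr_Ob[OF u(1)] by simp_all
    ultimately show ?thesis unfolding comma_sorts_def by blast
  qed
  have sq: "map_square (Fa ?T) S \<in> KQ" if S: "S \<in> QQ B" for S
  proof -
    note A = B.QQ_Ar[OF S]
    from B.QQ_cases[OF S] have "sLft (map_square (Fa ?T) S) \<in> KE" "sRgt (map_square (Fa ?T) S) \<in> KE"
      using srt by (metis map_square_simps)+
    moreover have "map_square base_arr (map_square (Fa ?T) S) = map_square (Fa U) S"
      using A by (intro square_eqI) simp_all
    moreover have "\<lparr>sTop = fibre_arr (sTop (map_square (Fa ?T) S)),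
      sBot = corner_map C (comma_square F (sLft (map_square (Fa ?T) S))) (comma_square F (sRgt (map_square (Fa ?T) S)))
               (fibre_arr (sBot (map_square (Fa ?T) S))) (Fa F (base_arr (sTop (map_square (Fa ?T) S)))),
      sLft = gap C (comma_square F (sLft (map_square (Fa ?T) S))),
      sRgt = gap C (comma_square F (sRgt (map_square (Fa ?T) S)))\<rparr> \<in> distinguished C"
      using p(3)[OF S] A by (simp add: cod natsq_def)
    ultimately show ?thesis
      using functor_comm_square[OF F B.Q_comm[OF S]] u(5)[OF S] unfolding comma_squares_def by simp
  qed
  show ?thesis unfolding models_def using F one srt sq by blast
qed

lemma base_sort_model:
  assumes "precontextual B" "U \<in> ctx_functors B L" "indexed_sort B C \<pi>" "NCod \<pi> = comp_fctr B F U"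
  shows "comp_fctr B base_functor (sort_model B U \<pi>) = U"
proof -
  interpret B: precontextual B by fact
  note T = modelsD(1)[OF sort_model[OF assms]]
  show ?thesis
  proof (rule fctr_eqI[OF B.comp_fctr_functors[OF T base_functor] ctx_functorsD(1)[OF assms(2)]])
    fix a assume a: "a \<in> Ob B"
    then show "Fo (comp_fctr B base_functor (sort_model B U \<pi>)) a = Fo U a"
      using fctr_Ob[OF T a] by (simp add: base_functor_def)
  next
    fix f assume f: "f \<in> Ar B"
    then show "Fa (comp_fctr B base_functor (sort_model B U \<pi>)) f = Fa U f"
      using fctr_Ar(1)[OF T f] by (simp add: base_functor_def)
  qed
qed

definition model_dom :: "('o, 'm, 'o \<times> 'n, ('o \<times> 'n) \<times> ('o \<times> 'n) \<times> 'm \<times> 'n) fctr \<Rightarrow> ('o, 'm, 'p, 'n) fctr" where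
  "model_dom T = \<lparr>Fo = (\<lambda>a \<in> Ob L. Src C (snd (Fo T a))), Fa = (\<lambda>f \<in> Ar L. fibre_arr (Fa T f))\<rparr>"

definition model_sort :: "('o, 'm, 'o \<times> 'n, ('o \<times> 'n) \<times> ('o \<times> 'n) \<times> 'm \<times> 'n) fctr \<Rightarrow> ('o, 'm, 'p, 'n) ntrans" where
  "model_sort T = \<lparr>NDom = model_dom T, NCod = F, NCmp = (\<lambda>a \<in> Ob L. snd (Fo T a))\<rparr>"

text \<open>Being a section forces \<open>T\<close> to be the identity on bases. What remains is a
  component at each object and a fibre arrow over each arrow, that is, a functor with a natural
  transformation to \<open>F\<close>.\<close>

lemma model_sort:
  assumes T: "T \<in> models L KK (one L, Idn C (one C)) KE KQ" and PT: "comp_fctr L base_functor T = id_fctr L"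
  shows "indexed_sort L C (model_sort T)"
proof -
  note t = modelsD[OF T]
  let ?G = "model_dom T" and ?\<tau> = "\<lambda>a. snd (Fo T a)" and ?\<gamma> = "\<lambda>f. fibre_arr (Fa T f)"
  have ob: "Fo T a = (a, ?\<tau> a) \<and> ?\<tau> a \<in> Ar C \<and> Tgt C (?\<tau> a) = Fo F a" if a: "a \<in> Ob L" for a
  proof -
    have "Fo (comp_fctr L base_functor T) a = a" unfolding PT using a by simp
    then have "fst (Fo T a) = a" using fctr_Ob[OF t(1) a] a by (simp add: base_functor_def)
    then show ?thesis using fctr_Ob[OF t(1) a] by (cases "Fo T a") simp
  qed
  have ar: "Fa T f = ((Src L f, ?\<tau> (Src L f)), (Tgt L f, ?\<tau> (Tgt L f)), f, ?\<gamma> f)"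
    and arC: "?\<gamma> f \<in> hom C (Src C (?\<tau> (Src L f))) (Src C (?\<tau> (Tgt L f)))"
    and nat: "?\<tau> (Tgt L f) \<cdot> ?\<gamma> f = Fa F f \<cdot> ?\<tau> (Src L f)" if f: "f \<in> Ar L" for f
  proof -
    have "Fa (comp_fctr L base_functor T) f = f" unfolding PT using f by simp
    then have b: "base_arr (Fa T f) = f" using fctr_Ar(1)[OF t(1) f] f by (simp add: base_functor_def)
    have "Src KK (Fa T f) = (Src L f, ?\<tau> (Src L f))" "Tgt KK (Fa T f) = (Tgt L f, ?\<tau> (Tgt L f))"
      using fctr_Ar(2,3)[OF t(1) f] ob[of "Src L f"] ob[of "Tgt L f"] f by simp_all
    then show e: "Fa T f = ((Src L f, ?\<tau> (Src L f)), (Tgt L f, ?\<tau> (Tgt L f)), f, ?\<gamma> f)"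
      using b by (cases "Fa T f") simp
    have "((Src L f, ?\<tau> (Src L f)), (Tgt L f, ?\<tau> (Tgt L f)), f, ?\<gamma> f) \<in> Ar KK"
      using fctr_Ar(1)[OF t(1) f] by (subst (asm) e)
    then show "?\<gamma> f \<in> hom C (Src C (?\<tau> (Src L f))) (Src C (?\<tau> (Tgt L f)))"
      "?\<tau> (Tgt L f) \<cdot> ?\<gamma> f = Fa F f \<cdot> ?\<tau> (Src L f)" by simp_all
  qed
  have csq: "comma_square F (Fa T f) = natsq L (model_sort T) f" if f: "f \<in> Ar L" for f
    by (subst ar[OF f]) (use f in \<open>simp add: model_sort_def natsq_def model_dom_def\<close>)
  have G: "?G \<in> functors L C"
  proof (rule functorsI)
    fix a assume a: "a \<in> Ob L"
    show "Fo ?G a \<in> Ob C" using ob[OF a] a by (simp add: model_dom_def)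
    have "Fa T (Idn L a) = Idn KK (a, ?\<tau> a)" using fctr_Idn[OF t(1) a] ob[OF a] by simp
    then show "Fa ?G (Idn L a) = Idn C (Fo ?G a)" using a by (simp add: model_dom_def)
  next
    fix f assume f: "f \<in> Ar L"
    show "Fa ?G f \<in> hom C (Fo ?G (Src L f)) (Fo ?G (Tgt L f))" using arC[OF f] f by (simp add: model_dom_def)
  next
    fix f g assume fg: "f \<in> Ar L" "g \<in> Ar L" "Src L g = Tgt L f"
    show "Fa ?G (Cmp L g f) = Cmp C (Fa ?G g) (Fa ?G f)"
      using fctr_Cmp[OF t(1) fg] fg by (simp add: model_dom_def)
  qed (simp_all add: model_dom_def)
  have rd: "rel_display1 C (natsq L (model_sort T) (Pr L a))" if a: "a \<in> Ob L" "1 \<le> Len L a" for a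
    using t(3)[OF a] csq[OF L.Ar_Pr[OF a]] by (simp add: comma_sorts_def)
  \<comment> \<open>On projections, preservation of display maps is the left-side clause of
    \<open>rel_display1\<close>; the other display maps follow by composition.\<close>
  have GD: "?G \<in> Ob (disp_fun_cat L C)"
    unfolding disp_Ob
  proof (intro conjI ballI impI G)
    fix f assume "f \<in> displays L"
    then show "Fa ?G f \<in> displays C"
    proof (rule preserves_displaysI[OF L.precontextual_axioms C.precontextual_axioms G, rotated])
      fix a assume a: "a \<in> Ob L" "1 \<le> Len L a"
      show "Fa ?G (Pr L a) \<in> displays C" using C.rel_display1D(3)[OF rd[OF a]] by (simp add: model_sort_def)
    qed
  next
    fix a assume "a \<in> Ob L" "Len L a = 0"
    then show "Fo ?G a = one C" using t(2)[of a] by (simp add: model_dom_def)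
  qed
  have cmp: "NCmp (model_sort T) a \<in> hom C (Fo ?G a) (Fo F a)" if "a \<in> Ob L" for a
    using ob[OF that] that by (simp add: model_sort_def model_dom_def hom_iff)
  have Ar: "model_sort T \<in> Ar (disp_fun_cat L C)"
    unfolding disp_Ar
  proof (intro conjI ballI)
    fix f assume f: "f \<in> Ar L"
    show "comm_square C (natsq L (model_sort T) f)"
      using cmp nat[OF f] f
      by (intro comm_natsqI[OF L.category_axioms G F_functor _ _ f]) (simp_all add: model_sort_def model_dom_def)
  qed (use GD F_disp cmp in \<open>simp_all add: model_sort_def\<close>)
  show ?thesis
    unfolding indexed_sort_def Let_def
  proof (intro conjI ballI impI Ar rd)
    fix S assume S: "S \<in> QQ L"
    note A = L.QQ_Ar[OF S]
    have b: "base_arr (Fa T (sTop S)) = sTop S" using ar[of "sTop S"] A by (metis base_arr.simps)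
    show "\<lparr>sTop = Fa (NDom (model_sort T)) (sTop S),
           sBot = corner_map C (natsq L (model_sort T) (sLft S)) (natsq L (model_sort T) (sRgt S))
             (Fa (NDom (model_sort T)) (sBot S)) (Fa (NCod (model_sort T)) (sTop S)),
           sLft = gap C (natsq L (model_sort T) (sLft S)), sRgt = gap C (natsq L (model_sort T) (sRgt S))\<rparr>
       \<in> distinguished C"
      using t(4)[OF S] csq[of "sLft S"] csq[of "sRgt S"] A b
      unfolding comma_squares_def by (simp add: model_sort_def model_dom_def)
  qed
qed

end

text \<open>Existence: the model of \<open>\<pi>\<close> extends to a section over \<open>L\<close>,
  which is read back as an indexed sort. Uniqueness: two extensions of \<open>\<pi>\<close> are
  models on \<open>L\<close> with the same restriction to \<open>A\<close>.\<close>

theorem indexed_sort_extension: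
  fixes A L C :: "('u, 'u) ctx"
  assumes inf: "infinite (UNIV :: 'u set)" and A: "precontextual A" and C: "contextual C"
    and R: "reflection A L \<iota>" and F: "F \<in> Ob (disp_fun_cat L C)"
    and \<pi>: "indexed_sort A C \<pi>" and cod: "NCod \<pi> = comp_fctr A F \<iota>"
  shows "\<exists>!\<pi>'. indexed_sort L C \<pi>' \<and> NCod \<pi>' = F \<and> whisker A \<pi>' \<iota> = \<pi>"
proof -
  interpret A: precontextual A by fact
  interpret C: contextual C by fact
  have Lc: "contextual L" and \<iota>: "\<iota> \<in> ctx_functors A L" using R by (simp_all add: reflection_def)
  interpret L: contextual L by fact
  interpret display_functor L C F by unfold_locales (rule F)
  note i = ctx_functorsD[OF \<iota>]
  have id: "\<exists>f :: 'u \<Rightarrow> 'u. inj f" using inj_on_id by blast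
  note pr = ex_inj_prod[OF inf]
  \<comment> \<open>Arrows of the comma category are tuples over \<open>'u\<close>; the extension of
    models asks that they embed in \<open>'u\<close>.\<close>
  have emb: "\<exists>f :: ('u \<times> 'u) \<times> ('u \<times> 'u) \<times> 'u \<times> 'u \<Rightarrow> 'u. inj f"
    by (rule pr[OF pr[OF id id] pr[OF pr[OF id id] pr[OF id id]]])
  let ?T = "sort_model A \<iota> \<pi>"
  note M = sort_model[OF A \<iota> \<pi> cod]
  show ?thesis
  proof (rule ex_ex1I)
    have "\<exists>T'. T' \<in> models L KK (one L, Idn C (one C)) KE KQ \<and> comp_fctr A T' \<iota> = ?T \<and> comp_fctr L base_functor T' = id_fctr L"
    proof (rule K.model_extension_over[OF A R inf emb base_functor _ _ _ M base_sort_model[OF A \<iota> \<pi> cod]])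
      show "Fo base_functor (one L, Idn C (one C)) = one L" by (simp add: base_functor_def F_one)
    next
      fix e assume e: "e \<in> KE"
      have "e \<in> Ar KK" using e by (simp add: comma_sorts_def)
      then have fe: "Fa base_functor e = base_arr e" by (simp add: base_functor_def)
      from KE_cases[OF e] obtain a \<pi>' \<rho> k where er: "e = ((a, \<pi>'), (Ft L a, \<rho>), Pr L a, k)"
        and a: "a \<in> Ob L" "1 \<le> Len L a" "\<pi>' \<in> Ar C" "Tgt C \<pi>' = Fo F a" .
      have "Fo base_functor (Src KK e) = a" using a(1,3,4) by (simp add: er base_functor_def)
      then show "1 \<le> Len L (Fo base_functor (Src KK e)) \<and> Fa base_functor e = Pr L (Fo base_functor (Src KK e))"
        using a(2) by (simp only: fe) (simp add: er)
    next
      fix S assume S: "S \<in> KQ"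
      have "map_square (Fa base_functor) S = map_square base_arr S"
        using comm_squareD[OF KQ_D(1)[OF S]] by (intro square_eqI) (simp_all add: base_functor_def)
      then show "map_square (Fa base_functor) S \<in> QQ L" using KQ_D(4)[OF S] by simp
    qed
    then obtain T' where T': "T' \<in> models L KK (one L, Idn C (one C)) KE KQ" "comp_fctr A T' \<iota> = ?T"
      "comp_fctr L base_functor T' = id_fctr L" by blast
    have cmp: "snd (Fo T' (Fo \<iota> a)) = NCmp \<pi> a" if "a \<in> Ob A" for a
    proof -
      have "Fo (comp_fctr A T' \<iota>) a = Fo ?T a" by (simp only: T'(2))
      then show ?thesis using that by simp
    qed
    have arr: "fibre_arr (Fa T' (Fa \<iota> f)) = Fa (NDom \<pi>) f" if "f \<in> Ar A" for f
    proof -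
      have "Fa (comp_fctr A T' \<iota>) f = Fa ?T f" by (simp only: T'(2))
      then show ?thesis using that by simp
    qed
    note D = disp_ArD[OF indexed_sortD(1)[OF \<pi>]]
    have dom: "comp_fctr A (model_dom T') \<iota> = NDom \<pi>"
    proof (rule fctr_eqI[OF _ D(4)])
      have "model_dom T' \<in> functors L C"
        using disp_ArD(4)[OF indexed_sortD(1)[OF model_sort[OF T'(1,3)]]] by (simp add: model_sort_def)
      then show "comp_fctr A (model_dom T') \<iota> \<in> functors A C" by (rule A.comp_fctr_functors[OF i(1)])
      fix a assume a: "a \<in> Ob A"
      show "Fo (comp_fctr A (model_dom T') \<iota>) a = Fo (NDom \<pi>) a"
        using cmp[OF a] D(6)[OF a] a fctr_Ob[OF i(1) a] by (simp add: model_dom_def hom_iff)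
    next
      fix f assume f: "f \<in> Ar A"
      show "Fa (comp_fctr A (model_dom T') \<iota>) f = Fa (NDom \<pi>) f"
        using arr[OF f] f fctr_Ar[OF i(1) f] by (simp add: model_dom_def)
    qed
    have nc: "compose (Ob A) (NCmp (model_sort T')) (Fo \<iota>) = NCmp \<pi>"
      by (rule extensionalityI[OF _ D(3)])
        (auto simp: compose_eq model_sort_def fctr_Ob[OF i(1)] cmp)
    have "whisker A (model_sort T') \<iota> = \<pi>"
      unfolding whisker_def nc using dom cod by (simp add: model_sort_def)
    then show "\<exists>\<pi>'. indexed_sort L C \<pi>' \<and> NCod \<pi>' = F \<and> whisker A \<pi>' \<iota> = \<pi>"
      using model_sort[OF T'(1,3)] by (intro exI[of _ "model_sort T'"]) (simp add: model_sort_def)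
  next
    fix p q
    assume p: "indexed_sort L C p \<and> NCod p = F \<and> whisker A p \<iota> = \<pi>"
      and q: "indexed_sort L C q \<and> NCod q = F \<and> whisker A q \<iota> = \<pi>"
    have Fid: "F = comp_fctr L F (id_fctr L)" using L.comp_fctr_id[OF F_functor] by simp
    have mod: "sort_model L (id_fctr L) r \<in> models L KK (one L, Idn C (one C)) KE KQ \<and>
        comp_fctr A (sort_model L (id_fctr L) r) \<iota> = ?T" if r: "indexed_sort L C r \<and> NCod r = F \<and> whisker A r \<iota> = \<pi>" for r
    proof
      show m: "sort_model L (id_fctr L) r \<in> models L KK (one L, Idn C (one C)) KE KQ"
        using r Fid by (intro sort_model[OF L.precontextual_axioms L.id_ctx_functors]) simp_all
      have w: "whisker A r \<iota> = \<pi>" using r by simp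
      show "comp_fctr A (sort_model L (id_fctr L) r) \<iota> = ?T"
      proof (rule fctr_eqI[OF A.comp_fctr_functors[OF i(1) modelsD(1)[OF m]] modelsD(1)[OF M]])
        fix a assume a: "a \<in> Ob A"
        show "Fo (comp_fctr A (sort_model L (id_fctr L) r) \<iota>) a = Fo ?T a"
          unfolding w[symmetric] using a fctr_Ob[OF i(1) a] by (simp add: whisker_def compose_eq)
      next
        fix f assume f: "f \<in> Ar A"
        show "Fa (comp_fctr A (sort_model L (id_fctr L) r) \<iota>) f = Fa ?T f"
          unfolding w[symmetric] using f fctr_Ar[OF i(1) f] fctr_Ob[OF i(1) A.src_Ob[OF f]] fctr_Ob[OF i(1) A.tgt_Ob[OF f]]
          by (simp add: whisker_def compose_eq)
      qed
    qed
    have "sort_model L (id_fctr L) p = sort_model L (id_fctr L) q"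
      using K.model_extension[OF A R inf emb M] mod[OF p] mod[OF q] by blast
    then have e: "Fo (sort_model L (id_fctr L) p) a = Fo (sort_model L (id_fctr L) q) a"
      "Fa (sort_model L (id_fctr L) p) f = Fa (sort_model L (id_fctr L) q) f" for a f by simp_all
    have cmp: "NCmp p a = NCmp q a" if "a \<in> Ob L" for a using e(1)[of a] that by simp
    have arr: "Fa (NDom p) f = Fa (NDom q) f" if "f \<in> Ar L" for f using e(2)[of f] that by simp
    note dp = disp_ArD[OF indexed_sortD(1)[OF conjunct1[OF p]]] and dq = disp_ArD[OF indexed_sortD(1)[OF conjunct1[OF q]]]
    have "NDom p = NDom q"
    proof (rule fctr_eqI[OF dp(4) dq(4) _ arr])
      fix a assume a: "a \<in> Ob L"
      show "Fo (NDom p) a = Fo (NDom q) a" using cmp[OF a] dp(6)[OF a] dq(6)[OF a] by (simp add: hom_iff)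
    qed
    moreover have "NCmp p = NCmp q" by (rule extensionalityI[OF dp(3) dq(3) cmp])
    moreover have "NCod p = NCod q" using p q by simp
    ultimately show "p = q" by simp
  qed
qed

section \<open>Induction over the objects of a reflection\<close>

text \<open>The projections of objects satisfying \<open>P\<close> are taken as sorts:
  \<open>pull\<close> closes them under lifts and \<open>gen\<close> makes \<open>\<iota>\<close> a
  model. Its extension over \<open>L\<close> is the identity, so every projection of
  \<open>L\<close> is a sort, and projections determine their objects.\<close>

theorem reflection_induct:
  fixes A L :: "('u, 'u) ctx"
  assumes inf: "infinite (UNIV :: 'u set)" and A: "precontextual A" and R: "reflection A L \<iota>"
    and gen: "\<And>a. a \<in> Ob A \<Longrightarrow> 1 \<le> Len A a \<Longrightarrow> P (Fo \<iota> a)"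
    and pull: "\<And>S a b. S \<in> QQ L \<Longrightarrow> a \<in> Ob L \<Longrightarrow> 1 \<le> Len L a \<Longrightarrow> b \<in> Ob L \<Longrightarrow> 1 \<le> Len L b \<Longrightarrow>
      sLft S = Pr L a \<Longrightarrow> sRgt S = Pr L b \<Longrightarrow> P b \<Longrightarrow> P a"
    and a: "a \<in> Ob L" "1 \<le> Len L a"
  shows "P a"
proof -
  interpret A: precontextual A by fact
  have Lc: "contextual L" and \<iota>: "\<iota> \<in> ctx_functors A L" using R by (simp_all add: reflection_def)
  interpret L: contextual L by fact
  note i = ctx_functorsD[OF \<iota>]
  define E where "E = {Pr L b | b. b \<in> Ob L \<and> 1 \<le> Len L b \<and> P b}"
  define Q where "Q = {S \<in> QQ L. sLft S \<in> E \<and> sRgt S \<in> E}"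
  \<comment> \<open>The assumption \<open>pull\<close>, read as: the left side of a lifted square is
    again a sort.\<close>
  have lft_E: "sLft S \<in> E" if S: "S \<in> QQ L" "sRgt S \<in> E" for S
  proof -
    obtain c b where cb: "c \<in> Ob L" "1 \<le> Len L c" "sLft S = Pr L c" "b \<in> Ob L" "1 \<le> Len L b" "sRgt S = Pr L b"
      using L.QQ_cases[OF S(1)] by metis
    obtain d where d: "d \<in> Ob L" "1 \<le> Len L d" "P d" "sRgt S = Pr L d" using S(2) by (auto simp: E_def)
    have "P c" by (rule pull[OF S(1) cb(1,2) d(1,2) cb(3) d(4) d(3)])
    then show ?thesis using cb unfolding E_def by blast
  qed
  interpret K: sort_category L "one L" E Q
  proof (rule sort_category.intro[OF L.category_axioms], unfold_locales)
    show "terminal L (one L)" by (rule L.terminal_one)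
    show "e \<in> Ar L" if "e \<in> E" for e using that by (auto simp: E_def)
    show "pullback L S" "sLft S \<in> E" if "S \<in> Q" for S using that L.Q_pullback by (auto simp: Q_def)
    show "\<lparr>sTop = Idn L (Src L e), sBot = Idn L (Tgt L e), sLft = e, sRgt = e\<rparr> \<in> Q" if e: "e \<in> E" for e
      using e L.Q_id unfolding Q_def E_def by auto
    show "\<lparr>sTop = Cmp L (sTop T) (sTop S), sBot = Cmp L (sBot T) (sBot S), sLft = sLft S, sRgt = sRgt T\<rparr> \<in> Q"
      if "S \<in> Q" "T \<in> Q" "sRgt S = sLft T" for S T
      using that L.Q_horizontal[of S T] by (simp add: Q_def)
    show "\<exists>!S. S \<in> Q \<and> sRgt S = e \<and> sBot S = f" if e: "e \<in> E" and f: "f \<in> Ar L" "Tgt L f = Tgt L e" for e f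
    proof -
      obtain b where b: "b \<in> Ob L" "1 \<le> Len L b" "e = Pr L b" using e by (auto simp: E_def)
      have "\<exists>!S. S \<in> QQ L \<and> sRgt S = e \<and> sBot S = f"
        unfolding b(3) by (rule L.Q_lift) (use b f in simp_all)
      moreover have "S \<in> Q \<longleftrightarrow> S \<in> QQ L" if "sRgt S = e" for S using that e lft_E unfolding Q_def by auto
      ultimately show ?thesis by (metis (no_types, lifting))
    qed
  qed
  have emb: "\<exists>f :: 'u \<Rightarrow> 'u. inj f" using inj_on_id by blast
  have \<iota>M: "\<iota> \<in> models A L (one L) E Q"
  proof -
    have E: "Fa \<iota> (Pr A b) \<in> E" if b: "b \<in> Ob A" "1 \<le> Len A b" for b
      using i(4)[OF b] gen[OF b] i(2)[OF b(1)] fctr_Ob[OF i(1) b(1)] b unfolding E_def by auto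
    have "map_square (Fa \<iota>) S \<in> Q" if S: "S \<in> QQ A" for S
    proof -
      from A.QQ_cases[OF S] have "Fa \<iota> (sLft S) \<in> E" "Fa \<iota> (sRgt S) \<in> E" using E by metis+
      then show ?thesis using i(5)[OF S] by (simp add: Q_def)
    qed
    moreover have "Fo \<iota> b = one L" if "b \<in> Ob A" "Len A b = 0" for b
      using that i(2)[of b] fctr_Ob[OF i(1), of b] by (intro L.one_eqI) simp_all
    ultimately show ?thesis unfolding models_def using i(1) E by blast
  qed
  have "\<exists>T'. T' \<in> models L L (one L) E Q \<and> comp_fctr A T' \<iota> = \<iota> \<and> comp_fctr L (id_fctr L) T' = id_fctr L"
  proof (rule K.model_extension_over[OF A R inf emb L.id_fctr_functors _ _ _ \<iota>M])
    show "Fo (id_fctr L) (one L) = one L" by simp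
    show "1 \<le> Len L (Fo (id_fctr L) (Src L e)) \<and> Fa (id_fctr L) e = Pr L (Fo (id_fctr L) (Src L e))" if "e \<in> E" for e
      using that by (auto simp: E_def)
    show "map_square (Fa (id_fctr L)) S \<in> QQ L" if "S \<in> Q" for S
      using that ctx_functorsD(5)[OF L.id_ctx_functors] by (simp add: Q_def)
    show "comp_fctr A (id_fctr L) \<iota> = \<iota>" by (rule A.id_comp_fctr[OF L.category_axioms i(1)])
  qed
  then obtain T' where T': "T' \<in> models L L (one L) E Q" "comp_fctr L (id_fctr L) T' = id_fctr L" by blast
  have "T' = id_fctr L" using L.id_comp_fctr[OF L.category_axioms modelsD(1)[OF T'(1)]] T'(2) by simp
  then have "Pr L a \<in> E" using modelsD(3)[OF T'(1) a] L.Ar_Pr[OF a] by simp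
  then obtain b where b: "Pr L a = Pr L b" "b \<in> Ob L" "1 \<le> Len L b" "P b" by (auto simp: E_def)
  have "a = b" by (rule L.Pr_inj[OF a b(2,3,1)])
  then show ?thesis using b(4) by simp
qed

section \<open>Natural transformations as models\<close>

text \<open>The inserter of \<open>F\<close> and \<open>G\<close>: sections of its projection to
  \<open>L\<close> are the natural transformations from \<open>F\<close> to
  \<open>G\<close>.\<close>

definition nt_cat ::
  "('o, 'm, 'x) ctx_scheme \<Rightarrow> ('p, 'n, 'y) ctx_scheme \<Rightarrow> ('o, 'm, 'p, 'n) fctr \<Rightarrow> ('o, 'm, 'p, 'n) fctr \<Rightarrow>
   ('o \<times> 'n, ('o \<times> 'n) \<times> ('o \<times> 'n) \<times> 'm) cat" where
  "nt_cat L C F G =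
     \<lparr>Ob = {(a, \<tau>). a \<in> Ob L \<and> \<tau> \<in> hom C (Fo F a) (Fo G a)},
      Ar = {((a, \<tau>), (b, \<sigma>), f). f \<in> hom L a b \<and> \<tau> \<in> hom C (Fo F a) (Fo G a) \<and>
              \<sigma> \<in> hom C (Fo F b) (Fo G b) \<and> Fa G f \<cdot>\<^bsub>C\<^esub> \<tau> = \<sigma> \<cdot>\<^bsub>C\<^esub> Fa F f},
      Src = fst,
      Tgt = (\<lambda>(x, y, f). y),
      Idn = (\<lambda>(a, \<tau>). ((a, \<tau>), (a, \<tau>), Idn L a)),
      Cmp = (\<lambda>(y', z, g) (x, y, f). (x, z, g \<cdot>\<^bsub>L\<^esub> f))\<rparr>"

fun nt_base :: "('o \<times> 'n) \<times> ('o \<times> 'n) \<times> 'm \<Rightarrow> 'm" where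
  "nt_base (x, y, f) = f"

text \<open>By \<open>G_pullback\<close> a component at a pulled back object is determined by its
  two projections, and can be constructed from them.\<close>

locale nt_lift = L: contextual L + C: contextual C
  for L :: "('o, 'm, 'x) ctx_scheme" and C :: "('p, 'n, 'y) ctx_scheme" (structure) +
  fixes F G :: "('o, 'm, 'p, 'n) fctr"
  assumes F_disp: "F \<in> Ob (disp_fun_cat L C)" and G_disp: "G \<in> Ob (disp_fun_cat L C)"
    and G_pullback: "S \<in> QQ L \<Longrightarrow> pullback C (map_square (Fa G) S)"
begin

abbreviation "NN \<equiv> nt_cat L C F G"

definition "NE = {e \<in> Ar NN. \<exists>a \<in> Ob L. 1 \<le> Len L a \<and> nt_base e = Pr L a}"

definition "NQ = {S. comm_square NN S \<and> map_square nt_base S \<in> QQ L}"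

lemma functors_FG: "F \<in> functors L C" "G \<in> functors L C"
  and FG_one: "Fo F (one L) = one C" "Fo G (one L) = one C"
  using F_disp G_disp unfolding disp_Ob by simp_all

lemmas FG_Ar [simp] = fctr_Ar[OF functors_FG(1)] fctr_Ar[OF functors_FG(2)]
lemmas FG_Ob [simp] = fctr_Ob[OF functors_FG(1)] fctr_Ob[OF functors_FG(2)]
lemmas FG_Idn [simp] = fctr_Idn[OF functors_FG(1)] fctr_Idn[OF functors_FG(2)]
lemmas F_Cmp = fctr_Cmp[OF functors_FG(1)]
lemmas G_Cmp = fctr_Cmp[OF functors_FG(2)]

lemma NN_simps [simp]:
  "(a, \<tau>) \<in> Ob NN \<longleftrightarrow> a \<in> Ob L \<and> \<tau> \<in> hom C (Fo F a) (Fo G a)"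
  "((a, \<tau>), (b, \<sigma>), f) \<in> Ar NN \<longleftrightarrow> f \<in> hom L a b \<and> \<tau> \<in> hom C (Fo F a) (Fo G a) \<and>
     \<sigma> \<in> hom C (Fo F b) (Fo G b) \<and> Fa G f \<cdot> \<tau> = \<sigma> \<cdot> Fa F f"
  "Src NN (x, y, f) = x" "Tgt NN (x, y, f) = y"
  "Idn NN (a, \<tau>) = ((a, \<tau>), (a, \<tau>), Idn L a)"
  "Cmp NN (y', z, g) (x, y, f) = (x, z, g \<cdot>\<^bsub>L\<^esub> f)"
  by (simp_all add: nt_cat_def)

lemma NN_homE:
  assumes "h \<in> hom NN (a, \<tau>) (b, \<sigma>)"
  obtains f where "h = ((a, \<tau>), (b, \<sigma>), f)" "f \<in> hom L a b" "\<tau> \<in> hom C (Fo F a) (Fo G a)"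
     "\<sigma> \<in> hom C (Fo F b) (Fo G b)" "Fa G f \<cdot> \<tau> = \<sigma> \<cdot> Fa F f"
  using assms by (cases h) (auto simp: hom_iff[of _ NN])

lemma NN_hom [simp]: "((a, \<tau>), (b, \<sigma>), f) \<in> hom NN (a', \<tau>') (b', \<sigma>') \<longleftrightarrow>
    a = a' \<and> \<tau> = \<tau>' \<and> b = b' \<and> \<sigma> = \<sigma>' \<and> f \<in> hom L a b \<and> \<tau> \<in> hom C (Fo F a) (Fo G a) \<and>
     \<sigma> \<in> hom C (Fo F b) (Fo G b) \<and> Fa G f \<cdot> \<tau> = \<sigma> \<cdot> Fa F f"
  by (auto simp: hom_iff[of _ NN])

lemma NN_Cmp_nat:
  assumes "f \<in> hom L a b" "\<tau> \<in> hom C (Fo F a) (Fo G a)" "\<sigma> \<in> hom C (Fo F b) (Fo G b)"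
    "Fa G f \<cdot> \<tau> = \<sigma> \<cdot> Fa F f"
    and "g \<in> hom L b c" "\<rho> \<in> hom C (Fo F c) (Fo G c)" "Fa G g \<cdot> \<sigma> = \<rho> \<cdot> Fa F g"
  shows "Fa G (g \<cdot>\<^bsub>L\<^esub> f) \<cdot> \<tau> = \<rho> \<cdot> Fa F (g \<cdot>\<^bsub>L\<^esub> f)"
proof -
  note a = assms(1,2,3,5,6)
  have "Fa G (g \<cdot>\<^bsub>L\<^esub> f) \<cdot> \<tau> = Fa G g \<cdot> (Fa G f \<cdot> \<tau>)"
    using a by (simp add: G_Cmp hom_iff C.Cmp_assoc)
  also have "\<dots> = Fa G g \<cdot> (\<sigma> \<cdot> Fa F f)" by (simp add: assms(4))
  also have "\<dots> = (\<rho> \<cdot> Fa F g) \<cdot> Fa F f"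
    using a by (intro C.Cmp_reassoc assms(7)) (auto simp: hom_iff)
  also have "\<dots> = \<rho> \<cdot> Fa F (g \<cdot>\<^bsub>L\<^esub> f)"
    using a by (simp add: F_Cmp hom_iff C.Cmp_assoc)
  finally show ?thesis .
qed

lemma category_NN: "category NN"
proof
  fix h assume h: "h \<in> Ar NN"
  obtain a \<tau> b \<sigma> f where e: "h = ((a, \<tau>), (b, \<sigma>), f)" by (metis prod.collapse)
  then show "Src NN h \<in> Ob NN" "Tgt NN h \<in> Ob NN" using h by (auto simp: hom_iff)
next
  fix x assume "x \<in> Ob NN"
  then show "Idn NN x \<in> hom NN x x" by (cases x) (auto simp: hom_iff[of _ C] hom_iff[of _ L])
next
  fix h g x y z assume h: "h \<in> hom NN x y" and g: "g \<in> hom NN y z"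
  obtain a \<tau> b \<sigma> c \<rho> where xyz: "x = (a, \<tau>)" "y = (b, \<sigma>)" "z = (c, \<rho>)" by (metis prod.collapse)
  from NN_homE[OF h[unfolded xyz]] obtain f where f: "h = ((a, \<tau>), (b, \<sigma>), f)" "f \<in> hom L a b" "\<tau> \<in> hom C (Fo F a) (Fo G a)"
     "\<sigma> \<in> hom C (Fo F b) (Fo G b)" "Fa G f \<cdot> \<tau> = \<sigma> \<cdot> Fa F f" .
  from NN_homE[OF g[unfolded xyz]] obtain f' where g: "g = ((b, \<sigma>), (c, \<rho>), f')" "f' \<in> hom L b c" "\<sigma> \<in> hom C (Fo F b) (Fo G b)"
     "\<rho> \<in> hom C (Fo F c) (Fo G c)" "Fa G f' \<cdot> \<sigma> = \<rho> \<cdot> Fa F f'" .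
  show "Cmp NN g h \<in> hom NN x z"
    using NN_Cmp_nat[OF f(2-5) g(2,4,5)] f(3) g(4) L.cmp_hom[OF f(2) g(2)]
    by (simp add: f(1) g(1) xyz)
next
  fix h x y assume h: "h \<in> hom NN x y"
  obtain a \<tau> b \<sigma> where xy: "x = (a, \<tau>)" "y = (b, \<sigma>)" by (metis prod.collapse)
  from NN_homE[OF h[unfolded xy]] obtain f where "h = ((a, \<tau>), (b, \<sigma>), f)" "f \<in> hom L a b" .
  then show "Cmp NN h (Idn NN x) = h" "Cmp NN (Idn NN y) h = h" by (simp_all add: xy hom_iff)
next
  fix h g i x y z w assume h: "h \<in> hom NN x y" and g: "g \<in> hom NN y z" and i: "i \<in> hom NN z w"
  obtain a \<tau> b \<sigma> c \<rho> d \<upsilon> where xyz: "x = (a, \<tau>)" "y = (b, \<sigma>)" "z = (c, \<rho>)" "w = (d, \<upsilon>)" by (metis prod.collapse)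
  from NN_homE[OF h[unfolded xyz]] obtain f where f: "h = ((a, \<tau>), (b, \<sigma>), f)" "f \<in> hom L a b" .
  from NN_homE[OF g[unfolded xyz]] obtain f' where g: "g = ((b, \<sigma>), (c, \<rho>), f')" "f' \<in> hom L b c" .
  from NN_homE[OF i[unfolded xyz]] obtain f'' where i: "i = ((c, \<rho>), (d, \<upsilon>), f'')" "f'' \<in> hom L c d" .
  show "Cmp NN i (Cmp NN g h) = Cmp NN (Cmp NN i g) h"
    using L.cmp_assoc[OF f(2) g(2) i(2)] by (simp add: f(1) g(1) i(1))
qed

lemma terminal_NN: "terminal NN (one L, Idn C (one C))"
  unfolding terminal_def
proof (intro conjI ballI)
  show "(one L, Idn C (one C)) \<in> Ob NN" by (simp add: FG_one hom_iff)
  fix x assume x: "x \<in> Ob NN"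
  obtain a \<tau> where xa: "x = (a, \<tau>)" by (metis prod.collapse)
  then have a: "a \<in> Ob L" "\<tau> \<in> hom C (Fo F a) (Fo G a)" using x by simp_all
  obtain f where f: "f \<in> hom L a (one L)" using L.ex_to_one[OF a(1)] by blast
  have "Fa G f \<cdot> \<tau> = Idn C (one C) \<cdot> Fa F f"
    using f a FG_one by (intro C.to_one_eq) (auto simp: hom_iff)
  then have "((a, \<tau>), (one L, Idn C (one C)), f) \<in> hom NN x (one L, Idn C (one C))"
    using f a FG_one by (simp add: xa hom_iff[of _ C])
  then show "\<exists>!h. h \<in> hom NN x (one L, Idn C (one C))"
  proof (rule ex1I)
    fix h assume "h \<in> hom NN x (one L, Idn C (one C))"
    from NN_homE[OF this[unfolded xa]] obtain f' where h: "h = ((a, \<tau>), (one L, Idn C (one C)), f')"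
      "f' \<in> hom L a (one L)" .
    have "f' = f" using h f L.to_one_eq[of f' f] by (simp add: hom_iff)
    then show "h = ((a, \<tau>), (one L, Idn C (one C)), f)" using h by simp
  qed
qed

lemma NE_cases:
  assumes "e \<in> Ar NN" "a \<in> Ob L" "1 \<le> Len L a" "nt_base e = Pr L a"
  obtains \<tau> \<rho> where "e = ((a, \<tau>), (Ft L a, \<rho>), Pr L a)" "\<tau> \<in> hom C (Fo F a) (Fo G a)"
    "\<rho> \<in> hom C (Fo F (Ft L a)) (Fo G (Ft L a))" "Fa G (Pr L a) \<cdot> \<tau> = \<rho> \<cdot> Fa F (Pr L a)"
proof -
  obtain b \<tau> c \<rho> f where e: "e = ((b, \<tau>), (c, \<rho>), f)" by (metis prod.collapse)
  then have f: "f = Pr L a" using assms(4) by simp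
  have "((b, \<tau>), (c, \<rho>), Pr L a) \<in> Ar NN" using assms(1) e f by simp
  then have h: "Pr L a \<in> hom L b c" "\<tau> \<in> hom C (Fo F b) (Fo G b)" "\<rho> \<in> hom C (Fo F c) (Fo G c)"
    "Fa G (Pr L a) \<cdot> \<tau> = \<rho> \<cdot> Fa F (Pr L a)" by simp_all
  have bc: "b = a" "c = Ft L a" using h(1) assms(2,3) by (auto simp: hom_iff)
  show thesis using e h(2-4) unfolding bc f by (rule that)
qed

lemma NQ_cases:
  assumes S: "S \<in> NQ"
  obtains a' \<tau>' \<rho>' a \<tau> \<rho> f' f where
    "S = \<lparr>sTop = ((a', \<tau>'), (a, \<tau>), f'), sBot = ((Ft L a', \<rho>'), (Ft L a, \<rho>), f),
          sLft = ((a', \<tau>'), (Ft L a', \<rho>'), Pr L a'), sRgt = ((a, \<tau>), (Ft L a, \<rho>), Pr L a)\<rparr>"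
    "\<lparr>sTop = f', sBot = f, sLft = Pr L a', sRgt = Pr L a\<rparr> \<in> QQ L"
    "a' \<in> Ob L" "1 \<le> Len L a'" "a \<in> Ob L" "1 \<le> Len L a"
    "f' \<in> hom L a' a" "f \<in> hom L (Ft L a') (Ft L a)"
    "\<tau>' \<in> hom C (Fo F a') (Fo G a')" "\<tau> \<in> hom C (Fo F a) (Fo G a)"
    "\<rho>' \<in> hom C (Fo F (Ft L a')) (Fo G (Ft L a'))" "\<rho> \<in> hom C (Fo F (Ft L a)) (Fo G (Ft L a))"
    "Fa G f' \<cdot> \<tau>' = \<tau> \<cdot> Fa F f'" "Fa G f \<cdot> \<rho>' = \<rho> \<cdot> Fa F f"
    "Fa G (Pr L a') \<cdot> \<tau>' = \<rho>' \<cdot> Fa F (Pr L a')"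
proof -
  have cS: "comm_square NN S" and Q: "map_square nt_base S \<in> QQ L" using S by (simp_all add: NQ_def)
  note c = comm_squareD[OF cS]
  obtain a' a where a: "a' \<in> Ob L" "1 \<le> Len L a'" "nt_base (sLft S) = Pr L a'" "a \<in> Ob L" "1 \<le> Len L a"
    "nt_base (sRgt S) = Pr L a"
    using L.QQ_cases[OF Q] by (metis map_square_simps(3,4))
  from NE_cases[OF c(3) a(1-3)] obtain \<tau>' \<rho>' where l: "sLft S = ((a', \<tau>'), (Ft L a', \<rho>'), Pr L a')"
    "\<tau>' \<in> hom C (Fo F a') (Fo G a')" "\<rho>' \<in> hom C (Fo F (Ft L a')) (Fo G (Ft L a'))"
    "Fa G (Pr L a') \<cdot> \<tau>' = \<rho>' \<cdot> Fa F (Pr L a')" .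
  from NE_cases[OF c(4) a(4-6)] obtain \<tau> \<rho> where r: "sRgt S = ((a, \<tau>), (Ft L a, \<rho>), Pr L a)"
    "\<tau> \<in> hom C (Fo F a) (Fo G a)" "\<rho> \<in> hom C (Fo F (Ft L a)) (Fo G (Ft L a))" .
  have "sTop S \<in> hom NN (a', \<tau>') (a, \<tau>)" using c(1,5,6) l(1) r(1) by (simp add: hom_iff[of _ NN])
  from NN_homE[OF this] obtain f' where t: "sTop S = ((a', \<tau>'), (a, \<tau>), f')" "f' \<in> hom L a' a"
    "Fa G f' \<cdot> \<tau>' = \<tau> \<cdot> Fa F f'" .
  have "sBot S \<in> hom NN (Ft L a', \<rho>') (Ft L a, \<rho>)" using c(2,7,8) l(1) r(1) by (simp add: hom_iff[of _ NN])
  from NN_homE[OF this] obtain f where b: "sBot S = ((Ft L a', \<rho>'), (Ft L a, \<rho>), f)"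
    "f \<in> hom L (Ft L a') (Ft L a)" "Fa G f \<cdot> \<rho>' = \<rho> \<cdot> Fa F f" .
  show thesis
  proof (rule that[of a' \<tau>' a \<tau> f' \<rho>' \<rho> f])
    show "S = \<lparr>sTop = ((a', \<tau>'), (a, \<tau>), f'), sBot = ((Ft L a', \<rho>'), (Ft L a, \<rho>), f),
          sLft = ((a', \<tau>'), (Ft L a', \<rho>'), Pr L a'), sRgt = ((a, \<tau>), (Ft L a, \<rho>), Pr L a)\<rparr>"
      by (rule square_eqI) (simp_all add: t(1) b(1) l(1) r(1))
    show "\<lparr>sTop = f', sBot = f, sLft = Pr L a', sRgt = Pr L a\<rparr> \<in> QQ L"
      using Q by (simp add: map_square_def t(1) b(1) l(1) r(1))
  qed (use a l r t b in simp_all)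
qed

text \<open>The lift \<open>w\<close> and its uniqueness come from \<open>L\<close>. The point is
  that \<open>w\<close> respects the components, an equation between maps into the image of
  \<open>a'\<close> under \<open>G\<close>, which is tested on the pullback
  \<open>?R\<close>.\<close>

lemma NQ_pullback:
  assumes S: "S \<in> NQ"
  shows "pullback NN S"
proof -
  interpret N: category NN by (rule category_NN)
  have cS: "comm_square NN S" using S by (simp add: NQ_def)
  from NQ_cases[OF S] obtain a' \<tau>' \<rho>' a \<tau> \<rho> f' f where
    Se: "S = \<lparr>sTop = ((a', \<tau>'), (a, \<tau>), f'), sBot = ((Ft L a', \<rho>'), (Ft L a, \<rho>), f),
          sLft = ((a', \<tau>'), (Ft L a', \<rho>'), Pr L a'), sRgt = ((a, \<tau>), (Ft L a, \<rho>), Pr L a)\<rparr>"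
    and Q: "\<lparr>sTop = f', sBot = f, sLft = Pr L a', sRgt = Pr L a\<rparr> \<in> QQ L"
    and a: "a' \<in> Ob L" "1 \<le> Len L a'" "a \<in> Ob L" "1 \<le> Len L a"
    and f: "f' \<in> hom L a' a" "f \<in> hom L (Ft L a') (Ft L a)"
    and \<tau>: "\<tau>' \<in> hom C (Fo F a') (Fo G a')" "\<tau> \<in> hom C (Fo F a) (Fo G a)"
    "\<rho>' \<in> hom C (Fo F (Ft L a')) (Fo G (Ft L a'))" "\<rho> \<in> hom C (Fo F (Ft L a)) (Fo G (Ft L a))"
    and e: "Fa G f' \<cdot> \<tau>' = \<tau> \<cdot> Fa F f'" "Fa G (Pr L a') \<cdot> \<tau>' = \<rho>' \<cdot> Fa F (Pr L a')" .
  note LP = L.Q_pullback[OF Q]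
  let ?R = "\<lparr>sTop = Fa G f', sBot = Fa G f, sLft = Fa G (Pr L a'), sRgt = Fa G (Pr L a)\<rparr>"
  have GP: "pullback C ?R"
    using G_pullback[OF Q] by (simp add: map_square_def)
  show ?thesis
  proof (rule N.pullbackI[OF cS])
    fix z u v assume u: "u \<in> hom NN z (Src NN (sBot S))" and v: "v \<in> hom NN z (Src NN (sRgt S))"
      and uv: "sBot S \<cdot>\<^bsub>NN\<^esub> u = sRgt S \<cdot>\<^bsub>NN\<^esub> v"
    obtain x \<zeta> where z: "z = (x, \<zeta>)" by (metis prod.collapse)
    have "u \<in> hom NN (x, \<zeta>) (Ft L a', \<rho>')" "v \<in> hom NN (x, \<zeta>) (a, \<tau>)" using u v by (simp_all add: Se z)
    from NN_homE[OF this(1)] NN_homE[OF this(2)] obtain fu fv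
      where u': "u = ((x, \<zeta>), (Ft L a', \<rho>'), fu)" "fu \<in> hom L x (Ft L a')" "\<zeta> \<in> hom C (Fo F x) (Fo G x)"
        "Fa G fu \<cdot> \<zeta> = \<rho>' \<cdot> Fa F fu"
      and v': "v = ((x, \<zeta>), (a, \<tau>), fv)" "fv \<in> hom L x a" "Fa G fv \<cdot> \<zeta> = \<tau> \<cdot> Fa F fv" by metis
    have uv': "f \<cdot>\<^bsub>L\<^esub> fu = Pr L a \<cdot>\<^bsub>L\<^esub> fv"
      using uv by (simp add: Se u'(1) v'(1))
    have "fu \<in> hom L x (Src L f)" "fv \<in> hom L x (Src L (Pr L a))" using u' v' f a by (simp_all add: hom_iff)
    then obtain w where w: "w \<in> hom L x a'" "Pr L a' \<cdot>\<^bsub>L\<^esub> w = fu" "f' \<cdot>\<^bsub>L\<^esub> w = fv"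
      using pullback_lift[OF LP, of fu x fv] uv' f by (auto simp: hom_iff)
    have "Fa G w \<cdot> \<zeta> = \<tau>' \<cdot> Fa F w"
    proof (rule C.pullback_unique[OF GP])
      show "Fa G w \<cdot> \<zeta> \<in> hom C (Fo F x) (Src C (sTop ?R))"
        "\<tau>' \<cdot> Fa F w \<in> hom C (Fo F x) (Src C (sTop ?R))"
        using w(1) u'(3) \<tau>(1) f(1) by (simp_all add: hom_iff)
      have "Fa G (Pr L a') \<cdot> (Fa G w \<cdot> \<zeta>) = Fa G fu \<cdot> \<zeta>"
        unfolding w(2)[symmetric] using w(1) u'(3) a by (simp add: G_Cmp hom_iff C.Cmp_assoc)
      also have "\<dots> = \<rho>' \<cdot> Fa F fu" by (rule u'(4))
      also have "\<dots> = \<rho>' \<cdot> (Fa F (Pr L a') \<cdot> Fa F w)"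
        unfolding w(2)[symmetric] using w(1) a by (simp add: F_Cmp hom_iff)
      also have "\<dots> = (Fa G (Pr L a') \<cdot> \<tau>') \<cdot> Fa F w"
        unfolding e(2) using w(1) a \<tau>(3) by (simp add: hom_iff C.Cmp_assoc)
      also have "\<dots> = Fa G (Pr L a') \<cdot> (\<tau>' \<cdot> Fa F w)"
        using w(1) a \<tau>(1) by (intro C.Cmp_assoc) (simp_all add: hom_iff)
      finally show "sLft ?R \<cdot> (Fa G w \<cdot> \<zeta>)
        = sLft ?R \<cdot> (\<tau>' \<cdot> Fa F w)" by simp
      have "Fa G f' \<cdot> (Fa G w \<cdot> \<zeta>) = Fa G fv \<cdot> \<zeta>"
        unfolding w(3)[symmetric] using w(1) u'(3) f(1) by (simp add: G_Cmp hom_iff C.Cmp_assoc)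
      also have "\<dots> = \<tau> \<cdot> Fa F fv" by (rule v'(3))
      also have "\<dots> = \<tau> \<cdot> (Fa F f' \<cdot> Fa F w)"
        unfolding w(3)[symmetric] using w(1) f(1) by (simp add: F_Cmp hom_iff)
      also have "\<dots> = (Fa G f' \<cdot> \<tau>') \<cdot> Fa F w"
        unfolding e(1) using w(1) f(1) \<tau>(2) by (simp add: hom_iff C.Cmp_assoc)
      also have "\<dots> = Fa G f' \<cdot> (\<tau>' \<cdot> Fa F w)"
        using w(1) f(1) \<tau>(1) by (intro C.Cmp_assoc) (simp_all add: hom_iff)
      finally show "sTop ?R \<cdot> (Fa G w \<cdot> \<zeta>)
        = sTop ?R \<cdot> (\<tau>' \<cdot> Fa F w)" by simp
    qed
    then show "\<exists>h. h \<in> hom NN z (Src NN (sTop S)) \<and> sLft S \<cdot>\<^bsub>NN\<^esub> h = u \<and> sTop S \<cdot>\<^bsub>NN\<^esub> h = v"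
      using w u'(1,3) v'(1) \<tau>(1) by (intro exI[of _ "((x, \<zeta>), (a', \<tau>'), w)"]) (simp add: Se z)
  next
    fix z h1 h2 assume h: "h1 \<in> hom NN z (Src NN (sTop S))" "h2 \<in> hom NN z (Src NN (sTop S))"
      and eq: "sLft S \<cdot>\<^bsub>NN\<^esub> h1 = sLft S \<cdot>\<^bsub>NN\<^esub> h2" "sTop S \<cdot>\<^bsub>NN\<^esub> h1 = sTop S \<cdot>\<^bsub>NN\<^esub> h2"
    obtain x \<zeta> where z: "z = (x, \<zeta>)" by (metis prod.collapse)
    have "h1 \<in> hom NN (x, \<zeta>) (a', \<tau>')" "h2 \<in> hom NN (x, \<zeta>) (a', \<tau>')" using h by (simp_all add: Se z)
    from NN_homE[OF this(1)] NN_homE[OF this(2)] obtain w1 w2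
      where h1: "h1 = ((x, \<zeta>), (a', \<tau>'), w1)" "w1 \<in> hom L x a'"
      and h2: "h2 = ((x, \<zeta>), (a', \<tau>'), w2)" "w2 \<in> hom L x a'" by metis
    have "w1 = w2"
      using L.pullback_unique[OF LP, of w1 x w2] eq h1 h2 f a by (simp add: Se hom_iff)
    then show "h1 = h2" using h1(1) h2(1) by simp
  qed
qed

lemma nt_base_Cmp [simp]: "nt_base (Cmp NN g f) = nt_base g \<cdot>\<^bsub>L\<^esub> nt_base f"
  by (cases f; cases g; simp)

text \<open>The lift in \<open>L\<close> leaves one unknown, the component at the new vertex.
  Naturality along the left side and along the top prescribes its two projections, and
  \<open>G_pullback\<close> then yields exactly one such component.\<close>

lemma NQ_lift:
  assumes e: "e \<in> NE" and h: "h \<in> Ar NN" and eh: "Tgt NN h = Tgt NN e"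
  shows "\<exists>!S. S \<in> NQ \<and> sRgt S = e \<and> sBot S = h"
proof -
  from e obtain a where a: "a \<in> Ob L" "1 \<le> Len L a" "nt_base e = Pr L a" and eA: "e \<in> Ar NN" by (auto simp: NE_def)
  from NE_cases[OF eA a] obtain \<tau> \<rho> where er: "e = ((a, \<tau>), (Ft L a, \<rho>), Pr L a)" and \<tau>: "\<tau> \<in> hom C (Fo F a) (Fo G a)"
    and \<rho>: "\<rho> \<in> hom C (Fo F (Ft L a)) (Fo G (Ft L a))" and e\<tau>: "Fa G (Pr L a) \<cdot> \<tau> = \<rho> \<cdot> Fa F (Pr L a)" .
  obtain b \<sigma> where sh: "Src NN h = (b, \<sigma>)" by (metis prod.collapse)
  then have "h \<in> hom NN (b, \<sigma>) (Ft L a, \<rho>)" using h eh er by (simp add: hom_iff[of _ NN])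
  from NN_homE[OF this] obtain f where hk: "h = ((b, \<sigma>), (Ft L a, \<rho>), f)" and f: "f \<in> hom L b (Ft L a)"
     and \<sigma>: "\<sigma> \<in> hom C (Fo F b) (Fo G b)" and fn: "Fa G f \<cdot> \<sigma> = \<rho> \<cdot> Fa F f" .
  have "f \<in> Ar L" "Tgt L f = Ft L a" using f by (simp_all add: hom_iff)
  from L.Q_lift[OF a(1,2) this] obtain R where R: "R \<in> QQ L" "sRgt R = Pr L a" "sBot R = f"
    and unR: "\<And>R'. R' \<in> QQ L \<Longrightarrow> sRgt R' = Pr L a \<Longrightarrow> sBot R' = f \<Longrightarrow> R' = R" by blast
  obtain a' where a': "a' \<in> Ob L" "1 \<le> Len L a'" "sLft R = Pr L a'" "sTop R \<in> hom L a' a" "b = Ft L a'"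
  proof -
    obtain a' c where ac: "a' \<in> Ob L" "1 \<le> Len L a'" "sLft R = Pr L a'" "c \<in> Ob L" "1 \<le> Len L c"
      "sRgt R = Pr L c" "sTop R \<in> hom L a' c" "sBot R \<in> hom L (Ft L a') (Ft L c)"
      using L.QQ_cases[OF R(1)] .
    have "Pr L c = Pr L a" using ac(6) R(2) by simp
    then have c: "c = a" by (rule L.Pr_inj[OF ac(4,5) a(1,2)])
    have "b = Ft L a'" using ac(8) f unfolding R(3) by (simp add: hom_iff)
    with ac(1-3) ac(7)[unfolded c] show thesis by (rule that)
  qed
  have RL: "Pr L a \<cdot>\<^bsub>L\<^esub> sTop R = f \<cdot>\<^bsub>L\<^esub> Pr L a'"
    using comm_squareD(9)[OF L.Q_comm[OF R(1)]] R a' by simp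
  have Fsq: "Fa F (Pr L a) \<cdot> Fa F (sTop R) = Fa F f \<cdot> Fa F (Pr L a')"
    using RL F_Cmp[of "sTop R" "Pr L a"] F_Cmp[of "Pr L a'" f] a a' f by (simp add: hom_iff)
  note GP = G_pullback[OF R(1)]
  have u: "\<sigma> \<cdot> Fa F (Pr L a') \<in> hom C (Fo F a') (Src C (sBot (map_square (Fa G) R)))"
    and v: "\<tau> \<cdot> Fa F (sTop R) \<in> hom C (Fo F a') (Src C (sRgt (map_square (Fa G) R)))"
    using \<sigma> \<tau> a a' f R by (simp_all add: hom_iff)
  have "Fa G f \<cdot> (\<sigma> \<cdot> Fa F (Pr L a')) = (\<rho> \<cdot> Fa F f) \<cdot> Fa F (Pr L a')"
    using \<sigma> f a' by (intro C.Cmp_reassoc fn) (simp_all add: hom_iff)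
  also have "\<dots> = \<rho> \<cdot> (Fa F f \<cdot> Fa F (Pr L a'))"
    using \<rho> f a' by (intro C.Cmp_assoc) (simp_all add: hom_iff)
  also have "\<dots> = \<rho> \<cdot> (Fa F (Pr L a) \<cdot> Fa F (sTop R))" by (simp only: Fsq)
  also have "\<dots> = (\<rho> \<cdot> Fa F (Pr L a)) \<cdot> Fa F (sTop R)"
    using \<rho> a a'(4) by (intro C.Cmp_assoc[symmetric]) (simp_all add: hom_iff)
  also have "\<dots> = (Fa G (Pr L a) \<cdot> \<tau>) \<cdot> Fa F (sTop R)" by (simp only: e\<tau>)
  also have "\<dots> = Fa G (Pr L a) \<cdot> (\<tau> \<cdot> Fa F (sTop R))"
    using \<tau> a a'(4) by (intro C.Cmp_assoc) (simp_all add: hom_iff)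
  finally have "sBot (map_square (Fa G) R) \<cdot> (\<sigma> \<cdot> Fa F (Pr L a')) =
      sRgt (map_square (Fa G) R) \<cdot> (\<tau> \<cdot> Fa F (sTop R))" by (simp add: R)
  from pullback_lift[OF GP u v this] obtain \<tau>' where "\<tau>' \<in> hom C (Fo F a') (Src C (sTop (map_square (Fa G) R)))"
    "sLft (map_square (Fa G) R) \<cdot> \<tau>' = \<sigma> \<cdot> Fa F (Pr L a')"
    "sTop (map_square (Fa G) R) \<cdot> \<tau>' = \<tau> \<cdot> Fa F (sTop R)" .
  then have \<tau>': "\<tau>' \<in> hom C (Fo F a') (Fo G a')" "Fa G (Pr L a') \<cdot> \<tau>' = \<sigma> \<cdot> Fa F (Pr L a')"
    "Fa G (sTop R) \<cdot> \<tau>' = \<tau> \<cdot> Fa F (sTop R)" using a' by (simp_all add: hom_iff)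
  let ?S = "\<lparr>sTop = ((a', \<tau>'), (a, \<tau>), sTop R), sBot = h, sLft = ((a', \<tau>'), (b, \<sigma>), Pr L a'), sRgt = e\<rparr>"
  have tA: "((a', \<tau>'), (a, \<tau>), sTop R) \<in> Ar NN" "((a', \<tau>'), (b, \<sigma>), Pr L a') \<in> Ar NN"
    using \<tau>' \<tau> \<sigma> a' L.pr_hom[OF a'(1,2)] by simp_all
  have "comm_square NN ?S"
    unfolding comm_square_def using tA h eA RL by (simp add: hk er)
  moreover have "map_square nt_base ?S = R"
    by (rule square_eqI) (simp_all add: hk er a'(3) R)
  ultimately have SQ: "?S \<in> NQ" using R(1) by (simp add: NQ_def)
  show ?thesis
  proof (rule ex1I)
    show "?S \<in> NQ \<and> sRgt ?S = e \<and> sBot ?S = h" using SQ by simp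
    fix T assume T: "T \<in> NQ \<and> sRgt T = e \<and> sBot T = h"
    then have TQ: "T \<in> NQ" by simp
    from NQ_cases[OF TQ] obtain c \<tau>'' \<rho>'' d \<tau>d \<rho>d f' f'' where
      Te: "T = \<lparr>sTop = ((c, \<tau>''), (d, \<tau>d), f'), sBot = ((Ft L c, \<rho>''), (Ft L d, \<rho>d), f''),
          sLft = ((c, \<tau>''), (Ft L c, \<rho>''), Pr L c), sRgt = ((d, \<tau>d), (Ft L d, \<rho>d), Pr L d)\<rparr>"
      and Q: "\<lparr>sTop = f', sBot = f'', sLft = Pr L c, sRgt = Pr L d\<rparr> \<in> QQ L"
      and c: "c \<in> Ob L" "1 \<le> Len L c"
      and tt: "\<tau>'' \<in> hom C (Fo F c) (Fo G c)"
        "Fa G f' \<cdot> \<tau>'' = \<tau>d \<cdot> Fa F f'" "Fa G (Pr L c) \<cdot> \<tau>'' = \<rho>'' \<cdot> Fa F (Pr L c)" .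
    have d: "d = a" "\<tau>d = \<tau>" "\<rho>d = \<rho>" "f'' = f" "Ft L c = b" "\<rho>'' = \<sigma>"
      using T by (simp_all add: Te er hk)
    have "\<lparr>sTop = f', sBot = f'', sLft = Pr L c, sRgt = Pr L d\<rparr> = R"
      by (rule unR[OF Q]) (simp_all add: d)
    then have ff: "f' = sTop R" "Pr L c = Pr L a'" using a'(3) by auto
    have ca: "c = a'" by (rule L.Pr_inj[OF c a'(1,2) ff(2)])
    have "\<tau>'' = \<tau>'"
    proof (rule C.pullback_unique[OF GP])
      show "\<tau>'' \<in> hom C (Fo F a') (Src C (sTop (map_square (Fa G) R)))" "\<tau>' \<in> hom C (Fo F a') (Src C (sTop (map_square (Fa G) R)))"
        using tt(1) \<tau>'(1) a'(4) by (simp_all add: ca hom_iff)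
      show "sLft (map_square (Fa G) R) \<cdot> \<tau>'' = sLft (map_square (Fa G) R) \<cdot> \<tau>'"
        using tt(3) \<tau>'(2) by (simp add: a'(3) ca d)
      show "sTop (map_square (Fa G) R) \<cdot> \<tau>'' = sTop (map_square (Fa G) R) \<cdot> \<tau>'"
        using tt(2) \<tau>'(3) by (simp add: ff d)
    qed
    then show "T = ?S" by (simp add: Te er hk d(1-4) d(6) ff(1) ca a'(5))
  qed
qed

sublocale N: sort_category NN "(one L, Idn C (one C))" NE NQ
proof (rule sort_category.intro[OF category_NN], unfold_locales)
  interpret N: category NN by (rule category_NN)
  show "terminal NN (one L, Idn C (one C))" by (rule terminal_NN)
  show "e \<in> Ar NN" if "e \<in> NE" for e using that by (simp add: NE_def)
  show "pullback NN S" if "S \<in> NQ" for S by (rule NQ_pullback[OF that])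
  show "sLft S \<in> NE" if S: "S \<in> NQ" for S
  proof -
    have "comm_square NN S" "map_square nt_base S \<in> QQ L" using S by (simp_all add: NQ_def)
    then show ?thesis
      using L.Q_lft comm_squareD(3)[of NN S] unfolding NE_def by fastforce
  qed
  show "\<lparr>sTop = Idn NN (Src NN e), sBot = Idn NN (Tgt NN e), sLft = e, sRgt = e\<rparr> \<in> NQ" if e: "e \<in> NE" for e
  proof -
    from e obtain a where a: "a \<in> Ob L" "1 \<le> Len L a" "nt_base e = Pr L a" and eA: "e \<in> Ar NN" by (auto simp: NE_def)
    from NE_cases[OF eA a] obtain \<tau> \<rho> where er: "e = ((a, \<tau>), (Ft L a, \<rho>), Pr L a)" .
    have "comm_square NN \<lparr>sTop = Idn NN (Src NN e), sBot = Idn NN (Tgt NN e), sLft = e, sRgt = e\<rparr>"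
      using eA by (simp add: comm_square_def)
    then show ?thesis using L.Q_id[OF a(1,2)] by (simp add: NQ_def map_square_def er)
  qed
  show "\<lparr>sTop = sTop T \<cdot>\<^bsub>NN\<^esub> sTop S, sBot = sBot T \<cdot>\<^bsub>NN\<^esub> sBot S, sLft = sLft S, sRgt = sRgt T\<rparr> \<in> NQ"
    if "S \<in> NQ" "T \<in> NQ" "sRgt S = sLft T" for S T
    using that N.comm_square_horizontal[of S T] L.Q_horizontal[of "map_square nt_base S" "map_square nt_base T"]
    unfolding NQ_def by (simp add: map_square_def)
qed (rule NQ_lift; assumption)

section \<open>Natural transformations and models in the inserter\<close>

definition nt_model ::
  "('a, 'b, 'z) ctx_scheme \<Rightarrow> ('a, 'b, 'o, 'm) fctr \<Rightarrow> ('a, 'b, 'p, 'n) ntrans \<Rightarrow>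
   ('a, 'b, 'o \<times> 'n, ('o \<times> 'n) \<times> ('o \<times> 'n) \<times> 'm) fctr" where
  "nt_model B U \<sigma> =
     \<lparr>Fo = (\<lambda>b \<in> Ob B. (Fo U b, NCmp \<sigma> b)),
      Fa = (\<lambda>f \<in> Ar B. ((Fo U (Src B f), NCmp \<sigma> (Src B f)), (Fo U (Tgt B f), NCmp \<sigma> (Tgt B f)), Fa U f))\<rparr>"

lemma nt_model_simps [simp]:
  "b \<in> Ob B \<Longrightarrow> Fo (nt_model B U \<sigma>) b = (Fo U b, NCmp \<sigma> b)"
  "f \<in> Ar B \<Longrightarrow> Fa (nt_model B U \<sigma>) f = ((Fo U (Src B f), NCmp \<sigma> (Src B f)), (Fo U (Tgt B f), NCmp \<sigma> (Tgt B f)), Fa U f)"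
  by (simp_all add: nt_model_def)

definition nt_base_functor :: "('o \<times> 'n, ('o \<times> 'n) \<times> ('o \<times> 'n) \<times> 'm, 'o, 'm) fctr" where
  "nt_base_functor = \<lparr>Fo = restrict fst (Ob NN), Fa = restrict nt_base (Ar NN)\<rparr>"

lemma nt_base_functor: "nt_base_functor \<in> functors NN L"
proof (rule functorsI)
  fix x assume "x \<in> Ob NN"
  then show "Fo nt_base_functor x \<in> Ob L" "Fa nt_base_functor (Idn NN x) = Idn L (Fo nt_base_functor x)"
    using N.Ar_Idn[of x] by (cases x; simp add: nt_base_functor_def hom_iff)+
next
  fix f assume "f \<in> Ar NN"
  then show "Fa nt_base_functor f \<in> hom L (Fo nt_base_functor (Src NN f)) (Fo nt_base_functor (Tgt NN f))"
    by (cases f) (auto simp: nt_base_functor_def hom_iff)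
qed (simp_all add: nt_base_functor_def)

lemma nt_model:
  assumes "precontextual B" and U: "U \<in> ctx_functors B L"
    and \<sigma>: "\<sigma> \<in> hom (disp_fun_cat B C) (comp_fctr B F U) (comp_fctr B G U)"
  shows "nt_model B U \<sigma> \<in> models B NN (one L, Idn C (one C)) NE NQ"
    "comp_fctr B nt_base_functor (nt_model B U \<sigma>) = U"
proof -
  interpret B: precontextual B by fact
  note u = ctx_functorsD[OF U]
  have s: "\<sigma> \<in> Ar (disp_fun_cat B C)" "NDom \<sigma> = comp_fctr B F U" "NCod \<sigma> = comp_fctr B G U"
    using \<sigma> by (simp_all add: disp_hom)
  note D = disp_ArD[OF s(1)]
  let ?T = "nt_model B U \<sigma>"
  have cmp: "NCmp \<sigma> a \<in> hom C (Fo F (Fo U a)) (Fo G (Fo U a))" if "a \<in> Ob B" for a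
    using D(6)[OF that] that by (simp add: s)
  have nat: "Fa G (Fa U f) \<cdot> NCmp \<sigma> (Src B f) = NCmp \<sigma> (Tgt B f) \<cdot> Fa F (Fa U f)" if "f \<in> Ar B" for f
    using D(7)[OF that] that by (simp add: s)
  have F: "?T \<in> functors B NN"
  proof (rule functorsI)
    fix a assume a: "a \<in> Ob B"
    show "Fo ?T a \<in> Ob NN" using cmp[OF a] fctr_Ob[OF u(1) a] a by simp
    show "Fa ?T (Idn B a) = Idn NN (Fo ?T a)" using a by (simp add: fctr_Idn[OF u(1)])
  next
    fix f assume f: "f \<in> Ar B"
    show "Fa ?T f \<in> hom NN (Fo ?T (Src B f)) (Fo ?T (Tgt B f))"
      using cmp[OF B.src_Ob[OF f]] cmp[OF B.tgt_Ob[OF f]] fctr_Ar[OF u(1) f] nat[OF f] f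
      by (simp add: hom_iff[of _ L])
  next
    fix f g assume "f \<in> Ar B" "g \<in> Ar B" "Src B g = Tgt B f"
    then show "Fa ?T (Cmp B g f) = Cmp NN (Fa ?T g) (Fa ?T f)"
      by (simp add: fctr_Cmp[OF u(1)])
  qed (simp_all add: nt_model_def)
  have one: "Fo ?T a = (one L, Idn C (one C))" if a: "a \<in> Ob B" "Len B a = 0" for a
  proof -
    have "Fo U a = one L" using u(2) a fctr_Ob[OF u(1)] by (intro L.one_eqI) simp_all
    moreover from this have "NCmp \<sigma> a = Idn C (one C)"
      using cmp[OF a(1)] FG_one by (intro C.to_one_eq) (auto simp: hom_iff)
    ultimately show ?thesis using a by simp
  qed
  have srt: "Fa ?T (Pr B a) \<in> NE" if a: "a \<in> Ob B" "1 \<le> Len B a" for a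
  proof -
    have "Fa ?T (Pr B a) \<in> Ar NN" by (rule fctr_Ar(1)[OF F B.Ar_Pr[OF a]])
    moreover have "nt_base (Fa ?T (Pr B a)) = Pr L (Fo U a)" using u(4)[OF a] B.Ar_Pr[OF a] by simp
    moreover have "Fo U a \<in> Ob L" "1 \<le> Len L (Fo U a)" using u(2)[OF a(1)] a fctr_Ob[OF u(1)] by simp_all
    ultimately show ?thesis unfolding NE_def by blast
  qed
  have sq: "map_square (Fa ?T) S \<in> NQ" if S: "S \<in> QQ B" for S
  proof -
    have "map_square nt_base (map_square (Fa ?T) S) = map_square (Fa U) S"
      using B.QQ_Ar[OF S] by (intro square_eqI) simp_all
    then show ?thesis
      using functor_comm_square[OF F B.Q_comm[OF S]] u(5)[OF S] unfolding NQ_def by simp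
  qed
  show "?T \<in> models B NN (one L, Idn C (one C)) NE NQ" unfolding models_def using F one srt sq by blast
  show "comp_fctr B nt_base_functor ?T = U"
  proof (rule fctr_eqI[OF B.comp_fctr_functors[OF F nt_base_functor] u(1)])
    fix a assume a: "a \<in> Ob B"
    then show "Fo (comp_fctr B nt_base_functor ?T) a = Fo U a"
      using fctr_Ob[OF F a] by (simp add: nt_base_functor_def)
  next
    fix f assume f: "f \<in> Ar B"
    then show "Fa (comp_fctr B nt_base_functor ?T) f = Fa U f"
      using fctr_Ar(1)[OF F f] by (simp add: nt_base_functor_def)
  qed
qed

definition model_nt :: "('o, 'm, 'o \<times> 'n, ('o \<times> 'n) \<times> ('o \<times> 'n) \<times> 'm) fctr \<Rightarrow> ('o, 'm, 'p, 'n) ntrans" where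
  "model_nt T = \<lparr>NDom = F, NCod = G, NCmp = (\<lambda>a \<in> Ob L. snd (Fo T a))\<rparr>"

text \<open>The components are the second coordinates of the section; they are natural because an
  arrow of the inserter is a naturality square.\<close>

lemma model_nt:
  assumes T: "T \<in> functors L NN" and PT: "comp_fctr L nt_base_functor T = id_fctr L"
  shows "model_nt T \<in> hom (disp_fun_cat L C) F G"
proof -
  let ?\<tau> = "\<lambda>a. snd (Fo T a)"
  have ob: "Fo T a = (a, ?\<tau> a) \<and> ?\<tau> a \<in> hom C (Fo F a) (Fo G a)" if a: "a \<in> Ob L" for a
  proof -
    have "Fo (comp_fctr L nt_base_functor T) a = a" unfolding PT using a by simp
    then have "fst (Fo T a) = a" using fctr_Ob[OF T a] a by (simp add: nt_base_functor_def)
    then show ?thesis using fctr_Ob[OF T a] by (cases "Fo T a") simp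
  qed
  have nat: "Fa G f \<cdot> ?\<tau> (Src L f) = ?\<tau> (Tgt L f) \<cdot> Fa F f" if f: "f \<in> Ar L" for f
  proof -
    have "Fa (comp_fctr L nt_base_functor T) f = f" unfolding PT using f by simp
    then have b: "nt_base (Fa T f) = f" using fctr_Ar(1)[OF T f] f by (simp add: nt_base_functor_def)
    have "Src NN (Fa T f) = (Src L f, ?\<tau> (Src L f))" "Tgt NN (Fa T f) = (Tgt L f, ?\<tau> (Tgt L f))"
      using fctr_Ar(2,3)[OF T f] ob[of "Src L f"] ob[of "Tgt L f"] f by simp_all
    then have e: "Fa T f = ((Src L f, ?\<tau> (Src L f)), (Tgt L f, ?\<tau> (Tgt L f)), f)"
      using b by (cases "Fa T f") simp
    have "((Src L f, ?\<tau> (Src L f)), (Tgt L f, ?\<tau> (Tgt L f)), f) \<in> Ar NN"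
      using fctr_Ar(1)[OF T f] by (subst (asm) e)
    then show ?thesis by simp
  qed
  have cmp: "NCmp (model_nt T) a \<in> hom C (Fo F a) (Fo G a)" if "a \<in> Ob L" for a
    using ob[OF that] that by (simp add: model_nt_def)
  have "model_nt T \<in> Ar (disp_fun_cat L C)"
    unfolding disp_Ar
  proof (intro conjI ballI)
    fix f assume f: "f \<in> Ar L"
    show "comm_square C (natsq L (model_nt T) f)"
      using cmp nat[OF f] f
      by (intro comm_natsqI[OF L.category_axioms functors_FG _ _ f]) (simp_all add: model_nt_def)
  qed (use F_disp G_disp cmp in \<open>simp_all add: model_nt_def\<close>)
  then show ?thesis by (simp add: disp_hom) (simp add: model_nt_def)
qed

end

text \<open>The scheme of \<open>indexed_sort_extension\<close> with the inserter in place of the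
  comma category. Domain and codomain are prescribed, so extensions are compared on components
  alone.\<close>

theorem ntrans_extension:
  fixes A L C :: "('u, 'u) ctx"
  assumes inf: "infinite (UNIV :: 'u set)" and A: "precontextual A" and C: "contextual C"
    and R: "reflection A L \<iota>" and F: "F \<in> Ob (disp_fun_cat L C)" and G: "G \<in> Ob (disp_fun_cat L C)"
    and GP: "\<And>S. S \<in> QQ L \<Longrightarrow> pullback C (map_square (Fa G) S)"
    and \<sigma>: "\<sigma> \<in> hom (disp_fun_cat A C) (comp_fctr A F \<iota>) (comp_fctr A G \<iota>)"
  shows "\<exists>!\<tau>. \<tau> \<in> hom (disp_fun_cat L C) F G \<and> whisker A \<tau> \<iota> = \<sigma>"
proof -
  interpret A: precontextual A by fact
  interpret C: contextual C by fact
  have Lc: "contextual L" and \<iota>: "\<iota> \<in> ctx_functors A L" using R by (simp_all add: reflection_def)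
  interpret L: contextual L by fact
  interpret nt_lift L C F G by unfold_locales (use F G GP in simp_all)
  note i = ctx_functorsD[OF \<iota>]
  have id: "\<exists>f :: 'u \<Rightarrow> 'u. inj f" using inj_on_id by blast
  note pr = ex_inj_prod[OF inf]
  have emb: "\<exists>f :: ('u \<times> 'u) \<times> ('u \<times> 'u) \<times> 'u \<Rightarrow> 'u. inj f"
    by (rule pr[OF pr[OF id id] pr[OF pr[OF id id] id]])
  let ?T = "nt_model A \<iota> \<sigma>"
  note M = nt_model(1)[OF A \<iota> \<sigma>]
  show ?thesis
  proof (rule ex_ex1I)
    have "\<exists>T'. T' \<in> models L NN (one L, Idn C (one C)) NE NQ \<and> comp_fctr A T' \<iota> = ?T \<and> comp_fctr L nt_base_functor T' = id_fctr L"
    proof (rule N.model_extension_over[OF A R inf emb nt_base_functor _ _ _ M nt_model(2)[OF A \<iota> \<sigma>]])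
      show "Fo nt_base_functor (one L, Idn C (one C)) = one L" by (simp add: nt_base_functor_def FG_one hom_iff)
    next
      fix e assume e: "e \<in> NE"
      then obtain a where a: "a \<in> Ob L" "1 \<le> Len L a" "nt_base e = Pr L a" and eA: "e \<in> Ar NN" by (auto simp: NE_def)
      have fe: "Fa nt_base_functor e = Pr L a" using eA a(3) by (simp add: nt_base_functor_def)
      have "Fo nt_base_functor (Src NN e) = a"
        using fctr_Ar(2)[OF nt_base_functor eA] a(1,2) unfolding fe by simp
      then show "1 \<le> Len L (Fo nt_base_functor (Src NN e)) \<and> Fa nt_base_functor e = Pr L (Fo nt_base_functor (Src NN e))"
        using a(2) by (simp add: fe)
    next
      fix S assume S: "S \<in> NQ"
      then have S': "comm_square NN S" "map_square nt_base S \<in> QQ L" by (simp_all add: NQ_def)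
      have "map_square (Fa nt_base_functor) S = map_square nt_base S"
        using comm_squareD[OF S'(1)] by (intro square_eqI) (simp_all add: nt_base_functor_def)
      then show "map_square (Fa nt_base_functor) S \<in> QQ L" using S'(2) by simp
    qed
    then obtain T' where T': "T' \<in> models L NN (one L, Idn C (one C)) NE NQ" "comp_fctr A T' \<iota> = ?T"
      "comp_fctr L nt_base_functor T' = id_fctr L" by blast
    have cmp: "snd (Fo T' (Fo \<iota> a)) = NCmp \<sigma> a" if "a \<in> Ob A" for a
    proof -
      have "Fo (comp_fctr A T' \<iota>) a = Fo ?T a" by (simp only: T'(2))
      then show ?thesis using that by simp
    qed
    have s: "\<sigma> \<in> Ar (disp_fun_cat A C)" "NDom \<sigma> = comp_fctr A F \<iota>" "NCod \<sigma> = comp_fctr A G \<iota>"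
      using \<sigma> by (simp_all add: disp_hom)
    have nc: "compose (Ob A) (NCmp (model_nt T')) (Fo \<iota>) = NCmp \<sigma>"
      by (rule extensionalityI[OF _ disp_ArD(3)[OF s(1)]])
        (auto simp: compose_eq model_nt_def fctr_Ob[OF i(1)] cmp)
    have "whisker A (model_nt T') \<iota> = \<sigma>"
      unfolding whisker_def nc using s by (simp add: model_nt_def)
    then show "\<exists>\<tau>. \<tau> \<in> hom (disp_fun_cat L C) F G \<and> whisker A \<tau> \<iota> = \<sigma>"
      using model_nt[OF modelsD(1)[OF T'(1)] T'(3)] by blast
  next
    fix p q
    assume p: "p \<in> hom (disp_fun_cat L C) F G \<and> whisker A p \<iota> = \<sigma>"
      and q: "q \<in> hom (disp_fun_cat L C) F G \<and> whisker A q \<iota> = \<sigma>"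
    have ids: "comp_fctr L F (id_fctr L) = F" "comp_fctr L G (id_fctr L) = G"
      by (simp_all add: L.comp_fctr_id[OF functors_FG(1)] L.comp_fctr_id[OF functors_FG(2)])
    have mod: "nt_model L (id_fctr L) r \<in> models L NN (one L, Idn C (one C)) NE NQ \<and>
        comp_fctr A (nt_model L (id_fctr L) r) \<iota> = ?T" if r: "r \<in> hom (disp_fun_cat L C) F G \<and> whisker A r \<iota> = \<sigma>" for r
    proof
      show m: "nt_model L (id_fctr L) r \<in> models L NN (one L, Idn C (one C)) NE NQ"
        using r ids by (intro nt_model(1)[OF L.precontextual_axioms L.id_ctx_functors]) simp
      have w: "whisker A r \<iota> = \<sigma>" using r by simp
      show "comp_fctr A (nt_model L (id_fctr L) r) \<iota> = ?T"
      proof (rule fctr_eqI[OF A.comp_fctr_functors[OF i(1) modelsD(1)[OF m]] modelsD(1)[OF M]])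
        fix a assume a: "a \<in> Ob A"
        show "Fo (comp_fctr A (nt_model L (id_fctr L) r) \<iota>) a = Fo ?T a"
          unfolding w[symmetric] using a fctr_Ob[OF i(1) a] by (simp add: whisker_def compose_eq)
      next
        fix f assume f: "f \<in> Ar A"
        show "Fa (comp_fctr A (nt_model L (id_fctr L) r) \<iota>) f = Fa ?T f"
          unfolding w[symmetric] using f fctr_Ar[OF i(1) f] fctr_Ob[OF i(1) A.src_Ob[OF f]] fctr_Ob[OF i(1) A.tgt_Ob[OF f]]
          by (simp add: whisker_def compose_eq)
      qed
    qed
    have "nt_model L (id_fctr L) p = nt_model L (id_fctr L) q"
      using N.model_extension[OF A R inf emb M] mod[OF p] mod[OF q] by blast
    then have e: "Fo (nt_model L (id_fctr L) p) a = Fo (nt_model L (id_fctr L) q) a" for a by simp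
    have cmp: "NCmp p a = NCmp q a" if "a \<in> Ob L" for a using e[of a] that by simp
    have pq: "p \<in> Ar (disp_fun_cat L C)" "q \<in> Ar (disp_fun_cat L C)" "NDom p = NDom q" "NCod p = NCod q"
      using p q by (simp_all add: disp_hom)
    have "NCmp p = NCmp q" by (rule extensionalityI[OF disp_ArD(3)[OF pq(1)] disp_ArD(3)[OF pq(2)] cmp])
    then show "p = q" using pq by simp
  qed
qed

section \<open>The exponential\<close>

lemma category_disp:
  assumes "category A" "contextual C"
  shows "category (disp_fun_cat A C)"
proof -
  interpret A: category A by fact
  interpret C: contextual C by fact
  let ?D = "disp_fun_cat A C"
  have ext: "\<sigma> = \<tau>" if "\<sigma> \<in> Ar ?D" "\<tau> \<in> Ar ?D" "NDom \<sigma> = NDom \<tau>" "NCod \<sigma> = NCod \<tau>"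
    "\<And>a. a \<in> Ob A \<Longrightarrow> NCmp \<sigma> a = NCmp \<tau> a" for \<sigma> \<tau> :: "('a, 'b, 'd, 'e) ntrans"
    using that(3,4) extensionalityI[OF disp_ArD(3)[OF that(1)] disp_ArD(3)[OF that(2)] that(5)] by simp
  have idn: "Idn ?D F \<in> hom ?D F F" if F: "F \<in> Ob ?D" for F
  proof -
    have f: "F \<in> functors A C" using F by (simp add: disp_Ob)
    have "comm_square C (natsq A (Idn ?D F) f)" if "f \<in> Ar A" for f
      using that fctr_Ar[OF f that] fctr_Ob[OF f] by (simp add: comm_square_def)
    then show ?thesis using F fctr_Ob[OF f] by (simp add: disp_hom disp_Ar C.idn_hom)
  qed
  have cmp: "Cmp ?D \<tau> \<sigma> \<in> hom ?D F H" if \<sigma>: "\<sigma> \<in> hom ?D F G" and \<tau>: "\<tau> \<in> hom ?D G H" for F G H \<sigma> \<tau>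
  proof -
    have s: "\<sigma> \<in> Ar ?D" "NDom \<sigma> = F" "NCod \<sigma> = G" and t: "\<tau> \<in> Ar ?D" "NDom \<tau> = G" "NCod \<tau> = H"
      using \<sigma> \<tau> by (simp_all add: disp_hom)
    note S = disp_ArD[OF s(1), unfolded s(2,3)] and T = disp_ArD[OF t(1), unfolded t(2,3)]
    have c: "NCmp (Cmp ?D \<tau> \<sigma>) a \<in> hom C (Fo F a) (Fo H a)" if "a \<in> Ob A" for a
      using C.cmp_hom[OF S(6)[OF that] T(6)[OF that]] that by simp
    have "comm_square C (natsq A (Cmp ?D \<tau> \<sigma>) f)" if f: "f \<in> Ar A" for f
    proof (rule comm_natsqI[OF assms(1) S(4) T(5) _ _ f])
      note h = S(6)[OF A.src_Ob[OF f]] S(6)[OF A.tgt_Ob[OF f]] T(6)[OF A.src_Ob[OF f]] T(6)[OF A.tgt_Ob[OF f]]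
      note a = fctr_Ar[OF S(4) f] fctr_Ar[OF S(5) f] fctr_Ar[OF T(5) f]
      have "Fa H f \<cdot>\<^bsub>C\<^esub> (NCmp \<tau> (Src A f) \<cdot>\<^bsub>C\<^esub> NCmp \<sigma> (Src A f)) = (NCmp \<tau> (Tgt A f) \<cdot>\<^bsub>C\<^esub> Fa G f) \<cdot>\<^bsub>C\<^esub> NCmp \<sigma> (Src A f)"
        using h a by (intro C.Cmp_reassoc T(7)[OF f]) (simp_all add: hom_iff)
      also have "\<dots> = NCmp \<tau> (Tgt A f) \<cdot>\<^bsub>C\<^esub> (Fa G f \<cdot>\<^bsub>C\<^esub> NCmp \<sigma> (Src A f))"
        using h a by (intro C.Cmp_assoc) (simp_all add: hom_iff)
      also have "\<dots> = NCmp \<tau> (Tgt A f) \<cdot>\<^bsub>C\<^esub> (NCmp \<sigma> (Tgt A f) \<cdot>\<^bsub>C\<^esub> Fa F f)" by (simp only: S(7)[OF f])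
      also have "\<dots> = (NCmp \<tau> (Tgt A f) \<cdot>\<^bsub>C\<^esub> NCmp \<sigma> (Tgt A f)) \<cdot>\<^bsub>C\<^esub> Fa F f"
        using h a by (intro C.Cmp_assoc[symmetric]) (simp_all add: hom_iff)
      finally show "Fa H f \<cdot>\<^bsub>C\<^esub> NCmp (Cmp ?D \<tau> \<sigma>) (Src A f) = NCmp (Cmp ?D \<tau> \<sigma>) (Tgt A f) \<cdot>\<^bsub>C\<^esub> Fa F f"
        using f by simp
    qed (use s t c in simp_all)
    then show ?thesis using c S(1) T(2) s t unfolding disp_hom disp_Ar by simp
  qed
  show ?thesis
  proof
    fix \<tau> assume "\<tau> \<in> Ar ?D"
    then show "Src ?D \<tau> \<in> Ob ?D" "Tgt ?D \<tau> \<in> Ob ?D" by (simp_all add: disp_Ar)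
  next
    fix F assume "F \<in> Ob ?D" then show "Idn ?D F \<in> hom ?D F F" by (rule idn)
  next
    fix \<sigma> \<tau> F G H assume "\<sigma> \<in> hom ?D F G" "\<tau> \<in> hom ?D G H"
    then show "Cmp ?D \<tau> \<sigma> \<in> hom ?D F H" by (rule cmp)
  next
    fix \<sigma> F G assume s: "\<sigma> \<in> hom ?D F G"
    then have S: "\<sigma> \<in> Ar ?D" "NDom \<sigma> = F" "NCod \<sigma> = G" by (simp_all add: disp_hom)
    note d = disp_ArD[OF S(1), unfolded S(2,3)]
    have i: "Cmp ?D \<sigma> (Idn ?D F) \<in> hom ?D F G" "Cmp ?D (Idn ?D G) \<sigma> \<in> hom ?D F G"
      by (rule cmp[OF idn[OF d(1)] s], rule cmp[OF s idn[OF d(2)]])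
    show "Cmp ?D \<sigma> (Idn ?D F) = \<sigma>"
      by (rule ext) (use i S d(6) in \<open>simp_all add: disp_hom hom_iff[of _ C]\<close>)
    show "Cmp ?D (Idn ?D G) \<sigma> = \<sigma>"
      by (rule ext) (use i S d(6) in \<open>simp_all add: disp_hom hom_iff[of _ C]\<close>)
  next
    fix \<sigma> \<tau> \<upsilon> F G H K assume h: "\<sigma> \<in> hom ?D F G" "\<tau> \<in> hom ?D G H" "\<upsilon> \<in> hom ?D H K"
    then have S: "\<sigma> \<in> Ar ?D" "NDom \<sigma> = F" "NCod \<sigma> = G" "\<tau> \<in> Ar ?D" "NDom \<tau> = G" "NCod \<tau> = H"
      "\<upsilon> \<in> Ar ?D" "NDom \<upsilon> = H" "NCod \<upsilon> = K" by (simp_all add: disp_hom)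
    have "NCmp \<upsilon> a \<cdot>\<^bsub>C\<^esub> (NCmp \<tau> a \<cdot>\<^bsub>C\<^esub> NCmp \<sigma> a) = (NCmp \<upsilon> a \<cdot>\<^bsub>C\<^esub> NCmp \<tau> a) \<cdot>\<^bsub>C\<^esub> NCmp \<sigma> a" if "a \<in> Ob A" for a
      using disp_ArD(6)[OF S(1) that] disp_ArD(6)[OF S(4) that] disp_ArD(6)[OF S(7) that] S
      by (intro C.cmp_assoc) auto
    then show "Cmp ?D \<upsilon> (Cmp ?D \<tau> \<sigma>) = Cmp ?D (Cmp ?D \<upsilon> \<tau>) \<sigma>" by (auto simp: fun_eq_iff)
  qed
qed

lemma const_one_disp:
  assumes "precontextual A" "contextual C"
  shows "const_one A C \<in> Ob (disp_fun_cat A C)"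
proof -
  interpret A: precontextual A by fact
  interpret C: contextual C by fact
  have "const_one A C \<in> functors A C"
    by (rule functorsI) (auto simp: const_one_def hom_iff)
  then show ?thesis by (auto simp: disp_Ob const_one_def A.displays_Ar intro: displays_id)
qed

lemma chain_top_disp:
  assumes "precontextual A" "contextual C" "is_chain A C xs"
  shows "chain_top A C xs \<in> Ob (disp_fun_cat A C)"
  using assms const_one_disp[OF assms(1,2)]
  by (cases xs) (auto dest: indexed_sortD(1) disp_ArD(1))

lemma exponential_simps [simp]:
  "Ob (exponential A C) = {xs. is_chain A C xs}"
  "f \<in> Ar (exponential A C) \<longleftrightarrow> is_chain A C (XSrc f) \<and> is_chain A C (XTgt f) \<and>
     XNt f \<in> hom (disp_fun_cat A C) (chain_top A C (XSrc f)) (chain_top A C (XTgt f))"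
  "Src (exponential A C) = XSrc" "Tgt (exponential A C) = XTgt"
  "Idn (exponential A C) xs = \<lparr>XSrc = xs, XTgt = xs, XNt = Idn (disp_fun_cat A C) (chain_top A C xs)\<rparr>"
  "Cmp (exponential A C) g f = \<lparr>XSrc = XSrc f, XTgt = XTgt g, XNt = Cmp (disp_fun_cat A C) (XNt g) (XNt f)\<rparr>"
  "Len (exponential A C) = length" "Ft (exponential A C) = tl" "Pr (exponential A C) = chain_proj"
  by (simp_all add: exponential_def chain_cat_def)

lemma exponential_comm: "comm_square (chain_cat A C) S \<longleftrightarrow> comm_square (exponential A C) S"
  by (simp add: comm_square_def exponential_def)

lemma exponential_QQ: "S \<in> QQ (exponential A C) \<longleftrightarrow> comm_square (exponential A C) S \<and>
     (\<exists>xs. is_chain A C xs \<and> 1 \<le> length xs \<and> sLft S = chain_proj xs) \<and>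
     (\<exists>ys. is_chain A C ys \<and> 1 \<le> length ys \<and> sRgt S = chain_proj ys) \<and>
     indexed_distinguished A C (map_square XNt S)"
  by (simp add: exponential_comm[symmetric]) (simp add: exponential_def)

lemma exponential_hom: "f \<in> hom (exponential A C) xs ys \<longleftrightarrow> is_chain A C xs \<and> is_chain A C ys \<and>
    XSrc f = xs \<and> XTgt f = ys \<and> XNt f \<in> hom (disp_fun_cat A C) (chain_top A C xs) (chain_top A C ys)"
  by (auto simp: hom_iff[of _ "exponential A C"])

lemma chain_proj_hom:
  assumes "is_chain A C xs" "1 \<le> length xs"
  shows "chain_proj xs \<in> hom (exponential A C) xs (tl xs)"
  using assms by (cases xs) (auto simp: exponential_hom chain_proj_def disp_hom dest: indexed_sortD(1))

lemma chain_tl: "is_chain A C xs \<Longrightarrow> is_chain A C (tl xs)"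
  by (cases xs) auto

lemma precontextual_exponential:
  assumes A: "precontextual A" and C: "contextual C"
  shows "precontextual (exponential A C)"
proof -
  let ?X = "exponential A C"
  interpret A: precontextual A by fact
  interpret D: category "disp_fun_cat A C" by (rule category_disp[OF A.category_axioms C])
  note top = chain_top_disp[OF A C]
  \<comment> \<open>Identities and composites of natural transformations stay folded, so that the
    laws follow from those of \<open>disp_fun_cat\<close>.\<close>
  note [simp del] = disp_simps
  show ?thesis
  proof
    fix f assume "f \<in> Ar ?X" then show "Src ?X f \<in> Ob ?X" "Tgt ?X f \<in> Ob ?X" by simp_all
  next
    fix a assume "a \<in> Ob ?X"
    then show "Idn ?X a \<in> hom ?X a a" using D.idn_hom[OF top] by (simp add: exponential_hom)
  next
    fix f g a b c assume "f \<in> hom ?X a b" "g \<in> hom ?X b c"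
    then show "Cmp ?X g f \<in> hom ?X a c" using D.cmp_hom by (auto simp: exponential_hom)
  next
    fix f a b assume "f \<in> hom ?X a b"
    then show "Cmp ?X f (Idn ?X a) = f" "Cmp ?X (Idn ?X b) f = f"
      using D.cmp_idn D.idn_cmp by (auto simp: exponential_hom)
  next
    fix f g h a b c d assume "f \<in> hom ?X a b" "g \<in> hom ?X b c" "h \<in> hom ?X c d"
    then show "Cmp ?X h (Cmp ?X g f) = Cmp ?X (Cmp ?X h g) f"
      using D.cmp_assoc by (auto simp: exponential_hom)
  next
    fix a assume "a \<in> Ob ?X"
    then show "Ft ?X a \<in> Ob ?X" "Len ?X (Ft ?X a) = Len ?X a - 1" "Len ?X a = 0 \<Longrightarrow> Ft ?X a = a"
      "1 \<le> Len ?X a \<Longrightarrow> Pr ?X a \<in> hom ?X a (Ft ?X a)"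
      using chain_tl chain_proj_hom[of A C a] by auto
  next
    fix S assume "S \<in> QQ ?X"
    note S = this[unfolded exponential_QQ]
    from S show "comm_square ?X S" by (rule conjunct1)
    from S show "\<exists>a\<in>Ob ?X. 1 \<le> Len ?X a \<and> sLft S = Pr ?X a"
      "\<exists>b\<in>Ob ?X. 1 \<le> Len ?X b \<and> sRgt S = Pr ?X b" by simp_all
  qed
qed

lemma XNt_comm_square:
  assumes "comm_square (exponential A C) S"
  shows "comm_square (disp_fun_cat A C) (map_square XNt S)"
proof -
  note c = comm_squareD[OF assms]
  have h: "XNt f \<in> Ar (disp_fun_cat A C) \<and> NDom (XNt f) = chain_top A C (XSrc f) \<and> NCod (XNt f) = chain_top A C (XTgt f)"
    if "f \<in> Ar (exponential A C)" for f using that by (simp add: disp_hom)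
  have e: "XNt (Cmp (exponential A C) (sRgt S) (sTop S)) = XNt (Cmp (exponential A C) (sBot S) (sLft S))"
    by (simp only: c(9))
  show ?thesis
    unfolding comm_square_def
    using h[OF c(1)] h[OF c(2)] h[OF c(3)] h[OF c(4)] c(5-8) e by (simp del: disp_simps(3,4))
qed

subsection \<open>Precomposition\<close>

context precontextual
begin

lemma ctx_functor_displays:
  assumes "contextual L" "U \<in> ctx_functors C L" "f \<in> displays C"
  shows "Fa U f \<in> displays L"
proof -
  interpret L: contextual L by fact
  note u = ctx_functorsD[OF assms(2)]
  show ?thesis
  proof (rule preserves_displaysI[OF precontextual_axioms L.precontextual_axioms u(1) _ assms(3)])
    fix a assume "a \<in> Ob C" "1 \<le> Len C a"
    then show "Fa U (Pr C a) \<in> displays L"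
      using u(2,4) fctr_Ob[OF u(1)] by (simp add: L.Pr_displays)
  qed
qed

end

text \<open>Precomposition with an arbitrary contextual functor \<open>U\<close>; the universal
  property of \<open>\<iota>\<close> enters afterwards, when it is inverted.\<close>

locale precomposition = A: precontextual A + L: contextual L + C: contextual C
  for A :: "('a, 'b, 'x) ctx_scheme" and L :: "('q, 'k, 'y) ctx_scheme" and C :: "('p, 'n, 'z) ctx_scheme" +
  fixes U :: "('a, 'b, 'q, 'k) fctr"
  assumes U: "U \<in> ctx_functors A L"
begin

lemmas u = ctx_functorsD[OF U]
lemmas uAr [simp] = fctr_Ar[OF u(1)]
lemmas uOb [simp] = fctr_Ob[OF u(1)]

abbreviation "w \<pi> \<equiv> whisker A \<pi> U"

lemma whisker_simps [simp]:
  "NDom (w \<tau>) = comp_fctr A (NDom \<tau>) U" "NCod (w \<tau>) = comp_fctr A (NCod \<tau>) U"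
  "a \<in> Ob A \<Longrightarrow> NCmp (w \<tau>) a = NCmp \<tau> (Fo U a)"
  by (simp_all add: whisker_def compose_eq)

lemma natsq_whisker: "f \<in> Ar A \<Longrightarrow> natsq A (w \<tau>) f = natsq L \<tau> (Fa U f)"
  by (simp add: natsq_def)

lemma comp_disp: "F \<in> Ob (disp_fun_cat L C) \<Longrightarrow> comp_fctr A F U \<in> Ob (disp_fun_cat A C)"
  using A.comp_fctr_functors[OF u(1), of F C] A.ctx_functor_displays[OF L.contextual_axioms U]
  by (simp add: disp_Ob A.displays_Ar u(2))

lemma whisker_Ar:
  assumes "\<tau> \<in> Ar (disp_fun_cat L C)"
  shows "w \<tau> \<in> Ar (disp_fun_cat A C)"
  using disp_ArD[OF assms] unfolding disp_Ar
  by (simp add: comp_disp natsq_whisker) (simp add: whisker_def)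

lemma whisker_hom: "\<tau> \<in> hom (disp_fun_cat L C) F G \<Longrightarrow> w \<tau> \<in> hom (disp_fun_cat A C) (comp_fctr A F U) (comp_fctr A G U)"
  by (simp add: disp_hom whisker_Ar)

text \<open>Naturality squares of \<open>w \<pi>\<close> are those of \<open>\<pi>\<close> at images
  under \<open>U\<close>, and \<open>U\<close> preserves projections and \<open>QQ\<close>; each
  clause is an instance of the clause over \<open>L\<close>.\<close>

lemma whisker_indexed_sort:
  assumes "indexed_sort L C \<pi>"
  shows "indexed_sort A C (w \<pi>)"
proof -
  note p = indexed_sortD[OF assms]
  show ?thesis
    unfolding indexed_sort_def Let_def
  proof (intro conjI ballI impI)
    show "w \<pi> \<in> Ar (disp_fun_cat A C)" by (rule whisker_Ar[OF p(1)])
    fix a assume a: "a \<in> Ob A" "1 \<le> Len A a"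
    show "rel_display1 C (natsq A (w \<pi>) (Pr A a))"
      using p(2)[of "Fo U a"] a u(2)[of a] u(4)[OF a] by (simp add: natsq_whisker)
  next
    fix S assume S: "S \<in> QQ A"
    show "\<lparr>sTop = Fa (NDom (w \<pi>)) (sTop S),
       sBot = corner_map C (natsq A (w \<pi>) (sLft S)) (natsq A (w \<pi>) (sRgt S)) (Fa (NDom (w \<pi>)) (sBot S)) (Fa (NCod (w \<pi>)) (sTop S)),
       sLft = gap C (natsq A (w \<pi>) (sLft S)), sRgt = gap C (natsq A (w \<pi>) (sRgt S))\<rparr> \<in> distinguished C"
      using p(3)[OF u(5)[OF S]] A.QQ_Ar[OF S] by (simp add: natsq_whisker)
  qed
qed

lemma const_one_comp: "comp_fctr A (const_one L C) U = const_one A C"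
proof -
  have "const_one L C \<in> functors L C" "const_one A C \<in> functors A C"
    using const_one_disp[OF L.precontextual_axioms C.contextual_axioms]
      const_one_disp[OF A.precontextual_axioms C.contextual_axioms] by (simp_all add: disp_Ob)
  then show ?thesis
    by (intro fctr_eqI[OF A.comp_fctr_functors[OF u(1)]]) (auto simp: const_one_def)
qed

lemma chain_top_whisker: "chain_top A C (map w xs) = comp_fctr A (chain_top L C xs) U"
  by (cases xs) (simp_all add: const_one_comp)

lemma is_chain_whisker: "is_chain L C xs \<Longrightarrow> is_chain A C (map w xs)"
  by (induction xs) (simp_all add: whisker_indexed_sort chain_top_whisker)

abbreviation "EE \<equiv> exponential_map A L C U"

lemma EE_simps [simp]:
  "is_chain L C xs \<Longrightarrow> Fo EE xs = map w xs"
  "f \<in> Ar (exponential L C) \<Longrightarrow> Fa EE f = \<lparr>XSrc = map w (XSrc f), XTgt = map w (XTgt f), XNt = w (XNt f)\<rparr>"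
  by (simp_all add: exponential_map_def Let_def del: exponential_simps(2)) 

lemma EE_functor: "EE \<in> functors (exponential L C) (exponential A C)"
proof -
  interpret X: precontextual "exponential L C"
    by (rule precontextual_exponential[OF L.precontextual_axioms C.contextual_axioms])
  show ?thesis
  proof (rule functorsI)
    show "Fo EE \<in> extensional (Ob (exponential L C))" "Fa EE \<in> extensional (Ar (exponential L C))"
      by (simp_all add: exponential_map_def Let_def)
  next
    fix xs assume xs: "xs \<in> Ob (exponential L C)"
    then have c: "is_chain L C xs" by simp
    then show "Fo EE xs \<in> Ob (exponential A C)" by (simp add: is_chain_whisker)
    have F: "chain_top L C xs \<in> functors L C"
      using chain_top_disp[OF L.precontextual_axioms C.contextual_axioms c] by (simp add: disp_Ob)
    have "w (Idn (disp_fun_cat L C) (chain_top L C xs)) = Idn (disp_fun_cat A C) (comp_fctr A (chain_top L C xs) U)"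
      by (simp add: whisker_def compose_def fun_eq_iff)
    then show "Fa EE (Idn (exponential L C) xs) = Idn (exponential A C) (Fo EE xs)"
      using X.Ar_Idn[OF xs] c by (simp add: chain_top_whisker del: exponential_simps(2) disp_simps)
  next
    fix f assume f: "f \<in> Ar (exponential L C)"
    then show "Fa EE f \<in> hom (exponential A C) (Fo EE (Src (exponential L C) f)) (Fo EE (Tgt (exponential L C) f))"
      using whisker_hom[of "XNt f"] by (simp add: EE_simps(2)[OF f] exponential_hom is_chain_whisker chain_top_whisker)
  next
    fix f g assume fg: "f \<in> Ar (exponential L C)" "g \<in> Ar (exponential L C)" "Src (exponential L C) g = Tgt (exponential L C) f"
    have "w (Cmp (disp_fun_cat L C) (XNt g) (XNt f)) = Cmp (disp_fun_cat A C) (w (XNt g)) (w (XNt f))"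
      by (simp add: whisker_def compose_def fun_eq_iff)
    then show "Fa EE (Cmp (exponential L C) g f) = Cmp (exponential A C) (Fa EE g) (Fa EE f)"
      using X.Ar_Cmp[OF fg] fg by (simp del: exponential_simps(2) disp_simps)
  qed
qed

lemma EE_chain_proj:
  assumes "is_chain L C xs" "1 \<le> length xs"
  shows "Fa EE (chain_proj xs) = chain_proj (map w xs)"
proof -
  have "chain_proj xs \<in> Ar (exponential L C)" using chain_proj_hom[OF assms] by (simp only: hom_iff)
  then show ?thesis using assms by (cases xs) (simp_all add: chain_proj_def del: exponential_simps(2))
qed

lemma XNt_EE:
  assumes "comm_square (exponential L C) S"
  shows "map_square XNt (map_square (Fa EE) S) = map_square w (map_square XNt S)"
  using comm_squareD[OF assms] by (intro square_eqI) (simp_all del: exponential_simps(2))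

text \<open>The clause of \<open>indexed_distinguished\<close> at a single object, isolated so that
  it can be moved along \<open>U\<close> and serve as the predicate of an induction over
  objects.\<close>

definition (in -) fibre_square ::
  "('o, 'm, 'x) ctx_scheme \<Rightarrow> ('p, 'n, 'y) ctx_scheme \<Rightarrow> ('o, 'm, 'p, 'n) ntrans square \<Rightarrow> 'o \<Rightarrow> 'n square" where
  "fibre_square A C S a =
     \<lparr>sTop = NCmp (sTop S) a,
      sBot = corner_map C (natsq A (sLft S) (Pr A a)) (natsq A (sRgt S) (Pr A a)) (NCmp (sTop S) (Ft A a)) (NCmp (sBot S) a),
      sLft = gap C (natsq A (sLft S) (Pr A a)),
      sRgt = gap C (natsq A (sRgt S) (Pr A a))\<rparr>"

lemma (in -) indexed_distinguished_iff:
  "indexed_distinguished A C S \<longleftrightarrow> comm_square (disp_fun_cat A C) S \<and>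
     indexed_sort A C (sLft S) \<and> indexed_sort A C (sRgt S) \<and>
     (\<forall>a \<in> Ob A. 1 \<le> Len A a \<longrightarrow> fibre_square A C S a \<in> distinguished C)"
  by (simp add: indexed_distinguished_def fibre_square_def Let_def)

text \<open>\<open>U\<close> commutes with \<open>Pr\<close> and \<open>Ft\<close>, so the two
  squares have the same entries. Preservation of \<open>QQ\<close> follows at once, and its
  reflection is reduced to the objects outside the image of \<open>U\<close>.\<close>

lemma fibre_square_whisker:
  "a \<in> Ob A \<Longrightarrow> 1 \<le> Len A a \<Longrightarrow> fibre_square A C (map_square w S) a = fibre_square L C S (Fo U a)"
  using u(4)[of a] by (simp add: fibre_square_def natsq_whisker A.ft_Ob u(3))

lemma EE_ctx_functor: "EE \<in> ctx_functors (exponential L C) (exponential A C)"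
  unfolding ctx_functors_def
proof (intro CollectI conjI ballI impI EE_functor)
  fix xs assume "xs \<in> Ob (exponential L C)"
  then have c: "is_chain L C xs" by simp
  then show "Len (exponential A C) (Fo EE xs) = Len (exponential L C) xs"
    "Fo EE (Ft (exponential L C) xs) = Ft (exponential A C) (Fo EE xs)"
    using chain_tl[OF c] by (simp_all add: map_tl)
  show "Fa EE (Pr (exponential L C) xs) = Pr (exponential A C) (Fo EE xs)" if "1 \<le> Len (exponential L C) xs"
    using EE_chain_proj[OF c] that c by simp
next
  fix S assume "S \<in> QQ (exponential L C)"
  then have cS: "comm_square (exponential L C) S"
    and l: "\<exists>xs. is_chain L C xs \<and> 1 \<le> length xs \<and> sLft S = chain_proj xs"
    and r: "\<exists>ys. is_chain L C ys \<and> 1 \<le> length ys \<and> sRgt S = chain_proj ys"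
    and d: "indexed_distinguished L C (map_square XNt S)"
    by (simp_all add: exponential_QQ)
  have c: "comm_square (exponential A C) (map_square (Fa EE) S)" by (rule functor_comm_square[OF EE_functor cS])
  have "indexed_distinguished A C (map_square XNt (map_square (Fa EE) S))"
    using XNt_comm_square[OF c] d u(2) unfolding XNt_EE[OF cS] indexed_distinguished_iff
    by (simp add: whisker_indexed_sort fibre_square_whisker)
  moreover have "\<exists>xs. is_chain A C xs \<and> 1 \<le> length xs \<and> Fa EE e = chain_proj xs"
    if "\<exists>xs. is_chain L C xs \<and> 1 \<le> length xs \<and> e = chain_proj xs" for e
  proof -
    from that obtain xs where "is_chain L C xs" "1 \<le> length xs" "e = chain_proj xs" by blast
    then show ?thesis using EE_chain_proj[of xs] is_chain_whisker[of xs] by (intro exI[of _ "map w xs"]) simp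
  qed
  ultimately show "map_square (Fa EE) S \<in> QQ (exponential A C)"
    using c l r by (simp add: exponential_QQ)
qed

end

section \<open>Preservation of pullbacks along chains of indexed sorts\<close>

context display_functor
begin

text \<open>
  Apply the pullback property of squares of the comma category to an object over the top left
  corner of \<open>S\<close>.
\<close>

lemma indexed_sort_pullback:
  assumes \<pi>: "indexed_sort L C \<pi>" "NCod \<pi> = F"
    and FP: "pullback C (map_square (Fa F) S)" and S: "S \<in> QQ L"
  shows "pullback C (map_square (Fa (NDom \<pi>)) S)"
proof -
  let ?G = "NDom \<pi>" and ?T = "sort_model L (id_fctr L) \<pi>"
  note D = disp_ArD[OF indexed_sortD(1)[OF \<pi>(1)], unfolded \<pi>(2)]
  have cod: "NCod \<pi> = comp_fctr L F (id_fctr L)" by (simp add: \<pi>(2) L.comp_fctr_id[OF F_functor])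
  have KP: "pullback KK (map_square (Fa ?T) S)"
    by (intro K.square_pullback modelsD(4)[OF sort_model[OF L.precontextual_axioms L.id_ctx_functors \<pi>(1) cod]] S)
  obtain a' a where a: "a' \<in> Ob L" "a \<in> Ob L" "sLft S \<in> hom L a' (Ft L a')" "sRgt S \<in> hom L a (Ft L a)"
    "sTop S \<in> hom L a' a" "sBot S \<in> hom L (Ft L a') (Ft L a)"
    using L.QQ_cases[OF S] L.pr_hom by metis
  let ?b' = "Ft L a'" and ?b = "Ft L a"
  let ?p = "NCmp \<pi>"
  have ob: "?b' \<in> Ob L" "?b \<in> Ob L" using a L.ft_Ob by simp_all
  note p = D(6)[OF a(1)] D(6)[OF a(2)] D(6)[OF ob(1)] D(6)[OF ob(2)]
  have T: "Fa ?T f = ((x, ?p x), (y, ?p y), f, Fa ?G f)" if "f \<in> hom L x y" for f x y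
    using that by (auto simp: hom_iff)
  note Ts = T[OF a(3)] T[OF a(4)] T[OF a(5)] T[OF a(6)]
  have Gh: "Fa ?G f \<in> hom C (Fo ?G x) (Fo ?G y)" and Fh: "Fa F f \<in> hom C (Fo F x) (Fo F y)"
    and nat: "Fa F f \<cdot> ?p x = ?p y \<cdot> Fa ?G f" if "f \<in> hom L x y" for f x y
    using fctr_hom[OF D(4) that] fctr_hom[OF F_functor that] D(7)[of f] that by (auto simp: hom_iff)
  note G = Gh[OF a(3)] Gh[OF a(4)] Gh[OF a(5)] Gh[OF a(6)]
  note F' = Fh[OF a(3)] Fh[OF a(4)] Fh[OF a(5)] Fh[OF a(6)]
  show ?thesis
  proof (rule C.pullbackI)
    show "comm_square C (map_square (Fa ?G) S)" by (rule functor_comm_square[OF D(4) L.Q_comm[OF S]])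
  next
    fix z s v assume "s \<in> hom C z (Src C (sBot (map_square (Fa ?G) S)))" "v \<in> hom C z (Src C (sRgt (map_square (Fa ?G) S)))"
      "sBot (map_square (Fa ?G) S) \<cdot> s = sRgt (map_square (Fa ?G) S) \<cdot> v"
    then have s: "s \<in> hom C z (Fo ?G ?b')" and v: "v \<in> hom C z (Fo ?G a)"
      and sv: "Fa ?G (sBot S) \<cdot> s = Fa ?G (sRgt S) \<cdot> v" using G by (simp_all add: hom_iff)
    have "Fa F (sBot S) \<cdot> (?p ?b' \<cdot> s) = (?p ?b \<cdot> Fa ?G (sBot S)) \<cdot> s"
      using s p(3) F'(4) by (intro C.Cmp_reassoc nat[OF a(6)]) (simp_all add: hom_iff)
    also have "\<dots> = ?p ?b \<cdot> (Fa ?G (sBot S) \<cdot> s)"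
      using s p(4) G(4) by (intro C.Cmp_assoc) (simp_all add: hom_iff)
    also have "\<dots> = ?p ?b \<cdot> (Fa ?G (sRgt S) \<cdot> v)" by (simp only: sv)
    also have "\<dots> = (?p ?b \<cdot> Fa ?G (sRgt S)) \<cdot> v"
      using v p(4) G(2) by (intro C.Cmp_assoc[symmetric]) (simp_all add: hom_iff)
    also have "\<dots> = Fa F (sRgt S) \<cdot> (?p a \<cdot> v)"
      using v p(2) F'(2) by (intro C.Cmp_reassoc[symmetric] nat[OF a(4)]) (simp_all add: hom_iff)
    finally have "sBot (map_square (Fa F) S) \<cdot> (?p ?b' \<cdot> s) = sRgt (map_square (Fa F) S) \<cdot> (?p a \<cdot> v)" by simp
    moreover have "?p ?b' \<cdot> s \<in> hom C z (Src C (sBot (map_square (Fa F) S)))" "?p a \<cdot> v \<in> hom C z (Src C (sRgt (map_square (Fa F) S)))"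
      using s v p F' by (simp_all add: hom_iff)
    \<comment> \<open>The vertex \<open>z\<close> of the cone has no arrow to the image of
      \<open>a'\<close> under \<open>F\<close> yet. The pullback under \<open>F\<close> supplies
      one, and \<open>z\<close> becomes an object of the comma category over
      \<open>a'\<close>.\<close>
    ultimately obtain \<zeta> where "\<zeta> \<in> hom C z (Src C (sTop (map_square (Fa F) S)))"
      "sLft (map_square (Fa F) S) \<cdot> \<zeta> = ?p ?b' \<cdot> s" "sTop (map_square (Fa F) S) \<cdot> \<zeta> = ?p a \<cdot> v"
      using pullback_lift[OF FP] by metis
    then have \<zeta>: "\<zeta> \<in> hom C z (Fo F a')" "Fa F (sLft S) \<cdot> \<zeta> = ?p ?b' \<cdot> s"
      "Fa F (sTop S) \<cdot> \<zeta> = ?p a \<cdot> v" using F' by (simp_all add: hom_iff)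
    let ?s = "((a', \<zeta>), (?b', ?p ?b'), sLft S, s)" and ?v = "((a', \<zeta>), (a, ?p a), sTop S, v)"
    have "?s \<in> hom KK (a', \<zeta>) (Src KK (sBot (map_square (Fa ?T) S)))" "?v \<in> hom KK (a', \<zeta>) (Src KK (sRgt (map_square (Fa ?T) S)))"
      using \<zeta> s v p a by (simp_all add: Ts hom_iff[of _ C])
    moreover have "sBot (map_square (Fa ?T) S) \<cdot>\<^bsub>KK\<^esub> ?s = sRgt (map_square (Fa ?T) S) \<cdot>\<^bsub>KK\<^esub> ?v"
      using sv comm_squareD(9)[OF L.Q_comm[OF S]] by (simp add: Ts)
    ultimately obtain h where h: "h \<in> hom KK (a', \<zeta>) (Src KK (sTop (map_square (Fa ?T) S)))"
      "sLft (map_square (Fa ?T) S) \<cdot>\<^bsub>KK\<^esub> h = ?s" "sTop (map_square (Fa ?T) S) \<cdot>\<^bsub>KK\<^esub> h = ?v"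
      using pullback_lift[OF KP] by metis
    from h(1) have "h \<in> hom KK (a', \<zeta>) (a', ?p a')" by (simp add: Ts)
    from KK_homE[OF this] obtain f k where hk: "h = ((a', \<zeta>), (a', ?p a'), f, k)" "k \<in> hom C (Src C \<zeta>) (Src C (?p a'))" .
    have "k \<in> hom C z (Src C (sTop (map_square (Fa ?G) S)))" using hk(2) \<zeta>(1) p(1) G(3) by (simp add: hom_iff)
    moreover have "Fa ?G (sLft S) \<cdot> k = s" "Fa ?G (sTop S) \<cdot> k = v" using h(2,3) by (simp_all add: Ts hk(1))
    ultimately show "\<exists>h. h \<in> hom C z (Src C (sTop (map_square (Fa ?G) S))) \<and> sLft (map_square (Fa ?G) S) \<cdot> h = s \<and>
        sTop (map_square (Fa ?G) S) \<cdot> h = v" by (intro exI[of _ k]) simp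
  next
    fix z h k assume "h \<in> hom C z (Src C (sTop (map_square (Fa ?G) S)))" "k \<in> hom C z (Src C (sTop (map_square (Fa ?G) S)))"
      "sLft (map_square (Fa ?G) S) \<cdot> h = sLft (map_square (Fa ?G) S) \<cdot> k"
      "sTop (map_square (Fa ?G) S) \<cdot> h = sTop (map_square (Fa ?G) S) \<cdot> k"
    then have h: "h \<in> hom C z (Fo ?G a')" and k: "k \<in> hom C z (Fo ?G a')"
      and e: "Fa ?G (sLft S) \<cdot> h = Fa ?G (sLft S) \<cdot> k" "Fa ?G (sTop S) \<cdot> h = Fa ?G (sTop S) \<cdot> k"
      using G by (simp_all add: hom_iff)
    have post: "Fa F f \<cdot> (?p a' \<cdot> h) = Fa F f \<cdot> (?p a' \<cdot> k)"
      if f: "f \<in> hom L a' y" and e: "Fa ?G f \<cdot> h = Fa ?G f \<cdot> k" for f y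
    proof -
      have y: "?p y \<in> hom C (Fo ?G y) (Fo F y)" using f by (intro D(6)) (auto simp: hom_iff)
      have "Fa F f \<cdot> (?p a' \<cdot> j) = ?p y \<cdot> (Fa ?G f \<cdot> j)" if j: "j \<in> hom C z (Fo ?G a')" for j
        using C.Cmp_reassoc[OF nat[OF f], of j] C.Cmp_assoc[of j "Fa ?G f" "?p y"] j p(1) y Gh[OF f] Fh[OF f]
        by (simp add: hom_iff)
      from this[OF h] this[OF k] show ?thesis using e by simp
    qed
    have pe: "?p a' \<cdot> h = ?p a' \<cdot> k"
    proof (rule C.pullback_unique[OF FP])
      show "?p a' \<cdot> h \<in> hom C z (Src C (sTop (map_square (Fa F) S)))" "?p a' \<cdot> k \<in> hom C z (Src C (sTop (map_square (Fa F) S)))"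
        using h k p(1) F'(3) by (simp_all add: hom_iff)
    qed (use post[OF a(3) e(1)] post[OF a(5) e(2)] in simp_all)
    \<comment> \<open>By \<open>pe\<close> both \<open>h\<close> and \<open>k\<close> are arrows of
      the comma category out of the same object over \<open>a'\<close>, with identity base, so its
      pullback property can compare them.\<close>
    let ?\<zeta> = "?p a' \<cdot> h"
    have "((a', ?\<zeta>), (a', ?p a'), Idn L a', h) = ((a', ?\<zeta>), (a', ?p a'), Idn L a', k)"
    proof (rule K.pullback_unique[OF KP])
      have id: "Idn L a' \<in> hom L a' a'" by (rule L.idn_hom[OF a(1)])
      have Fi: "Fa F (Idn L a') \<cdot> ?\<zeta> = ?\<zeta>" using a(1) h p(1) by (simp add: hom_iff)
      have z: "?\<zeta> \<in> hom C z (Fo F a')" using h p(1) by (simp add: hom_iff)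
      have m: "((a', ?\<zeta>), (a', ?p a'), Idn L a', h) \<in> hom KK (a', ?\<zeta>) (a', ?p a')"
        "((a', ?\<zeta>), (a', ?p a'), Idn L a', k) \<in> hom KK (a', ?\<zeta>) (a', ?p a')"
        unfolding KK_hom Fi using id z h k p(1) pe by (simp_all add: hom_iff[of _ C])
      from m show "((a', ?\<zeta>), (a', ?p a'), Idn L a', h) \<in> hom KK (a', ?\<zeta>) (Src KK (sTop (map_square (Fa ?T) S)))"
        "((a', ?\<zeta>), (a', ?p a'), Idn L a', k) \<in> hom KK (a', ?\<zeta>) (Src KK (sTop (map_square (Fa ?T) S)))"
        by (simp_all only: map_square_simps Ts KK_simps)
    qed (use e in \<open>simp_all add: Ts\<close>)
    then show "h = k" by simp
  qed
qed

end

text \<open>The hypothesis on the codomain in \<open>ntrans_extension\<close>, for tops of chains.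
  The constant functor sends squares to identity squares at \<open>one C\<close>, and each indexed
  sort hands the property on to its domain.\<close>

lemma chain_top_pullback:
  assumes L: "contextual L" and C: "contextual C" and S: "S \<in> QQ L"
  shows "is_chain L C xs \<Longrightarrow> pullback C (map_square (Fa (chain_top L C xs)) S)"
proof (induction xs)
  case Nil
  interpret L: contextual L by fact
  interpret C: contextual C by fact
  have "map_square (Fa (const_one L C)) S = \<lparr>sTop = Idn C (one C), sBot = Idn C (one C),
      sLft = Idn C (Src C (Idn C (one C))), sRgt = Idn C (Tgt C (Idn C (one C)))\<rparr>"
    using L.QQ_Ar[OF S] by (simp add: map_square_def const_one_def)
  then show ?case using C.pullback_Idn[of "Idn C (one C)"] by simp
next
  case (Cons \<pi> xs)
  interpret L: contextual L by fact
  interpret C: contextual C by fact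
  have c: "is_chain L C xs" "indexed_sort L C \<pi>" "NCod \<pi> = chain_top L C xs" using Cons.prems by simp_all
  interpret display_functor L C "chain_top L C xs"
    by unfold_locales (rule chain_top_disp[OF L.precontextual_axioms C c(1)])
  show ?case using indexed_sort_pullback[OF c(2,3) Cons.IH[OF c(1)] S] by simp
qed

text \<open>Let \<open>T\<close> be the lift of the left side of \<open>V\<close> along the bottom
  of \<open>U\<close>. Both \<open>T\<close> and \<open>U\<close>, pasted with \<open>V\<close>,
  lift the same projection along the same arrow, so they have the same left side; their tops agree
  since \<open>V\<close> is a pullback.\<close>

lemma (in contextual) QQ_cancel:
  assumes U: "comm_square C U" and V: "V \<in> QQ C" and UV: "sRgt U = sLft V"
    and W: "\<lparr>sTop = sTop V \<cdot> sTop U, sBot = sBot V \<cdot> sBot U, sLft = sLft U, sRgt = sRgt V\<rparr> \<in> QQ C"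
  shows "U \<in> QQ C"
proof -
  note cU = comm_squareD[OF U]
  obtain b c where b: "b \<in> Ob C" "1 \<le> Len C b" "sLft V = Pr C b" and c: "c \<in> Ob C" "1 \<le> Len C c" "sRgt V = Pr C c"
    and Vt: "sTop V \<in> hom C b c" "sBot V \<in> hom C (Ft C b) (Ft C c)"
    using QQ_cases[OF V] by metis
  have tU: "Tgt C (sBot U) = Ft C b" using cU(8) UV b by simp
  from Q_lift[OF b(1,2) cU(2) tU] obtain T where T: "T \<in> QQ C" "sRgt T = Pr C b" "sBot T = sBot U" by blast
  note cT = comm_squareD[OF Q_comm[OF T(1)]]
  have TV: "\<lparr>sTop = sTop V \<cdot> sTop T, sBot = sBot V \<cdot> sBot U, sLft = sLft T, sRgt = sRgt V\<rparr> \<in> QQ C"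
    using Q_horizontal[OF T(1) V] T b by simp
  have "sBot V \<cdot> sBot U \<in> Ar C" "Tgt C (sBot V \<cdot> sBot U) = Ft C c" using cU tU Vt by (simp_all add: hom_iff)
  from Q_lift[OF c(1,2) this] obtain Z
    where Z: "\<And>Y. Y \<in> QQ C \<Longrightarrow> sRgt Y = Pr C c \<Longrightarrow> sBot Y = sBot V \<cdot> sBot U \<Longrightarrow> Y = Z" by blast
  have "\<lparr>sTop = sTop V \<cdot> sTop T, sBot = sBot V \<cdot> sBot U, sLft = sLft T, sRgt = sRgt V\<rparr> =
    \<lparr>sTop = sTop V \<cdot> sTop U, sBot = sBot V \<cdot> sBot U, sLft = sLft U, sRgt = sRgt V\<rparr>"
    by (rule trans[OF Z[OF TV] Z[OF W, symmetric]]) (simp_all add: c(3))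
  then have l: "sLft T = sLft U" and t: "sTop V \<cdot> sTop T = sTop V \<cdot> sTop U" by simp_all
  have "sTop T = sTop U"
  proof (rule pullback_unique[OF Q_pullback[OF V]])
    show "sTop T \<in> hom C (Src C (sTop U)) (Src C (sTop V))" "sTop U \<in> hom C (Src C (sTop U)) (Src C (sTop V))"
      using cT cU l T(2) UV b Vt by (simp_all add: hom_iff)
    show "sLft V \<cdot> sTop T = sLft V \<cdot> sTop U" using cT(9) cU(9) T UV b l by simp
  qed (rule t)
  then have "T = U" using l T UV b by (intro square_eqI) simp_all
  then show ?thesis using T by simp
qed

section \<open>Squares of indexed sorts and their fibre squares\<close>

locale indexed_square = A: precontextual A + C: contextual C
  for A :: "('a, 'b, 'x) ctx_scheme" and C :: "('p, 'n, 'z) ctx_scheme" (structure) +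
  fixes S :: "('a, 'b, 'p, 'n) ntrans square"
  assumes comm: "comm_square (disp_fun_cat A C) S"
    and lft: "indexed_sort A C (sLft S)" and rgt: "indexed_sort A C (sRgt S)"
begin

lemmas cS = comm_squareD[OF comm, simplified disp_simps(1,2)]
lemmas lD = indexed_sortD[OF lft]
lemmas rD = indexed_sortD[OF rgt]
lemmas topD = disp_ArD[OF cS(1)]
lemmas botD = disp_ArD[OF cS(2)]
lemmas lftD = disp_ArD[OF cS(3)]
lemmas rgtD = disp_ArD[OF cS(4)]

abbreviation "lsq a \<equiv> natsq A (sLft S) (Pr A a)"
abbreviation "rsq a \<equiv> natsq A (sRgt S) (Pr A a)"

lemma pointwise:
  assumes "a \<in> Ob A"
  shows "NCmp (sRgt S) a \<cdot> NCmp (sTop S) a = NCmp (sBot S) a \<cdot> NCmp (sLft S) a"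
proof -
  have "NCmp (Cmp (disp_fun_cat A C) (sRgt S) (sTop S)) a = NCmp (Cmp (disp_fun_cat A C) (sBot S) (sLft S)) a"
    by (simp only: cS(9))
  then show ?thesis using assms by simp
qed

lemma fibre_cospan:
  assumes a: "a \<in> Ob A" "1 \<le> Len A a"
  shows "cospan_map C (lsq a) (rsq a) (NCmp (sTop S) (Ft A a)) (NCmp (sBot S) a) (NCmp (sBot S) (Ft A a))"
proof -
  note l = C.rel_display1D[OF lD(2)[OF a]] and r = C.rel_display1D[OF rD(2)[OF a]]
  have f: "Ft A a \<in> Ob A" by (rule A.ft_Ob[OF a(1)])
  note fl = fctr_Ar[OF lftD(5) A.Ar_Pr[OF a]] and fr = fctr_Ar[OF rgtD(5) A.Ar_Pr[OF a]]
  show ?thesis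
    unfolding cospan_map_def
    using l(4) r(4) topD(6)[OF f] botD(6)[OF a(1)] botD(6)[OF f] lftD(6)[OF f] rgtD(6)[OF f] pointwise[OF f]
      botD(7)[OF A.Ar_Pr[OF a]] a fl fr cS(5-8) by (simp add: hom_iff)
qed

end

text \<open>Gives a value to the corner map in the square clause of \<open>indexed_sort\<close>.
  With \<open>fibre_cospan\<close> it makes the corner maps around the cube of
  \<open>fibre_square_pull\<close> composable.\<close>

lemma sort_cospan:
  assumes "precontextual A" "contextual C" and \<pi>: "indexed_sort A C \<pi>" and S: "S \<in> QQ A"
  shows "cospan_map C (natsq A \<pi> (sLft S)) (natsq A \<pi> (sRgt S)) (Fa (NDom \<pi>) (sBot S)) (Fa (NCod \<pi>) (sTop S)) (Fa (NCod \<pi>) (sBot S))"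
proof -
  interpret A: precontextual A by fact
  interpret C: contextual C by fact
  note p = indexed_sortD[OF \<pi>]
  note D = disp_ArD[OF p(1)]
  note c = comm_squareD[OF A.Q_comm[OF S]]
  obtain a b where ab: "a \<in> Ob A" "1 \<le> Len A a" "sLft S = Pr A a" "b \<in> Ob A" "1 \<le> Len A b" "sRgt S = Pr A b"
    using A.QQ_cases[OF S] by metis
  have co: "cospan C (natsq A \<pi> (sLft S))" "cospan C (natsq A \<pi> (sRgt S))"
    using C.rel_display1D(4)[OF p(2)[OF ab(1,2)]] C.rel_display1D(4)[OF p(2)[OF ab(4,5)]] ab by simp_all
  have "Fa (NCod \<pi>) (sRgt S) \<cdot>\<^bsub>C\<^esub> Fa (NCod \<pi>) (sTop S) = Fa (NCod \<pi>) (sBot S) \<cdot>\<^bsub>C\<^esub> Fa (NCod \<pi>) (sLft S)"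
    using comm_squareD(9)[OF functor_comm_square[OF D(5) A.Q_comm[OF S]]] by simp
  moreover have "NCmp \<pi> (Src A (sBot S)) \<in> hom C (Fo (NDom \<pi>) (Src A (sBot S))) (Fo (NCod \<pi>) (Src A (sBot S)))"
    "NCmp \<pi> (Tgt A (sBot S)) \<in> hom C (Fo (NDom \<pi>) (Tgt A (sBot S))) (Fo (NCod \<pi>) (Tgt A (sBot S)))"
    using D(6) c(2) by simp_all
  moreover note fctr_Ar[OF D(4) c(2)] fctr_Ar[OF D(5) c(1)] fctr_Ar[OF D(5) c(2)] fctr_Ar[OF D(5) c(3)] fctr_Ar[OF D(5) c(4)]
  ultimately show ?thesis
    unfolding cospan_map_def using co D(7)[OF c(2)] c(5-8) by (simp add: hom_iff)
qed

context indexed_square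
begin

text \<open>\<open>QQ_cancel\<close> starts from a commutative square; commutativity is naturality
  of the gap maps with respect to the top and bottom transformations.\<close>

lemma fibre_square_comm:
  assumes a: "a \<in> Ob A" "1 \<le> Len A a"
  shows "comm_square C (fibre_square A C S a)"
proof -
  note l = C.rel_display1D[OF lD(2)[OF a]] and r = C.rel_display1D[OF rD(2)[OF a]]
  note gl = C.gap[OF l(1,2)] and gr = C.gap[OF r(1,2)]
  note cm = C.corner_map[OF fibre_cospan[OF a]]
  have t: "NCmp (sTop S) a \<in> hom C (Src C (sTop (lsq a))) (Src C (sTop (rsq a)))"
    using topD(6)[OF a(1)] lftD(6)[OF a(1)] rgtD(6)[OF a(1)] cS(5,6) a by (simp add: hom_iff)
  have "gap C (rsq a) \<cdot> NCmp (sTop S) a =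
      corner_map C (lsq a) (rsq a) (NCmp (sTop S) (Ft A a)) (NCmp (sBot S) a) \<cdot> gap C (lsq a)"
  proof (rule C.gap_natural[OF l(1,2) r(1,2) fibre_cospan[OF a] t])
    show "sLft (rsq a) \<cdot> NCmp (sTop S) a = NCmp (sTop S) (Ft A a) \<cdot> sLft (lsq a)"
      using topD(7)[OF A.Ar_Pr[OF a]] cS(5,6) a by simp
    show "sTop (rsq a) \<cdot> NCmp (sTop S) a = NCmp (sBot S) a \<cdot> sTop (lsq a)"
      using pointwise[OF a(1)] a by simp
  qed
  then show ?thesis
    using gl(1) gr(1) cm(1) t unfolding fibre_square_def comm_square_def by (simp add: hom_iff)
qed

text \<open>
  The squares at \<open>a\<close> and \<open>b\<close> are the sides of a cube whose other two sides are the squares that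
  the indexed sorts assign to \<open>R\<close>; so the square at \<open>a\<close> is distinguished by cancellation.
\<close>

lemma fibre_square_pull:
  assumes R: "R \<in> QQ A" "sLft R = Pr A a" "sRgt R = Pr A b"
    and a: "a \<in> Ob A" "1 \<le> Len A a" and b: "b \<in> Ob A" "1 \<le> Len A b"
    and fb: "fibre_square A C S b \<in> distinguished C"
  shows "fibre_square A C S a \<in> distinguished C"
proof -
  note lb = C.rel_display1D[OF lD(2)[OF b]] and rb = C.rel_display1D[OF rD(2)[OF b]]
  note c = comm_squareD[OF A.Q_comm[OF R(1)]]
  have st: "Src A (sTop R) = a" "Tgt A (sTop R) = b" "Src A (sBot R) = Ft A a" "Tgt A (sBot R) = Ft A b"
    using c(5-8) R a b by simp_all
  let ?G' = "NDom (sLft S)" and ?F' = "NCod (sLft S)" and ?G = "NDom (sRgt S)" and ?F = "NCod (sRgt S)"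
  have WL: "\<lparr>sTop = Fa ?G' (sTop R), sBot = corner_map C (lsq a) (lsq b) (Fa ?G' (sBot R)) (Fa ?F' (sTop R)),
       sLft = gap C (lsq a), sRgt = gap C (lsq b)\<rparr> \<in> QQ C" (is "?WL \<in> _")
    by (rule C.distinguished_QQ[OF _ _ lb(5,6)]) (use lD(3)[OF R(1)] R lb(7) in simp_all)
  have WR: "\<lparr>sTop = Fa ?G (sTop R), sBot = corner_map C (rsq a) (rsq b) (Fa ?G (sBot R)) (Fa ?F (sTop R)),
       sLft = gap C (rsq a), sRgt = gap C (rsq b)\<rparr> \<in> QQ C" (is "?WR \<in> _")
    by (rule C.distinguished_QQ[OF _ _ rb(5,6)]) (use rD(3)[OF R(1)] R rb(7) in simp_all)
  have Fb: "fibre_square A C S b \<in> QQ C"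
    by (rule C.distinguished_QQ[OF fb _ rb(5,6)]) (simp add: fibre_square_def rb(7))
  note cl = sort_cospan[OF A.precontextual_axioms C.contextual_axioms lft R(1), unfolded R(2,3)]
  note cr = sort_cospan[OF A.precontextual_axioms C.contextual_axioms rgt R(1), unfolded R(2,3)]
  \<comment> \<open>Naturality of the top and bottom transformations at \<open>R\<close>. The first
    equation matches the tops of the two ways round the cube, the other two match the legs of the
    corner maps.\<close>
  have e1: "NCmp (sTop S) b \<cdot> Fa ?G' (sTop R) = Fa ?G (sTop R) \<cdot> NCmp (sTop S) a"
    "NCmp (sTop S) (Ft A b) \<cdot> Fa ?G' (sBot R) = Fa ?G (sBot R) \<cdot> NCmp (sTop S) (Ft A a)"
    "NCmp (sBot S) b \<cdot> Fa ?F' (sTop R) = Fa ?F (sTop R) \<cdot> NCmp (sBot S) a"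
    using topD(7)[OF c(1)] topD(7)[OF c(2)] botD(7)[OF c(1)] st cS(5-8) by simp_all
  \<comment> \<open>One way round the cube: the square of the left sort at \<open>R\<close>, then
    the fibre square at \<open>b\<close>. The other way is the fibre square at \<open>a\<close>
    followed by the square of the right sort, which is cancelled.\<close>
  have "\<lparr>sTop = sTop (fibre_square A C S b) \<cdot> sTop ?WL, sBot = sBot (fibre_square A C S b) \<cdot> sBot ?WL,
      sLft = sLft ?WL, sRgt = sRgt (fibre_square A C S b)\<rparr> \<in> QQ C"
    by (rule C.Q_horizontal[OF WL Fb]) (simp add: fibre_square_def)
  moreover have "sTop (fibre_square A C S b) \<cdot> sTop ?WL = sTop ?WR \<cdot> sTop (fibre_square A C S a)"
    using e1(1) by (simp add: fibre_square_def)
  moreover have "sBot (fibre_square A C S b) \<cdot> sBot ?WL = sBot ?WR \<cdot> sBot (fibre_square A C S a)"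
    using C.corner_map_Cmp[OF cl fibre_cospan[OF b]] C.corner_map_Cmp[OF fibre_cospan[OF a] cr] e1(2,3)
    by (simp add: fibre_square_def)
  ultimately have "\<lparr>sTop = sTop ?WR \<cdot> sTop (fibre_square A C S a), sBot = sBot ?WR \<cdot> sBot (fibre_square A C S a),
      sLft = sLft (fibre_square A C S a), sRgt = sRgt ?WR\<rparr> \<in> QQ C"
    by (simp add: fibre_square_def)
  then have "fibre_square A C S a \<in> QQ C"
    by (intro C.QQ_cancel[OF fibre_square_comm[OF a] WR]) (simp add: fibre_square_def)
  then show ?thesis by (rule C.QQ_distinguished)
qed

end

text \<open>Lengths, fathers and projections of the inverse follow from bijectivity. Membership in
  \<open>QQ\<close> does not, so it has to be reflected, along commutative squares.\<close>

lemma ctx_isoI: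
  assumes X: "precontextual X" and Y: "precontextual Y" and F: "F \<in> ctx_functors X Y"
    and ob: "bij_betw (Fo F) (Ob X) (Ob Y)" and ar: "bij_betw (Fa F) (Ar X) (Ar Y)"
    and refl: "\<And>S. comm_square X S \<Longrightarrow> map_square (Fa F) S \<in> QQ Y \<Longrightarrow> S \<in> QQ X"
  shows "ctx_iso X Y F"
proof -
  interpret X: precontextual X by fact
  interpret Y: precontextual Y by fact
  note f = ctx_functorsD[OF F]
  define io where "io = the_inv_into (Ob X) (Fo F)"
  define ia where "ia = the_inv_into (Ar X) (Fa F)"
  have ob_inj: "inj_on (Fo F) (Ob X)" and ar_inj: "inj_on (Fa F) (Ar X)" using ob ar by (simp_all add: bij_betw_def)
  have io: "io b \<in> Ob X" "Fo F (io b) = b" if "b \<in> Ob Y" for b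
    using that ob unfolding io_def by (auto simp: bij_betw_def intro: the_inv_into_into f_the_inv_into_f)
  have ia: "ia g \<in> Ar X" "Fa F (ia g) = g" if "g \<in> Ar Y" for g
    using that ar unfolding ia_def by (auto simp: bij_betw_def intro: the_inv_into_into f_the_inv_into_f)
  have io': "io (Fo F a) = a" if "a \<in> Ob X" for a using that ob_inj by (simp add: io_def the_inv_into_f_f)
  have ia': "ia (Fa F g) = g" if "g \<in> Ar X" for g using that ar_inj by (simp add: ia_def the_inv_into_f_f)
  have oeq: "a = a'" if "a \<in> Ob X" "a' \<in> Ob X" "Fo F a = Fo F a'" for a a' using inj_onD[OF ob_inj that(3,1,2)] .
  have aeq: "a = a'" if "a \<in> Ar X" "a' \<in> Ar X" "Fa F a = Fa F a'" for a a' using inj_onD[OF ar_inj that(3,1,2)] .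
  let ?G = "\<lparr>Fo = restrict io (Ob Y), Fa = restrict ia (Ar Y)\<rparr>"
  have srctgt: "Src X (ia g) = io (Src Y g)" "Tgt X (ia g) = io (Tgt Y g)" if g: "g \<in> Ar Y" for g
    using fctr_Ar(2,3)[OF f(1) ia(1)[OF g]] io'[of "Src X (ia g)"] io'[of "Tgt X (ia g)"] ia[OF g] by simp_all
  have GF: "?G \<in> functors Y X"
  proof (rule functorsI)
    fix b assume b: "b \<in> Ob Y"
    show "Fa ?G (Idn Y b) = Idn X (Fo ?G b)"
      using b io[OF b] ia'[of "Idn X (io b)"] fctr_Idn[OF f(1) io(1)[OF b]] by simp
  next
    fix g h assume gh: "g \<in> Ar Y" "h \<in> Ar Y" "Src Y h = Tgt Y g"
    note i = ia[OF gh(1)] ia[OF gh(2)]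
    have c: "Src X (ia h) = Tgt X (ia g)" using srctgt gh by simp
    have "Fa F (Cmp X (ia h) (ia g)) = Cmp Y h g" using fctr_Cmp[OF f(1) i(1,3) c] i by simp
    then show "Fa ?G (Cmp Y h g) = Cmp X (Fa ?G h) (Fa ?G g)"
      using ia'[OF X.Ar_Cmp[OF i(1,3) c]] gh by simp
  qed (simp_all add: io ia srctgt hom_iff)
  have G: "?G \<in> ctx_functors Y X"
    unfolding ctx_functors_def
  proof (intro CollectI conjI ballI impI GF)
    fix b assume b: "b \<in> Ob Y"
    note i = io[OF b]
    show "Len X (Fo ?G b) = Len Y b" using f(2)[OF i(1)] i b by simp
    show "Fo ?G (Ft Y b) = Ft X (Fo ?G b)"
      using f(3)[OF i(1)] i b io'[OF X.ft_Ob[OF i(1)]] Y.ft_Ob[OF b] by simp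
    show "Fa ?G (Pr Y b) = Pr X (Fo ?G b)" if l: "1 \<le> Len Y b"
    proof -
      have l': "1 \<le> Len X (io b)" using l f(2)[OF i(1)] i by simp
      show ?thesis using f(4)[OF i(1) l'] i b ia'[OF X.Ar_Pr[OF i(1) l']] Y.Ar_Pr[OF b l] by simp
    qed
  next
    fix T assume T: "T \<in> QQ Y"
    note A = Y.QQ_Ar[OF T]
    have e: "map_square (Fa F) (map_square (Fa ?G) T) = T" using A ia by (intro square_eqI) simp_all
    show "map_square (Fa ?G) T \<in> QQ X"
      by (rule refl[OF functor_comm_square[OF GF Y.Q_comm[OF T]]]) (unfold e, rule T)
  qed
  have "comp_fctr X ?G F = id_fctr X"
    by (rule fctr_eqI[OF X.comp_fctr_functors[OF f(1) GF] X.id_fctr_functors])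
      (simp_all add: fctr_Ob[OF f(1)] fctr_Ar[OF f(1)] io' ia')
  moreover have "comp_fctr Y F ?G = id_fctr Y"
    by (rule fctr_eqI[OF Y.comp_fctr_functors[OF GF f(1)] Y.id_fctr_functors]) (simp_all add: io ia)
  ultimately show ?thesis unfolding ctx_iso_def using F G by blast
qed

theorem proposition5p32:
  fixes A C L :: "('u, 'u) ctx" and \<iota> :: "('u, 'u, 'u, 'u) fctr"
  assumes "infinite (UNIV :: 'u set)"
    and "precontextual A"
    and "contextual C"
    and "reflection A L \<iota>"
  shows "ctx_iso (exponential L C) (exponential A C) (exponential_map A L C \<iota>)"
proof -
  note inf = assms(1) and A = assms(2) and C = assms(3) and R = assms(4)
  interpret A: precontextual A by fact
  interpret C: contextual C by fact
  have Lc: "contextual L" and \<iota>: "\<iota> \<in> ctx_functors A L" using R by (simp_all add: reflection_def)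
  interpret L: contextual L by fact
  interpret precomposition A L C \<iota> by unfold_locales (rule \<iota>)
  let ?XL = "exponential L C" and ?XA = "exponential A C"
  note Lp = L.precontextual_axioms
  have XL: "precontextual ?XL" and XA: "precontextual ?XA" by (rule precontextual_exponential[OF Lp C], rule precontextual_exponential[OF A C])
  note top = chain_top_disp[OF Lp C]
  \<comment> \<open>Once the tails agree, the two heads extend the same indexed sort over the same
    codomain.\<close>
  have chain_inj: "xs = ys" if "is_chain L C xs" "is_chain L C ys" "map w xs = map w ys" for xs ys
    using that
  proof (induction xs arbitrary: ys)
    case (Cons p xs)
    then obtain q zs where ys: "ys = q # zs" by (cases ys) auto
    have xz: "xs = zs" using Cons ys by simp
    have p: "indexed_sort L C p" "NCod p = chain_top L C xs" and q: "indexed_sort L C q" "NCod q = chain_top L C xs"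
      and xs: "is_chain L C xs" and pq: "w p = w q" using Cons.prems ys xz by simp_all
    have "\<exists>!r. indexed_sort L C r \<and> NCod r = chain_top L C xs \<and> w r = w p"
      by (rule indexed_sort_extension[OF inf A C R top[OF xs] whisker_indexed_sort[OF p(1)]]) (simp add: p(2))
    then have "p = q" using p q pq by auto
    then show ?case using ys xz by simp
  qed simp
  \<comment> \<open>The chain is extended one sort at a time, each over the top functor of the chain
    already found for its tail.\<close>
  have chain_ex: "\<exists>xs. is_chain L C xs \<and> map w xs = ys" if "is_chain A C ys" for ys
    using that
  proof (induction ys)
    case Nil
    show ?case by (rule exI[of _ "[]"]) simp
  next
    case (Cons q ys)
    then obtain xs where xs: "is_chain L C xs" "map w xs = ys" by auto
    have q: "indexed_sort A C q" "NCod q = comp_fctr A (chain_top L C xs) \<iota>"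
      using Cons.prems chain_top_whisker[of xs] xs(2) by simp_all
    obtain p where "indexed_sort L C p" "NCod p = chain_top L C xs" "w p = q"
      using indexed_sort_extension[OF inf A C R top[OF xs(1)] q] by blast
    then show ?case using xs by (intro exI[of _ "p # xs"]) simp
  qed
  \<comment> \<open>The codomain is the top of a chain, so it sends \<open>QQ\<close> to pullbacks
    as \<open>ntrans_extension\<close> demands.\<close>
  have nt_ex1: "\<exists>!\<tau>. \<tau> \<in> hom (disp_fun_cat L C) (chain_top L C xs) (chain_top L C ys) \<and> w \<tau> = \<sigma>"
    if xs: "is_chain L C xs" and ys: "is_chain L C ys"
      and \<sigma>: "\<sigma> \<in> hom (disp_fun_cat A C) (chain_top A C (map w xs)) (chain_top A C (map w ys))" for xs ys \<sigma>
    using ntrans_extension[OF inf A C R top[OF xs] top[OF ys] chain_top_pullback[OF Lc C _ ys]] \<sigma>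
    by (simp add: chain_top_whisker)
  \<comment> \<open>An arrow of the exponential remembers its two chains; \<open>chain_inj\<close>
    must identify these before the transformations can be compared.\<close>
  have ar_inj: "inj_on (Fa EE) (Ar ?XL)"
  proof (rule inj_onI)
    fix f g assume f: "f \<in> Ar ?XL" and g: "g \<in> Ar ?XL" and e: "Fa EE f = Fa EE g"
    have "\<lparr>XSrc = map w (XSrc f), XTgt = map w (XTgt f), XNt = w (XNt f)\<rparr> =
        \<lparr>XSrc = map w (XSrc g), XTgt = map w (XTgt g), XNt = w (XNt g)\<rparr>"
      using e by (simp only: EE_simps(2)[OF f] EE_simps(2)[OF g])
    then have h: "map w (XSrc f) = map w (XSrc g)" "map w (XTgt f) = map w (XTgt g)" "w (XNt f) = w (XNt g)"
      by simp_all
    have cf: "is_chain L C (XSrc f)" "is_chain L C (XTgt f)" and cg: "is_chain L C (XSrc g)" "is_chain L C (XTgt g)"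
      using f g by simp_all
    have s: "XSrc f = XSrc g" "XTgt f = XTgt g"
      by (rule chain_inj[OF cf(1) cg(1) h(1)], rule chain_inj[OF cf(2) cg(2) h(2)])
    have tf: "XNt f \<in> hom (disp_fun_cat L C) (chain_top L C (XSrc f)) (chain_top L C (XTgt f))"
      and tg: "XNt g \<in> hom (disp_fun_cat L C) (chain_top L C (XSrc f)) (chain_top L C (XTgt f))"
      using f g s by simp_all
    have "w (XNt f) \<in> hom (disp_fun_cat A C) (chain_top A C (map w (XSrc f))) (chain_top A C (map w (XTgt f)))"
      using whisker_hom[OF tf] by (simp add: chain_top_whisker)
    from nt_ex1[OF cf this] have "XNt f = XNt g" using tf tg h(3) by auto
    then show "f = g" using s by simp
  qed
  have ob_bij: "bij_betw (Fo EE) (Ob ?XL) (Ob ?XA)"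
  proof (rule bij_betwI')
    show "(Fo EE xs = Fo EE ys) = (xs = ys)" if "xs \<in> Ob ?XL" "ys \<in> Ob ?XL" for xs ys
      using that chain_inj[of xs ys] by auto
    show "Fo EE xs \<in> Ob ?XA" if "xs \<in> Ob ?XL" for xs using that by (simp add: is_chain_whisker)
    show "\<exists>xs\<in>Ob ?XL. ys = Fo EE xs" if ys: "ys \<in> Ob ?XA" for ys
    proof -
      obtain xs where "is_chain L C xs" "map w xs = ys" using chain_ex[of ys] ys by auto
      then show ?thesis by (intro bexI[of _ xs]) simp_all
    qed
  qed
  have ar_surj: "\<exists>f \<in> Ar ?XL. Fa EE f = g" if g: "g \<in> Ar ?XA" for g
  proof -
    obtain xs ys where xs: "is_chain L C xs" "map w xs = XSrc g" and ys: "is_chain L C ys" "map w ys = XTgt g"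
      using chain_ex[of "XSrc g"] chain_ex[of "XTgt g"] g by auto
    have "XNt g \<in> hom (disp_fun_cat A C) (chain_top A C (map w xs)) (chain_top A C (map w ys))"
      using g by (simp add: xs(2) ys(2))
    from nt_ex1[OF xs(1) ys(1) this] obtain \<tau> where \<tau>: "\<tau> \<in> hom (disp_fun_cat L C) (chain_top L C xs) (chain_top L C ys)"
      "w \<tau> = XNt g" by blast
    have f: "\<lparr>XSrc = xs, XTgt = ys, XNt = \<tau>\<rparr> \<in> Ar ?XL" using xs ys \<tau> by simp
    have "Fa EE \<lparr>XSrc = xs, XTgt = ys, XNt = \<tau>\<rparr> = g"
      unfolding EE_simps(2)[OF f] using xs(2) ys(2) \<tau>(2) by simp
    then show ?thesis using f by blast
  qed
  have ar_bij: "bij_betw (Fa EE) (Ar ?XL) (Ar ?XA)"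
    unfolding bij_betw_def
  proof
    show "inj_on (Fa EE) (Ar ?XL)" by (rule ar_inj)
    show "Fa EE ` Ar ?XL = Ar ?XA" using fctr_Ar(1)[OF EE_functor] ar_surj by blast
  qed
  show ?thesis
  proof (rule ctx_isoI[OF XL XA EE_ctx_functor ob_bij ar_bij])
    fix S assume S: "comm_square ?XL S" and Q: "map_square (Fa EE) S \<in> QQ ?XA"
    \<comment> \<open>The image of \<open>e\<close> is also the image of the projection of the
      lifted chain, and \<open>Fa EE\<close> is injective on arrows, so \<open>e\<close> is that
      projection.\<close>
    have proj: "\<exists>xs. is_chain L C xs \<and> 1 \<le> length xs \<and> e = chain_proj xs"
      if e: "e \<in> Ar ?XL" "\<exists>ys. is_chain A C ys \<and> 1 \<le> length ys \<and> Fa EE e = chain_proj ys" for e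
    proof -
      obtain ys where ys: "is_chain A C ys" "1 \<le> length ys" "Fa EE e = chain_proj ys" using e(2) by blast
      obtain xs where xs: "is_chain L C xs" "map w xs = ys" using chain_ex[OF ys(1)] by blast
      have l: "1 \<le> length xs" using ys(2) unfolding xs(2)[symmetric] by simp
      have "chain_proj xs \<in> Ar ?XL" using chain_proj_hom[OF xs(1) l] by (simp only: hom_iff)
      moreover have "Fa EE e = Fa EE (chain_proj xs)" using EE_chain_proj[OF xs(1) l] ys(3) xs(2) by simp
      ultimately have "e = chain_proj xs" using inj_onD[OF ar_inj] e(1) by blast
      then show ?thesis using xs(1) l by blast
    qed
    note c = comm_squareD[OF S]
    have Q': "\<exists>xs. is_chain A C xs \<and> 1 \<le> length xs \<and> Fa EE (sLft S) = chain_proj xs"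
      "\<exists>ys. is_chain A C ys \<and> 1 \<le> length ys \<and> Fa EE (sRgt S) = chain_proj ys"
      and d: "indexed_distinguished A C (map_square w (map_square XNt S))"
      using Q by (simp_all add: exponential_QQ XNt_EE[OF S])
    obtain xs where xs: "is_chain L C xs" "1 \<le> length xs" "sLft S = chain_proj xs" using proj[OF c(3) Q'(1)] by blast
    obtain ys where ys: "is_chain L C ys" "1 \<le> length ys" "sRgt S = chain_proj ys" using proj[OF c(4) Q'(2)] by blast
    have sorts: "indexed_sort L C (sLft (map_square XNt S))" "indexed_sort L C (sRgt (map_square XNt S))"
      using xs ys by (cases xs; cases ys; simp add: chain_proj_def)+
    interpret indexed_square L C "map_square XNt S"
      by unfold_locales (rule XNt_comm_square[OF S] sorts)+
    \<comment> \<open>At objects from \<open>A\<close> this is the assumption on the image square,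
      by \<open>fibre_square_whisker\<close>; pulled back objects inherit it by
      \<open>fibre_square_pull\<close>.\<close>
    have "fibre_square L C (map_square XNt S) a \<in> distinguished C" if a: "a \<in> Ob L" "1 \<le> Len L a" for a
    proof (rule reflection_induct[OF inf A R _ _ a])
      fix b assume b: "b \<in> Ob A" "1 \<le> Len A b"
      show "fibre_square L C (map_square XNt S) (Fo \<iota> b) \<in> distinguished C"
        using d fibre_square_whisker[OF b, of "map_square XNt S"] b unfolding indexed_distinguished_iff by auto
    next
      fix R a b assume h: "R \<in> QQ L" "a \<in> Ob L" "1 \<le> Len L a" "b \<in> Ob L" "1 \<le> Len L b" "sLft R = Pr L a" "sRgt R = Pr L b"
        "fibre_square L C (map_square XNt S) b \<in> distinguished C"
      show "fibre_square L C (map_square XNt S) a \<in> distinguished C" by (rule fibre_square_pull[OF h(1,6,7,2-5,8)])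
    qed
    then have "indexed_distinguished L C (map_square XNt S)"
      using XNt_comm_square[OF S] sorts unfolding indexed_distinguished_iff by simp
    then show "S \<in> QQ ?XL" unfolding exponential_QQ using S xs ys by blast
  qed
qed

end
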